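(* Let $G$ be a graph that does not contain infinitely many pairwise vertex-disjoint rays, let $\Psi$ be a set of ends of $G$, and suppose the $\Psi$-system $M=M(G,\Psi)=(E(G),\mathcal{L})$ is a matroid. Then $M$ is $k$-nearly finitary for some $k\in\mathbb{N}$.
   Context: A ray is a one-way infinite path; two rays are equivalent if for every finite set $S$ of vertices they have tails in the same component of $G-S$; an end is an equivalence class, and $\Omega(G)$ is the set of ends. The space $|G|$ has underlying set $V(G)\sqcup\Omega(G)\sqcup (0,1)\times E(G)$ (edges realized as unit intervals between their endvertices), with topology given by: metric $\epsilon$-balls ($\epsilon\le 1$) around vertices and around interior points of edges, and, for an end $\omega$ and a finite vertex set $S$, the basic open set $\hat C(S,\omega)$ consisting of the component $C(S,\omega)$ of $G-S$ containing a ray of $\omega$, together with all vertices and interior points of edges in or incident with it and all ends represented by rays in it. For $\Psi\subseteq\Omega(G)$ let $|G|_\Psi=|G|\setminus(\Omega(G)\setminus\Psi)$, regarded with vertex set $V(G)\cup\Psi$ and edge set $E(G)$. Declare two points $v,v'$ of $V(G)\cup\Psi$ equivalent if every partition of $V(G)\cup\Psi$ into two disjoint open subsets of $|G|_\Psi$ puts $v,v'$ in the same part, and let $\tilde G_\Psi$ be the quotient. The $\Psi$-system $M(G,\Psi)$ has ground set $E(G)$, and a set of edges is independent iff it contains no set of the form $\{e\in E(G): \text{the interior of } e \subseteq C\}$ with $C$ a topological circle (homeomorphic image of $S^1$) in $\tilde G_\Psi$. Matroid axioms: $\emptyset$ independent; subsets of independent sets independent; if $B$ is maximal and $A$ non-maximal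 independent then $A\cup\{b\}$ independent for some $b\in B\setminus A$; for independent $A\subseteq X\subseteq E$ a maximal independent $S$ with $A\subseteq S\subseteq X$ exists. Bases are maximal independent sets; $M^{\mathrm{fin}}$ has as independent sets the sets all of whose finite subsets are independent in $M$; $M$ is $k$-nearly finitary if $|F\setminus B|\le k$ whenever a base $F$ of $M^{\mathrm{fin}}$ contains a base $B$ of $M$. *)

theory Defs
  imports "HOL-Analysis.Analysis"
begin

text \<open>A graph is given by a vertex set V, an edge set E and, for every edge, its two
  endvertices src e and tgt e (the orientation is only used to parametrise the edge as
  a unit interval).  Graphs are simple: no loops and no parallel edges.\<close>

definition simple_graph :: "'v set \<Rightarrow> 'e set \<Rightarrow> ('e \<Rightarrow> 'v) \<Rightarrow> ('e \<Rightarrow> 'v) \<Rightarrow> bool" where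
  "simple_graph V E src tgt \<longleftrightarrow>
     (\<forall>e\<in>E. src e \<in> V \<and> tgt e \<in> V \<and> src e \<noteq> tgt e) \<and>
     (\<forall>e\<in>E. \<forall>f\<in>E. {src e, tgt e} = {src f, tgt f} \<longrightarrow> e = f)"

definition adj :: "'e set \<Rightarrow> ('e \<Rightarrow> 'v) \<Rightarrow> ('e \<Rightarrow> 'v) \<Rightarrow> 'v \<Rightarrow> 'v \<Rightarrow> bool" where
  "adj E src tgt u w \<longleftrightarrow> (\<exists>e\<in>E. {src e, tgt e} = {u, w})"

definition conn_avoid :: "'v set \<Rightarrow> 'e set \<Rightarrow> ('e \<Rightarrow> 'v) \<Rightarrow> ('e \<Rightarrow> 'v) \<Rightarrow> 'v set \<Rightarrow> 'v \<Rightarrow> 'v \<Rightarrow> bool" where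
  "conn_avoid V E src tgt S u w \<longleftrightarrow> u \<in> V - S \<and>
     (u, w) \<in> {(x, y). x \<in> V - S \<and> y \<in> V - S \<and> adj E src tgt x y}\<^sup>*"

definition is_ray :: "'v set \<Rightarrow> 'e set \<Rightarrow> ('e \<Rightarrow> 'v) \<Rightarrow> ('e \<Rightarrow> 'v) \<Rightarrow> (nat \<Rightarrow> 'v) \<Rightarrow> bool" where
  "is_ray V E src tgt r \<longleftrightarrow> inj r \<and> range r \<subseteq> V \<and> (\<forall>n. adj E src tgt (r n) (r (Suc n)))"

definition tails_same_comp ::
  "'v set \<Rightarrow> 'e set \<Rightarrow> ('e \<Rightarrow> 'v) \<Rightarrow> ('e \<Rightarrow> 'v) \<Rightarrow> 'v set \<Rightarrow> (nat \<Rightarrow> 'v) \<Rightarrow> (nat \<Rightarrow> 'v) \<Rightarrow> bool" where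
  "tails_same_comp V E src tgt S r r' \<longleftrightarrow>
     (\<exists>n. (\<forall>m\<ge>n. r m \<notin> S \<and> r' m \<notin> S) \<and> conn_avoid V E src tgt S (r n) (r' n))"

definition ray_equiv :: "'v set \<Rightarrow> 'e set \<Rightarrow> ('e \<Rightarrow> 'v) \<Rightarrow> ('e \<Rightarrow> 'v) \<Rightarrow> (nat \<Rightarrow> 'v) \<Rightarrow> (nat \<Rightarrow> 'v) \<Rightarrow> bool" where
  "ray_equiv V E src tgt r r' \<longleftrightarrow>
     (\<forall>S. finite S \<and> S \<subseteq> V \<longrightarrow> tails_same_comp V E src tgt S r r')"

definition graph_ends :: "'v set \<Rightarrow> 'e set \<Rightarrow> ('e \<Rightarrow> 'v) \<Rightarrow> ('e \<Rightarrow> 'v) \<Rightarrow> (nat \<Rightarrow> 'v) set set" where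
  "graph_ends V E src tgt =
     {{r'. is_ray V E src tgt r' \<and> ray_equiv V E src tgt r r'} | r. is_ray V E src tgt r}"

definition inf_disjoint_rays :: "'v set \<Rightarrow> 'e set \<Rightarrow> ('e \<Rightarrow> 'v) \<Rightarrow> ('e \<Rightarrow> 'v) \<Rightarrow> bool" where
  "inf_disjoint_rays V E src tgt \<longleftrightarrow>
     (\<exists>R :: nat \<Rightarrow> nat \<Rightarrow> 'v. (\<forall>i. is_ray V E src tgt (R i)) \<and>
        (\<forall>i j. i \<noteq> j \<longrightarrow> range (R i) \<inter> range (R j) = {}))"

datatype ('v, 'e) gpoint = Vx 'v | Ed 'e real | En "(nat \<Rightarrow> 'v) set"

definition comp_of_end ::
  "'v set \<Rightarrow> 'e set \<Rightarrow> ('e \<Rightarrow> 'v) \<Rightarrow> ('e \<Rightarrow> 'v) \<Rightarrow> 'v set \<Rightarrow> (nat \<Rightarrow> 'v) set \<Rightarrow> 'v set" where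
  "comp_of_end V E src tgt S \<omega> =
     {w. \<exists>r\<in>\<omega>. \<exists>n. (\<forall>m\<ge>n. r m \<notin> S) \<and> conn_avoid V E src tgt S (r n) w}"

definition hatC ::
  "'v set \<Rightarrow> 'e set \<Rightarrow> ('e \<Rightarrow> 'v) \<Rightarrow> ('e \<Rightarrow> 'v) \<Rightarrow> 'v set \<Rightarrow> (nat \<Rightarrow> 'v) set \<Rightarrow> ('v, 'e) gpoint set" where
  "hatC V E src tgt S \<omega> =
     (let C = comp_of_end V E src tgt S \<omega> in
       Vx ` C \<union>
       {Ed e t | e t. e \<in> E \<and> 0 < t \<and> t < 1 \<and> (src e \<in> C \<or> tgt e \<in> C)} \<union>
       {En \<omega>' | \<omega>'. \<omega>' \<in> graph_ends V E src tgt \<and> (\<exists>r\<in>\<omega>'. range r \<subseteq> C)})"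

text \<open>Generating family of open sets of |G|: epsilon-balls around vertices (open stars of
  radius eps), epsilon-balls around inner points of edges (open subintervals of the edge;
  these generate the same topology as all metric balls of radius at most 1), and the
  sets \<open>\<hat>C(S, omega)\<close>.\<close>
definition basic_opens :: "'v set \<Rightarrow> 'e set \<Rightarrow> ('e \<Rightarrow> 'v) \<Rightarrow> ('e \<Rightarrow> 'v) \<Rightarrow> ('v, 'e) gpoint set set" where
  "basic_opens V E src tgt =
     {{Vx v} \<union> {Ed e t | e t. e \<in> E \<and> 0 < t \<and> t < 1 \<and>
                    ((src e = v \<and> t < \<epsilon>) \<or> (tgt e = v \<and> 1 - t < \<epsilon>))}
        | v \<epsilon>. v \<in> V \<and> 0 < \<epsilon> \<and> \<epsilon> \<le> 1}
   \<union> {{Ed e s | s. 0 < s \<and> s < 1 \<and> \<bar>s - t\<bar> < \<epsilon>} | e t \<epsilon>. e \<in> E \<and> 0 < t \<and> t < 1 \<and> 0 < \<epsilon> \<and> \<epsilon> \<le> 1}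
   \<union> {hatC V E src tgt S \<omega> | S \<omega>. finite S \<and> S \<subseteq> V \<and> \<omega> \<in> graph_ends V E src tgt}"

definition graph_space :: "'v set \<Rightarrow> 'e set \<Rightarrow> ('e \<Rightarrow> 'v) \<Rightarrow> ('e \<Rightarrow> 'v) \<Rightarrow> ('v, 'e) gpoint topology" where
  "graph_space V E src tgt = topology_generated_by (basic_opens V E src tgt)"

definition graph_space_Psi ::
  "'v set \<Rightarrow> 'e set \<Rightarrow> ('e \<Rightarrow> 'v) \<Rightarrow> ('e \<Rightarrow> 'v) \<Rightarrow> (nat \<Rightarrow> 'v) set set \<Rightarrow> ('v, 'e) gpoint topology" where
  "graph_space_Psi V E src tgt \<Psi> =
     subtopology (graph_space V E src tgt)
       (topspace (graph_space V E src tgt) - En ` (graph_ends V E src tgt - \<Psi>))"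

definition VPsi_points :: "'v set \<Rightarrow> (nat \<Rightarrow> 'v) set set \<Rightarrow> ('v, 'e) gpoint set" where
  "VPsi_points V \<Psi> = Vx ` V \<union> En ` \<Psi>"

definition pt_equiv ::
  "'v set \<Rightarrow> 'e set \<Rightarrow> ('e \<Rightarrow> 'v) \<Rightarrow> ('e \<Rightarrow> 'v) \<Rightarrow> (nat \<Rightarrow> 'v) set set \<Rightarrow> ('v, 'e) gpoint \<Rightarrow> ('v, 'e) gpoint \<Rightarrow> bool" where
  "pt_equiv V E src tgt \<Psi> x y \<longleftrightarrow>
     x \<in> VPsi_points V \<Psi> \<and> y \<in> VPsi_points V \<Psi> \<and>
     (\<forall>O1 O2. openin (graph_space_Psi V E src tgt \<Psi>) O1 \<and> openin (graph_space_Psi V E src tgt \<Psi>) O2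
        \<and> O1 \<inter> O2 = {} \<and> VPsi_points V \<Psi> \<subseteq> O1 \<union> O2 \<longrightarrow> (x \<in> O1 \<longleftrightarrow> y \<in> O1))"

definition pt_class ::
  "'v set \<Rightarrow> 'e set \<Rightarrow> ('e \<Rightarrow> 'v) \<Rightarrow> ('e \<Rightarrow> 'v) \<Rightarrow> (nat \<Rightarrow> 'v) set set \<Rightarrow> ('v, 'e) gpoint \<Rightarrow> ('v, 'e) gpoint set" where
  "pt_class V E src tgt \<Psi> x =
     (if x \<in> VPsi_points V \<Psi> then {y. pt_equiv V E src tgt \<Psi> x y} else {x})"

definition quotient_top :: "'a topology \<Rightarrow> ('a \<Rightarrow> 'b) \<Rightarrow> 'b topology" where
  "quotient_top X q = topology (\<lambda>U. U \<subseteq> q ` topspace X \<and> openin X {x \<in> topspace X. q x \<in> U})"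

definition tildeG ::
  "'v set \<Rightarrow> 'e set \<Rightarrow> ('e \<Rightarrow> 'v) \<Rightarrow> ('e \<Rightarrow> 'v) \<Rightarrow> (nat \<Rightarrow> 'v) set set \<Rightarrow> ('v, 'e) gpoint set topology" where
  "tildeG V E src tgt \<Psi> = quotient_top (graph_space_Psi V E src tgt \<Psi>) (pt_class V E src tgt \<Psi>)"

definition topological_circle :: "'a topology \<Rightarrow> 'a set \<Rightarrow> bool" where
  "topological_circle X C \<longleftrightarrow> C \<subseteq> topspace X \<and>
     (subtopology X C) homeomorphic_space (top_of_set (sphere (0::complex) 1))"

definition circle_edges ::
  "'v set \<Rightarrow> 'e set \<Rightarrow> ('e \<Rightarrow> 'v) \<Rightarrow> ('e \<Rightarrow> 'v) \<Rightarrow> (nat \<Rightarrow> 'v) set set \<Rightarrow> ('v, 'e) gpoint set set \<Rightarrow> 'e set" where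
  "circle_edges V E src tgt \<Psi> C =
     {e \<in> E. \<forall>t. 0 < t \<and> t < 1 \<longrightarrow> pt_class V E src tgt \<Psi> (Ed e t) \<in> C}"

definition psi_indep ::
  "'v set \<Rightarrow> 'e set \<Rightarrow> ('e \<Rightarrow> 'v) \<Rightarrow> ('e \<Rightarrow> 'v) \<Rightarrow> (nat \<Rightarrow> 'v) set set \<Rightarrow> 'e set \<Rightarrow> bool" where
  "psi_indep V E src tgt \<Psi> I \<longleftrightarrow> I \<subseteq> E \<and>
     \<not> (\<exists>C. topological_circle (tildeG V E src tgt \<Psi>) C \<and> circle_edges V E src tgt \<Psi> C \<subseteq> I)"

definition maximal_in :: "('a set \<Rightarrow> bool) \<Rightarrow> 'a set \<Rightarrow> 'a set \<Rightarrow> bool" where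
  "maximal_in P X S \<longleftrightarrow> P S \<and> S \<subseteq> X \<and> (\<forall>T. P T \<and> S \<subseteq> T \<and> T \<subseteq> X \<longrightarrow> T = S)"

definition is_matroid :: "'a set \<Rightarrow> ('a set \<Rightarrow> bool) \<Rightarrow> bool" where
  "is_matroid E ind \<longleftrightarrow>
     (\<forall>I. ind I \<longrightarrow> I \<subseteq> E) \<and>
     ind {} \<and>
     (\<forall>I J. ind I \<and> J \<subseteq> I \<longrightarrow> ind J) \<and>
     (\<forall>A B. ind A \<and> \<not> maximal_in ind E A \<and> maximal_in ind E B \<longrightarrow>
            (\<exists>b\<in>B - A. ind (insert b A))) \<and>
     (\<forall>A X. ind A \<and> A \<subseteq> X \<and> X \<subseteq> E \<longrightarrow> (\<exists>S. A \<subseteq> S \<and> maximal_in ind X S))"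

definition is_base :: "'a set \<Rightarrow> ('a set \<Rightarrow> bool) \<Rightarrow> 'a set \<Rightarrow> bool" where
  "is_base E ind B \<longleftrightarrow> maximal_in ind E B"

definition fin_indep :: "('a set \<Rightarrow> bool) \<Rightarrow> 'a set \<Rightarrow> bool" where
  "fin_indep ind I \<longleftrightarrow> (\<forall>F. F \<subseteq> I \<and> finite F \<longrightarrow> ind F)"

definition nearly_finitary :: "nat \<Rightarrow> 'a set \<Rightarrow> ('a set \<Rightarrow> bool) \<Rightarrow> bool" where
  "nearly_finitary k E ind \<longleftrightarrow>
     (\<forall>F B. is_base E (\<lambda>I. I \<subseteq> E \<and> fin_indep ind I) F \<and> is_base E ind B \<and> B \<subseteq> F
        \<longrightarrow> finite (F - B) \<and> card (F - B) \<le> k)"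

end

theory Submission
  imports Defs
begin

text \<open>Let \<open>F\<close> be a base of \<open>M\<^sup>f\<^sup>i\<^sup>n\<close>.  Identifying equivalent points turns every finite cycle of the
  quotient graph into a circle, so \<open>F\<close> is a forest there and extends to a spanning forest \<open>J\<close> of
  the quotient.  Say that \<open>J - X\<close> links two points if they become connected once every component
  of \<open>J - X\<close> containing a ray of an end \<open>\<omega> \<in> \<Psi>\<close> is also attached to \<open>\<omega>\<close>.  If the endpoints of
  every edge of \<open>X\<close> are linked by \<open>J - X\<close>, then \<open>card X\<close> attachments are needed, and a minimal
  set of them consists of rays that meet pairwise only finitely often; hence \<open>card X\<close> is at most the
  maximal number \<open>K\<close> of disjoint rays, which exists by a theorem of Halin.  Choose such an \<open>X\<close> of
  maximal size.  Now no edge \<open>e\<close> of \<open>J - X\<close> has its endpoints linked by \<open>J - X - {e}\<close>, and the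
  points linked to one endpoint of \<open>e\<close> form one side of a partition into open sets which only \<open>e\<close>
  crosses among the edges of \<open>J - X\<close>.  A circle cannot cross such a partition in exactly one edge,
  so \<open>J - X\<close>, and with it \<open>F - X\<close>, is independent, and base exchange gives
  \<open>card (F - B) \<le> card X \<le> K\<close> for every base \<open>B \<subseteq> F\<close>.\<close>

section \<open>Halin's theorem on disjoint rays\<close>

text \<open>A circle of the quotient may run through infinitely many ends and classes and has no
  finite description, so little more is used of it than connectedness and the absence of cut points.
  Everything then depends on having enough partitions of \<open>V \<union> \<Psi>\<close> into open
  sets. The obstacle lies at the ends: components of \<open>J - X\<close> that are not attached to
  \<omega> might still accumulate at it, and then a class of linked points would not be open there.
  A single component that finitely many vertices cannot separate from \<omega> contains a vertex
  equivalent to \<omega> or a ray of \<omega>, by a descent through branches in the manner of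
  Koenig's lemma. For the descent \<Psi> has to be finite, so that identifications of vertices stop
  after finitely many steps; \<Psi> is finite because distinct ends have rays with disjoint tails.
  Several components together are harmless because \<open>J\<close> spans: deleting finitely many
  edges leaves finitely many components near \<omega>, whereas \<open>F\<close> itself could have
  infinitely many. Circles without edges are excluded by the axiom that the empty set is
  independent.\<close>

definition disjoint_rays ::
  "'v set \<Rightarrow> 'e set \<Rightarrow> ('e \<Rightarrow> 'v) \<Rightarrow> ('e \<Rightarrow> 'v) \<Rightarrow> nat \<Rightarrow> (nat \<Rightarrow> nat \<Rightarrow> 'v) \<Rightarrow> bool" where
  "disjoint_rays V E src tgt n R \<longleftrightarrow>
     (\<forall>i<n. is_ray V E src tgt (R i)) \<and>
     (\<forall>i<n. \<forall>j<n. \<forall>l m. R i l = R j m \<longrightarrow> i = j)"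

lemma is_ray_inj: "is_ray V E src tgt r \<Longrightarrow> r i = r j \<longleftrightarrow> i = j"
  by (auto simp: is_ray_def inj_def)

lemma is_ray_in: "is_ray V E src tgt r \<Longrightarrow> r i \<in> V"
  by (auto simp: is_ray_def)

lemma is_ray_adj: "is_ray V E src tgt r \<Longrightarrow> adj E src tgt (r n) (r (Suc n))"
  by (auto simp: is_ray_def)

lemma is_rayI:
  assumes "\<And>i j. r i = r j \<Longrightarrow> i = j" "\<And>i. r i \<in> V" "\<And>n. adj E src tgt (r n) (r (Suc n))"
  shows "is_ray V E src tgt r"
  using assms by (auto simp: is_ray_def inj_def)

lemma is_ray_tail: "is_ray V E src tgt r \<Longrightarrow> is_ray V E src tgt (\<lambda>m. r (n + m))"
  by (rule is_rayI) (auto simp: is_ray_inj is_ray_in is_ray_adj)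

lemma is_ray_avoids_finite:
  assumes "is_ray V E src tgt r" "finite S"
  shows "\<exists>n. \<forall>m\<ge>n. r m \<notin> S"
proof -
  have "finite (r -` S)" using assms by (auto simp: is_ray_def intro: finite_vimageI)
  then obtain n where "\<forall>m\<in>r -` S. m < n" using finite_nat_set_iff_bounded by metis
  then show ?thesis by (metis leD vimage_eq)
qed

text \<open>Each ray \<open>P i\<close> proposes its vertices in order; a vertex on \<open>Q j\<close> is given up
  once \<open>Q j\<close> has received a proposal further along.\<close>

definition passed_over :: "nat \<Rightarrow> (nat \<Rightarrow> nat \<Rightarrow> 'v) \<Rightarrow> 'v set \<Rightarrow> 'v \<Rightarrow> bool" where
  "passed_over n Q A u \<longleftrightarrow> (\<forall>j\<le>n. \<forall>p. Q j p = u \<longrightarrow> (\<exists>p'>p. Q j p' \<in> A))"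

text \<open>The bound \<open>l \<le> k\<close> keeps every stage finite. A vertex on none of the
  rays \<open>Q j\<close> counts as passed over at once, so a ray \<open>P i\<close> never stops
  there.\<close>

fun proposed :: "nat \<Rightarrow> (nat \<Rightarrow> nat \<Rightarrow> 'v) \<Rightarrow> (nat \<Rightarrow> nat \<Rightarrow> 'v) \<Rightarrow> nat \<Rightarrow> 'v set" where
  "proposed n P Q 0 = {}"
| "proposed n P Q (Suc k) =
     {P i l | i l. i < n \<and> l \<le> k \<and> (\<forall>j<l. passed_over n Q (proposed n P Q k) (P i j))}"

lemma passed_overD:
  "passed_over n Q A u \<Longrightarrow> j \<le> n \<Longrightarrow> Q j p = u \<Longrightarrow> \<exists>p'>p. Q j p' \<in> A"
  by (auto simp: passed_over_def)

lemma passed_over_mono: "A \<subseteq> B \<Longrightarrow> passed_over n Q A u \<Longrightarrow> passed_over n Q B u"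
  by (fastforce simp: passed_over_def)

lemma proposed_Suc_mono: "proposed n P Q k \<subseteq> proposed n P Q (Suc k)"
proof (induction k)
  case (Suc k)
  show ?case
  proof
    fix u assume "u \<in> proposed n P Q (Suc k)"
    then obtain i l where "u = P i l" "i < n" "l \<le> k"
      "\<forall>j<l. passed_over n Q (proposed n P Q k) (P i j)" by auto
    with passed_over_mono[OF Suc.IH]
    have "u = P i l \<and> i < n \<and> l \<le> Suc k \<and> (\<forall>j<l. passed_over n Q (proposed n P Q (Suc k)) (P i j))"
      by (meson le_SucI)
    then show "u \<in> proposed n P Q (Suc (Suc k))" unfolding proposed.simps(2)[of n P Q "Suc k"] by blast
  qed
qed simp

lemma proposed_mono: "k \<le> k' \<Longrightarrow> proposed n P Q k \<subseteq> proposed n P Q k'"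
  by (rule lift_Suc_mono_le[of "proposed n P Q"]) (auto simp only: proposed_Suc_mono)

lemma finite_proposed: "finite (proposed n P Q k)"
proof (cases k)
  case (Suc k')
  have "proposed n P Q (Suc k') \<subseteq> (\<lambda>(i,l). P i l) ` ({..<n} \<times> {..k'})" by auto
  then show ?thesis unfolding Suc by (rule finite_subset) auto
qed simp

text \<open>Since the rays \<open>P i\<close> are disjoint and injective, a vertex determines its
  pair \<open>(i, l)\<close>; the witness for being proposed therefore concerns this very initial
  segment.\<close>

lemma proposed_prefix:
  assumes P: "disjoint_rays V E src tgt n P" and i: "i < n" and l: "P i l \<in> proposed n P Q k"
    and j: "j < l"
  shows "passed_over n Q (proposed n P Q k) (P i j)"
proof (cases k)
  case 0 with l show ?thesis by simp
next
  case (Suc k')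
  with l obtain i' l' where 1: "P i l = P i' l'" "i' < n"
    "\<forall>j<l'. passed_over n Q (proposed n P Q k') (P i' j)" by auto
  have "i = i'" using P i 1 unfolding disjoint_rays_def by blast
  moreover have "l = l'" using 1 P i \<open>i = i'\<close> is_ray_inj unfolding disjoint_rays_def by metis
  ultimately have "passed_over n Q (proposed n P Q k') (P i j)" using 1 j by auto
  then show ?thesis using passed_over_mono proposed_Suc_mono Suc by metis
qed

text \<open>Pigeonhole: at a stage where all \<open>n + 1\<close> rays \<open>Q j\<close> have
  proposals, consider the last proposed vertex of each. Two of these on the same \<open>P i\<close>
  are impossible, because the earlier one would have been passed over and would not be last on its
  \<open>Q j\<close>. So \<open>n + 1\<close> rays would inject into \<open>n\<close>.\<close>

lemma ex_not_proposed:
  assumes P: "disjoint_rays V E src tgt n P" and Q: "disjoint_rays V E src tgt (Suc n) Q"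
  shows "\<exists>j\<le>n. \<forall>p k. Q j p \<notin> proposed n P Q k"
proof (rule ccontr)
  assume "\<not> ?thesis"
  then have "\<forall>j. \<exists>k. j \<le> n \<longrightarrow> (\<exists>p. Q j p \<in> proposed n P Q k)" by blast
  from choice[OF this] obtain kk where kk: "\<And>j. j \<le> n \<Longrightarrow> \<exists>p. Q j p \<in> proposed n P Q (kk j)" by blast
  define k where "k = Max (kk ` {..n})"
  have ex: "\<exists>p. Q j p \<in> proposed n P Q k" if "j \<le> n" for j
  proof -
    have "kk j \<le> k" unfolding k_def using that by (intro Max_ge) auto
    then have "proposed n P Q (kk j) \<subseteq> proposed n P Q k" by (rule proposed_mono)
    then show ?thesis using kk[OF that] by blast
  qed
  have fin: "finite {p. Q j p \<in> proposed n P Q k}" if "j \<le> n" for j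
  proof -
    have "inj (Q j)" using Q that by (auto simp: disjoint_rays_def is_ray_def)
    then have "finite (Q j -` proposed n P Q k)" by (intro finite_vimageI finite_proposed)
    then show ?thesis by (simp add: vimage_def)
  qed
  define p where "p j = Max {p. Q j p \<in> proposed n P Q k}" for j
  have pin: "Q j (p j) \<in> proposed n P Q k" if "j \<le> n" for j
    using Max_in[OF fin[OF that]] ex[OF that] unfolding p_def by auto
  have pmax: "p' \<le> p j" if "j \<le> n" "Q j p' \<in> proposed n P Q k" for j p'
    using Max_ge[OF fin] that unfolding p_def by auto
  have "\<exists>i l. i < n \<and> Q j (p j) = P i l" if "j \<le> n" for j
    using pin[OF that] by (cases k) auto
  then obtain I L where IL: "\<And>j. j \<le> n \<Longrightarrow> I j < n" "\<And>j. j \<le> n \<Longrightarrow> Q j (p j) = P (I j) (L j)" by metis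
  have key: "\<not> L j < L j'" if "j \<le> n" "j' \<le> n" "I j = I j'" for j j'
  proof
    assume lt: "L j < L j'"
    have "P (I j) (L j') \<in> proposed n P Q k" using pin[OF that(2)] IL(2)[OF that(2)] that(3) by simp
    then have "passed_over n Q (proposed n P Q k) (Q j (p j))"
      using proposed_prefix[OF P IL(1)[OF that(1)] _ lt] IL(2)[OF that(1)] by simp
    from passed_overD[OF this that(1) refl]
    obtain p' where "p' > p j" "Q j p' \<in> proposed n P Q k" by blast
    then show False using pmax[OF that(1), of p'] by simp
  qed
  have "inj_on I {..n}"
  proof (rule inj_onI)
    fix j j' assume a: "j \<in> {..n}" "j' \<in> {..n}" "I j = I j'"
    then have "L j = L j'" using key[of j j'] key[of j' j] by auto
    then have "Q j (p j) = Q j' (p j')" using IL a by auto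
    then show "j = j'" using Q a unfolding disjoint_rays_def by (metis atMost_iff le_imp_less_Suc)
  qed
  moreover have "I ` {..n} \<subseteq> {..<n}" using IL by auto
  ultimately have "card {..n} \<le> card {..<n}" by (rule card_inj_on_le) auto
  then show False by simp
qed

text \<open>A form of Pym's linkage theorem for rays.\<close>

lemma ray_linkage:
  assumes P: "disjoint_rays V E src tgt n P" and Q: "disjoint_rays V E src tgt (Suc n) Q"
  shows "\<exists>R. disjoint_rays V E src tgt (Suc n) R \<and> (\<forall>i<n. R i 0 = P i 0)"
proof -
  define A where "A = (\<Union>k. proposed n P Q k)"
  have A_pre: "passed_over n Q A (P i j)" if "i < n" "P i l \<in> A" "j < l" for i l j
  proof -
    obtain k where "P i l \<in> proposed n P Q k" using \<open>P i l \<in> A\<close> unfolding A_def by blast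
    then have "passed_over n Q (proposed n P Q k) (P i j)" using proposed_prefix[OF P] that by blast
    then show ?thesis by (rule passed_over_mono[rotated]) (auto simp: A_def)
  qed
  have rP: "is_ray V E src tgt (P i)" if "i < n" for i using P that by (auto simp: disjoint_rays_def)
  have rQ: "is_ray V E src tgt (Q j)" if "j \<le> n" for j using Q that by (auto simp: disjoint_rays_def)
  have dP: "i = j" if "P i l = P j m" "i < n" "j < n" for i j l m
    using P that unfolding disjoint_rays_def by metis
  have dQ: "i = j" if "Q i l = Q j m" "i \<le> n" "j \<le> n" for i j l m
    using Q that unfolding disjoint_rays_def by (metis le_imp_less_Suc)
  \<comment> \<open>A vertex has at most one position on at most one \<open>Q j\<close>, so a single
    later proposal is enough, and it occurs at a finite stage.\<close>
  have Qtail: "\<exists>k. passed_over n Q (proposed n P Q k) u" if "passed_over n Q A u" for u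
  proof (cases "\<exists>j\<le>n. \<exists>p. Q j p = u")
    case True
    then obtain j p where jp: "j \<le> n" "Q j p = u" by auto
    with that obtain p' where p': "p' > p" "Q j p' \<in> A" unfolding passed_over_def by blast
    then obtain k where k: "Q j p' \<in> proposed n P Q k" unfolding A_def by auto
    have "passed_over n Q (proposed n P Q k) u"
      unfolding passed_over_def
    proof (intro allI impI)
      fix j' q assume q: "j' \<le> n" "Q j' q = u"
      then have "j' = j" using jp dQ by blast
      moreover from this have "q = p" using q jp is_ray_inj[OF rQ[OF jp(1)]] by auto
      ultimately show "\<exists>p'>q. Q j' p' \<in> proposed n P Q k" using p' k by blast
    qed
    then show ?thesis by blast
  next
    case False
    then show ?thesis unfolding passed_over_def by blast
  qed
  \<comment> \<open>Only finitely many vertices precede \<open>P i l\<close>, so one stage serves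
    them all; \<open>l\<close> itself enters the maximum because \<open>proposed\<close> demands
    \<open>l \<le> k\<close>.\<close>
  have A_I: "P i l \<in> A" if i: "i < n" and ps: "\<forall>j<l. passed_over n Q A (P i j)" for i l
  proof -
    obtain kk where kk: "\<forall>j<l. passed_over n Q (proposed n P Q (kk j)) (P i j)"
    proof -
      have "\<forall>j. \<exists>k. j < l \<longrightarrow> passed_over n Q (proposed n P Q k) (P i j)" using ps Qtail by blast
      from choice[OF this] that show ?thesis by blast
    qed
    define k where "k = Max (insert l (kk ` {..<l}))"
    have "kk j \<le> k" if "j < l" for j unfolding k_def using that by (intro Max_ge) auto
    then have "\<forall>j<l. passed_over n Q (proposed n P Q k) (P i j)"
      using kk passed_over_mono proposed_mono by meson
    moreover have "l \<le> k" unfolding k_def by (intro Max_ge) auto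
    ultimately have "P i l \<in> proposed n P Q (Suc k)" using i by auto
    then show ?thesis unfolding A_def by blast
  qed
  \<comment> \<open>This ray receives no proposal at all and becomes the additional ray with index
    \<open>n\<close>.\<close>
  obtain j0 where j0: "j0 \<le> n" "\<And>p. Q j0 p \<notin> A"
    using ex_not_proposed[OF P Q] unfolding A_def by auto
  \<comment> \<open>Either all of \<open>P i\<close> is proposed and kept, or the route leaves
    \<open>P i\<close> at its first vertex that is not passed over. That vertex is the last element
    of \<open>A\<close> on some \<open>Q j\<close>, and the route continues along
    \<open>Q j\<close>. Membership in \<open>A\<close> thus tells the two portions of a route
    apart.\<close>
  have "\<exists>r. is_ray V E src tgt r \<and> r 0 = P i 0 \<and>
      ((\<forall>m. r m \<in> A \<and> r m \<in> range (P i)) \<or>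
       (\<exists>l j p. j \<le> n \<and> P i l = Q j p \<and> P i l \<in> A \<and> (\<forall>m\<le>l. r m = P i m \<and> P i m \<in> A) \<and>
          (\<forall>m>l. r m = Q j (p + (m - l)) \<and> r m \<notin> A)))" if i: "i < n" for i
  proof (cases "\<forall>l. passed_over n Q A (P i l)")
    case True
    then show ?thesis using A_I i rP by (intro exI[of _ "P i"]) blast
  next
    case False
    define l where "l = (LEAST l. \<not> passed_over n Q A (P i l))"
    have l: "\<not> passed_over n Q A (P i l)" "\<forall>j<l. passed_over n Q A (P i j)"
      using False LeastI_ex[of "\<lambda>l. \<not> passed_over n Q A (P i l)"] not_less_Least unfolding l_def by blast+
    then obtain j p where jp: "j \<le> n" "P i l = Q j p" "\<forall>p'>p. Q j p' \<notin> A"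
      unfolding passed_over_def by metis
    have inA: "P i m \<in> A" if "m \<le> l" for m using A_I[OF i, of m] l that by auto
    define r where "r m = (if m \<le> l then P i m else Q j (p + (m - l)))" for m
    have out: "r m \<notin> A" if "m > l" for m using jp that by (simp add: r_def)
    have "is_ray V E src tgt r"
    proof (rule is_rayI)
      fix a b assume ab: "r a = r b"
      show "a = b"
      proof (cases "a \<le> l")
        case True
        then have "r a \<in> A" using inA by (simp add: r_def)
        then have "b \<le> l" using ab out by (metis leI)
        then show ?thesis using ab True is_ray_inj[OF rP[OF i]] by (simp add: r_def)
      next
        case False
        then have "r a \<notin> A" using out by simp
        then have "\<not> b \<le> l" using ab inA unfolding r_def by metis
        then show ?thesis using ab False is_ray_inj[OF rQ[OF jp(1)]] by (simp add: r_def)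
      qed
    next
      fix m show "r m \<in> V" using is_ray_in[OF rP[OF i]] is_ray_in[OF rQ[OF jp(1)]] by (simp add: r_def)
      show "adj E src tgt (r m) (r (Suc m))"
      proof (cases "m < l")
        case True then show ?thesis using is_ray_adj[OF rP[OF i]] by (simp add: r_def)
      next
        case False
        then have "r m = Q j (p + (m - l))" by (cases "m = l") (auto simp: r_def jp)
        moreover have "r (Suc m) = Q j (Suc (p + (m - l)))" using False by (auto simp: r_def Suc_diff_le)
        ultimately show ?thesis using is_ray_adj[OF rQ[OF jp(1)]] by simp
      qed
    qed
    moreover have "r 0 = P i 0" by (simp add: r_def)
    moreover have "\<forall>m\<le>l. r m = P i m \<and> P i m \<in> A" using inA by (simp add: r_def)
    moreover have "\<forall>m>l. r m = Q j (p + (m - l)) \<and> r m \<notin> A" using out by (simp add: r_def)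
    ultimately show ?thesis using jp inA[of l] by blast
  qed
  then obtain r where r: "\<And>i. i < n \<Longrightarrow> is_ray V E src tgt (r i)" "\<And>i. i < n \<Longrightarrow> r i 0 = P i 0"
    "\<And>i. i < n \<Longrightarrow> (\<forall>m. r i m \<in> A \<and> r i m \<in> range (P i)) \<or>
       (\<exists>l j p. j \<le> n \<and> P i l = Q j p \<and> P i l \<in> A \<and> (\<forall>m\<le>l. r i m = P i m \<and> P i m \<in> A) \<and>
          (\<forall>m>l. r i m = Q j (p + (m - l)) \<and> r i m \<notin> A))" by metis
  have inA: "r i m \<in> range (P i)" if "i < n" "r i m \<in> A" for i m
    using r(3)[OF that(1)] that by (metis leI rangeI)
  have notA: "\<exists>j p q l. j \<le> n \<and> r i m = Q j q \<and> p < q \<and> Q j p \<in> A \<and> P i l = Q j p \<and> (\<forall>q'>p. Q j q' \<notin> A)"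
    if i: "i < n" and m: "r i m \<notin> A" for i m
  proof -
    from r(3)[OF i] show ?thesis
    proof (elim disjE exE conjE)
      assume "\<forall>m. r i m \<in> A \<and> r i m \<in> range (P i)"
      with m show ?thesis by blast
    next
      fix l j p assume *: "j \<le> n" "P i l = Q j p" "P i l \<in> A" "\<forall>m\<le>l. r i m = P i m \<and> P i m \<in> A"
        "\<forall>m>l. r i m = Q j (p + (m - l)) \<and> r i m \<notin> A"
      have ml: "m > l" using * m by (metis leI)
      have "Q j q' \<notin> A" if q': "q' > p" for q'
      proof -
        have "q' - p + l > l" using q' by simp
        with *(5) have "r i (q' - p + l) = Q j (p + ((q' - p + l) - l))" "r i (q' - p + l) \<notin> A" by blast+
        moreover have "p + ((q' - p + l) - l) = q'" using q' by simp
        ultimately show ?thesis by simp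
      qed
      moreover have "r i m = Q j (p + (m - l))" "p < p + (m - l)" "Q j p \<in> A"
        using *(5) ml *(2)[symmetric] *(3) by simp_all
      ultimately show ?thesis using *(1,2) by blast
    qed
  qed
  define R where "R i = (if i < n then r i else Q j0)" for i
  \<comment> \<open>Inside \<open>A\<close> the routes follow the disjoint rays \<open>P i\<close>.
    Outside \<open>A\<close> a common vertex determines \<open>Q j\<close>, hence the last element
    of \<open>A\<close> on it, hence the ray \<open>P i\<close> from which the route came.\<close>
  have dis: "i = i'" if ii: "i < n" "i' < n" and eq: "r i m = r i' m'" for i i' m m'
  proof (cases "r i m \<in> A")
    case True
    have "r i m \<in> range (P i)" "r i m \<in> range (P i')"
      using inA[OF ii(1) True] inA[of i' m'] True ii eq by auto
    then obtain l l' where "P i l = P i' l'" by (metis imageE)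
    then show ?thesis by (rule dP[OF _ ii])
  next
    case False
    obtain j p q l where 1: "j \<le> n" "r i m = Q j q" "Q j p \<in> A" "P i l = Q j p"
      "\<forall>q'>p. Q j q' \<notin> A" using notA[OF ii(1) False] by blast
    have "r i' m' \<notin> A" using False eq by simp
    then obtain j' p' q' l' where 2: "j' \<le> n" "r i' m' = Q j' q'" "Q j' p' \<in> A" "P i' l' = Q j' p'"
      "\<forall>q>p'. Q j' q \<notin> A" using notA[OF ii(2)] by blast
    have jj: "j = j'" using dQ[of j q j' q'] 1 2 eq by simp
    then have "\<not> p < p'" "\<not> p' < p" using 1 2 by blast+
    then have "p = p'" by simp
    then have "P i l = P i' l'" using 1(4) 2(4) jj by simp
    then show ?thesis by (rule dP[OF _ ii])
  qed
  have dis0: "r i m \<noteq> Q j0 q" if i: "i < n" for i m q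
  proof
    assume eq: "r i m = Q j0 q"
    then have "r i m \<notin> A" using j0 by simp
    then obtain j p q' where "j \<le> n" "r i m = Q j q'" "Q j p \<in> A" using notA[OF i] by blast
    then show False using dQ[of j q' j0 q] eq j0 by auto
  qed
  have "disjoint_rays V E src tgt (Suc n) R"
    unfolding disjoint_rays_def
  proof (intro conjI allI impI)
    fix i assume "i < Suc n"
    then show "is_ray V E src tgt (R i)" using r(1) rQ[OF j0(1)] by (auto simp: R_def)
  next
    fix i j l m assume *: "i < Suc n" "j < Suc n" "R i l = R j m"
    consider "i < n" "j < n" | "i < n" "j = n" | "i = n" "j < n" | "i = n" "j = n"
      using * by linarith
    then show "i = j"
    proof cases
      case 1 then show ?thesis using dis[of i j l m] * by (simp add: R_def)
    next
      case 2 then show ?thesis using dis0[of i l m] * by (simp add: R_def)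
    next
      case 3 then show ?thesis using dis0[of j m l] * by (simp add: R_def)
    qed simp
  qed
  then show ?thesis using r(2) by (auto simp: R_def)
qed

section \<open>From arbitrarily many disjoint rays to infinitely many\<close>

lemma is_ray_mono: "is_ray W E src tgt r \<Longrightarrow> W \<subseteq> V \<Longrightarrow> is_ray V E src tgt r"
  by (auto simp: is_ray_def)

lemma disjoint_rays_avoid_finite:
  assumes R: "disjoint_rays V E src tgt n R" and S: "finite S"
  shows "\<exists>R'. disjoint_rays (V - S) E src tgt n R'"
proof -
  have "\<forall>i. \<exists>k. i < n \<longrightarrow> (\<forall>m\<ge>k. R i m \<notin> S)"
    using R is_ray_avoids_finite[OF _ S] unfolding disjoint_rays_def by metis
  then obtain k where k: "\<And>i m. i < n \<Longrightarrow> m \<ge> k i \<Longrightarrow> R i m \<notin> S" by metis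
  have "disjoint_rays (V - S) E src tgt n (\<lambda>i m. R i (k i + m))"
    unfolding disjoint_rays_def
  proof (intro conjI allI impI)
    fix i assume i: "i < n"
    then have "is_ray V E src tgt (\<lambda>m. R i (k i + m))"
      using R is_ray_tail unfolding disjoint_rays_def by metis
    then show "is_ray (V - S) E src tgt (\<lambda>m. R i (k i + m))"
      using k[OF i] by (auto simp: is_ray_def)
  next
    fix i j l m assume "i < n" "j < n" "R i (k i + l) = R j (k j + m)"
    then show "i = j" using R unfolding disjoint_rays_def by metis
  qed
  then show ?thesis by blast
qed

text \<open>Linkage preserves only the first vertex of each ray. So the first \<open>n\<close>
  vertices of every \<open>R i\<close> are deleted from the graph, the tails starting at
  \<open>R i n\<close> are linked, and the deleted segments are put back in front; the vertices with
  index up to \<open>n\<close> survive.\<close>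

lemma extend_disjoint_rays:
  assumes R: "disjoint_rays V E src tgt n R" and big: "disjoint_rays V E src tgt (Suc n) Q"
  shows "\<exists>R'. disjoint_rays V E src tgt (Suc n) R' \<and> (\<forall>i<n. \<forall>m\<le>n. R' i m = R i m)"
proof -
  define S where "S = (\<lambda>(i,m). R i m) ` ({..<n} \<times> {..<n})"
  have finS: "finite S" by (simp add: S_def)
  obtain Q' where Q': "disjoint_rays (V - S) E src tgt (Suc n) Q'"
    using disjoint_rays_avoid_finite[OF big finS] by blast
  have rR: "is_ray V E src tgt (R i)" if "i < n" for i using R that by (auto simp: disjoint_rays_def)
  have dR: "i = j \<and> l = m" if "R i l = R j m" "i < n" "j < n" for i j l m
    using R that is_ray_inj unfolding disjoint_rays_def by metis
  have "disjoint_rays (V - S) E src tgt n (\<lambda>i m. R i (n + m))"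
    unfolding disjoint_rays_def
  proof (intro conjI allI impI)
    fix i assume i: "i < n"
    have "R i (n + m) \<notin> S" for m using dR i unfolding S_def by fastforce
    then show "is_ray (V - S) E src tgt (\<lambda>m. R i (n + m))"
      using is_ray_tail[OF rR[OF i], of n] by (auto simp: is_ray_def)
  qed (use dR in blast)
  from ray_linkage[OF this Q'] obtain T where T: "disjoint_rays (V - S) E src tgt (Suc n) T"
    "\<forall>i<n. T i 0 = R i n" by auto
  have rT: "is_ray (V - S) E src tgt (T i)" if "i \<le> n" for i using T that by (auto simp: disjoint_rays_def)
  have dT: "i = j" if "T i l = T j m" "i \<le> n" "j \<le> n" for i j l m
    using T that unfolding disjoint_rays_def by (metis le_imp_less_Suc)
  have TS: "T i m \<notin> S" if "i \<le> n" for i m using is_ray_in[OF rT[OF that]] by blast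
  define R' where "R' i m = (if i < n \<and> m < n then R i m else if i < n then T i (m - n) else T i m)" for i m
  have RS: "R i m \<in> S" if "i < n" "m < n" for i m using that by (auto simp: S_def)
  have "disjoint_rays V E src tgt (Suc n) R'"
    unfolding disjoint_rays_def
  proof (intro conjI allI impI)
    fix i assume i: "i < Suc n"
    show "is_ray V E src tgt (R' i)"
    proof (cases "i < n")
      case False
      then have "R' i = T i" by (auto simp: R'_def)
      then show ?thesis using rT[of i] i is_ray_mono by (metis Diff_subset less_Suc_eq_le)
    next
      case True
      show ?thesis
      proof (rule is_rayI)
        fix a b assume ab: "R' i a = R' i b"
        show "a = b"
        proof (cases "a < n"; cases "b < n")
          assume "a < n" "b < n" then show ?thesis using ab True dR by (auto simp: R'_def)
        next
          assume "a < n" "\<not> b < n" then show ?thesis using ab True RS TS[of i] by (simp add: R'_def) (metis i less_Suc_eq_le)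
        next
          assume "\<not> a < n" "b < n" then show ?thesis using ab True RS TS[of i] by (simp add: R'_def) (metis i less_Suc_eq_le)
        next
          assume "\<not> a < n" "\<not> b < n" then show ?thesis using ab True is_ray_inj[OF rT[of i]] by (simp add: R'_def)
        qed
      next
        fix m
        show "R' i m \<in> V" using True is_ray_in[OF rR[OF True]] is_ray_in[OF rT[of i]] by (auto simp: R'_def)
        consider "Suc m < n" | "Suc m = n" | "m \<ge> n" by linarith
        then show "adj E src tgt (R' i m) (R' i (Suc m))"
        proof cases
          case 1 then show ?thesis using True is_ray_adj[OF rR[OF True]] by (simp add: R'_def)
        next
          case 2 then show ?thesis using True is_ray_adj[OF rR[OF True], of m] T(2) by (simp add: R'_def) 
        next
          case 3 then show ?thesis using True is_ray_adj[OF rT[of i], of "m - n"] by (simp add: R'_def Suc_diff_le)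
        qed
      qed
    qed
  next
    fix i j l m assume *: "i < Suc n" "j < Suc n" "R' i l = R' j m"
    have 1: "(R' i l = R i l \<and> i < n \<and> l < n) \<or> (R' i l \<in> range (T i) \<and> \<not> (i < n \<and> l < n))" for i l
      by (auto simp: R'_def)
    show "i = j"
    proof (cases "i < n \<and> l < n"; cases "j < n \<and> m < n")
      assume "i < n \<and> l < n" "j < n \<and> m < n"
      then show ?thesis using * dR[of i l j m] by (simp add: R'_def)
    next
      assume a: "i < n \<and> l < n" "\<not> (j < n \<and> m < n)"
      then have "R' i l \<in> S" using RS by (simp add: R'_def)
      moreover obtain q where "R' j m = T j q" using a 1[of j m] by blast
      ultimately show ?thesis using * TS[of j q] by simp
    next
      assume a: "\<not> (i < n \<and> l < n)" "j < n \<and> m < n"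
      then have "R' j m \<in> S" using RS by (simp add: R'_def)
      moreover obtain q where "R' i l = T i q" using a 1[of i l] by blast
      ultimately show ?thesis using * TS[of i q] by simp
    next
      assume a: "\<not> (i < n \<and> l < n)" "\<not> (j < n \<and> m < n)"
      then obtain q q' where "R' i l = T i q" "R' j m = T j q'" using 1[of i l] 1[of j m] by blast
      then show ?thesis using dT[of i q j q'] * by simp
    qed
  qed
  moreover have "\<forall>i<n. \<forall>m\<le>n. R' i m = R i m" using T(2) by (auto simp: R'_def)
  ultimately show ?thesis by blast
qed

text \<open>Repeated extension freezes ever longer initial segments of ever more rays, and the
  limits of these segments are infinitely many disjoint rays.\<close>

theorem bounded_disjoint_rays:
  assumes "\<not> inf_disjoint_rays V E src tgt"
  shows "\<exists>K. \<forall>n R. disjoint_rays V E src tgt n R \<longrightarrow> n \<le> K"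
proof (rule ccontr)
  assume "\<not> ?thesis"
  then have unb: "\<exists>n>K. \<exists>R. disjoint_rays V E src tgt n R" for K by (meson not_le)
  have big: "\<exists>R. disjoint_rays V E src tgt n R" for n
  proof -
    obtain m R where "m > n" "disjoint_rays V E src tgt m R" using unb by blast
    then have "disjoint_rays V E src tgt n R" by (auto simp: disjoint_rays_def)
    then show ?thesis by blast
  qed
  have "\<exists>f. \<forall>n. disjoint_rays V E src tgt n (f n) \<and> (\<forall>i<n. \<forall>m\<le>n. f (Suc n) i m = f n i m)"
    by (rule dependent_nat_choice) (use big extend_disjoint_rays in blast)+
  then obtain f where f: "\<And>n. disjoint_rays V E src tgt n (f n)"
    "\<And>n i m. i < n \<Longrightarrow> m \<le> n \<Longrightarrow> f (Suc n) i m = f n i m" by blast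
  \<comment> \<open>From this stage on the ray \<open>i\<close> exists and its vertex
    \<open>m\<close> no longer changes.\<close>
  define R where "R i m = f (Suc (max i m)) i m" for i m
  have stab: "f N i m = R i m" if "N > i" "N > m" for N i m
  proof -
    have "Suc (max i m) \<le> N" using that by simp
    then show ?thesis
    proof (induction N rule: dec_induct)
      case base then show ?case by (simp add: R_def)
    next
      case (step N) then show ?case using f(2)[of i N m] by simp
    qed
  qed
  have "is_ray V E src tgt (R i)" for i
  proof (rule is_rayI)
    fix a b assume "R i a = R i b"
    then have "f (Suc (i + a + b)) i a = f (Suc (i + a + b)) i b" by (simp add: stab)
    then show "a = b" using f(1)[of "Suc (i + a + b)"] is_ray_inj unfolding disjoint_rays_def
      by (metis add.assoc le_add1 le_imp_less_Suc)
  next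
    fix n
    have r: "is_ray V E src tgt (f (Suc (Suc (i + n))) i)"
      using f(1)[of "Suc (Suc (i + n))"] unfolding disjoint_rays_def by auto
    show "R i n \<in> V" using is_ray_in[OF r, of n] by (simp add: stab)
    show "adj E src tgt (R i n) (R i (Suc n))" using is_ray_adj[OF r, of n] by (simp add: stab)
  qed
  moreover have "i = j" if "R i l = R j m" for i j l m
  proof -
    have "f (Suc (i + j + l + m)) i l = f (Suc (i + j + l + m)) j m" using that by (simp add: stab)
    moreover have "i < Suc (i + j + l + m)" "j < Suc (i + j + l + m)" by auto
    ultimately show ?thesis using f(1)[of "Suc (i + j + l + m)"] unfolding disjoint_rays_def by blast
  qed
  ultimately have "inf_disjoint_rays V E src tgt"
    unfolding inf_disjoint_rays_def by (intro exI[of _ R]) blast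
  with assms show False ..
qed

section \<open>Exchange for equivalence closures\<close>

definition eqc :: "('a \<times> 'a) set \<Rightarrow> ('a \<times> 'a) set" where
  "eqc Q = (Q \<union> Q\<inverse>)\<^sup>*"

lemma eqc_refl [simp]: "(x, x) \<in> eqc Q"
  by (simp add: eqc_def)

lemma eqc_sym: "(x, y) \<in> eqc Q \<Longrightarrow> (y, x) \<in> eqc Q"
proof -
  have "sym (Q \<union> Q\<inverse>)" by (auto simp: sym_def)
  then show "(x, y) \<in> eqc Q \<Longrightarrow> (y, x) \<in> eqc Q"
    unfolding eqc_def by (rule symD[OF sym_rtrancl])
qed

lemma eqc_trans: "(x, y) \<in> eqc Q \<Longrightarrow> (y, z) \<in> eqc Q \<Longrightarrow> (x, z) \<in> eqc Q"
  unfolding eqc_def by (rule rtrancl_trans)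

lemma eqc_base: "(x, y) \<in> Q \<Longrightarrow> (x, y) \<in> eqc Q"
  unfolding eqc_def by blast

lemma subset_eqc: "Q \<subseteq> eqc Q"
  by (auto intro: eqc_base)

lemma eqc_cong_right: "(a, b) \<in> eqc Q \<Longrightarrow> (x, a) \<in> eqc Q \<longleftrightarrow> (x, b) \<in> eqc Q"
  using eqc_trans[of x a Q b] eqc_trans[of x b Q a] eqc_sym[of a b Q] by blast

lemma eqc_step: "(x, y) \<in> eqc Q \<Longrightarrow> (y, z) \<in> Q \<or> (z, y) \<in> Q \<Longrightarrow> (x, z) \<in> eqc Q"
  by (meson eqc_base eqc_sym eqc_trans)

lemma eqc_invariant:
  assumes "(x, y) \<in> eqc Q" "\<And>a b. (a, b) \<in> Q \<Longrightarrow> a \<in> T \<longleftrightarrow> b \<in> T"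
  shows "x \<in> T \<longleftrightarrow> y \<in> T"
  using assms(1) unfolding eqc_def
  by (induction rule: rtrancl_induct) (use assms(2) in blast)+

lemma eqc_least:
  assumes "Q \<subseteq> eqc R"
  shows "eqc Q \<subseteq> eqc R"
proof (clarify)
  fix x y assume xy: "(x, y) \<in> eqc Q"
  have "a \<in> {y. (x, y) \<in> eqc R} \<longleftrightarrow> b \<in> {y. (x, y) \<in> eqc R}" if "(a, b) \<in> Q" for a b
    using eqc_cong_right[of a b R x] that assms by blast
  then have "x \<in> {y. (x, y) \<in> eqc R} \<longleftrightarrow> y \<in> {y. (x, y) \<in> eqc R}"
    by (rule eqc_invariant[OF xy])
  then show "(x, y) \<in> eqc R" by simp
qed

lemma eqc_mono: "Q \<subseteq> R \<Longrightarrow> eqc Q \<subseteq> eqc R"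
  by (rule eqc_least) (auto intro: eqc_base)

text \<open>A chain of pairs can be shortened so that it uses the new pair at most once, in one
  direction or the other.\<close>

lemma eqc_insertD:
  assumes "(x, y) \<in> eqc (insert (a, b) Q)"
  shows "(x, y) \<in> eqc Q \<or> ((x, a) \<in> eqc Q \<and> (b, y) \<in> eqc Q) \<or> ((x, b) \<in> eqc Q \<and> (a, y) \<in> eqc Q)"
proof -
  let ?T = "{y. (x, y) \<in> eqc Q \<or> ((x, a) \<in> eqc Q \<and> (b, y) \<in> eqc Q) \<or> ((x, b) \<in> eqc Q \<and> (a, y) \<in> eqc Q)}"
  have "u \<in> ?T \<longleftrightarrow> v \<in> ?T" if "(u, v) \<in> insert (a, b) Q" for u v
  proof (cases "(u, v) = (a, b)")
    case False
    then have "(u, v) \<in> eqc Q" using that eqc_base by auto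
    then show ?thesis using eqc_cong_right[of u v Q] by simp
  next
    case True
    then show ?thesis by (auto intro: eqc_sym eqc_trans)
  qed
  then have "x \<in> ?T \<longleftrightarrow> y \<in> ?T" by (rule eqc_invariant[OF assms])
  then show ?thesis by simp
qed

text \<open>The exchange property of a graphic matroid: if \<open>l\<close> makes the connection
  \<open>p\<close> possible, then \<open>l\<close> and \<open>p\<close> join the same two
  classes.\<close>

lemma eqc_exchange:
  assumes "p \<in> eqc (insert l Q)" "p \<notin> eqc Q"
  shows "l \<in> eqc (insert p Q)"
proof -
  obtain x y a b where p: "p = (x, y)" and l: "l = (a, b)" by fastforce
  have *: "eqc Q \<subseteq> eqc (insert p Q)" "(x, y) \<in> eqc (insert p Q)"
    by (auto intro!: eqc_mono eqc_base simp: p)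
  consider "(x, a) \<in> eqc Q" "(b, y) \<in> eqc Q" | "(x, b) \<in> eqc Q" "(a, y) \<in> eqc Q"
    using eqc_insertD[of x y a b Q] assms p l by blast
  then show ?thesis
  proof cases
    case 1
    then show ?thesis unfolding l using * eqc_sym eqc_trans by (metis subsetD)
  next
    case 2
    then show ?thesis unfolding l using * eqc_sym eqc_trans by (metis subsetD)
  qed
qed

text \<open>A connection is a finite chain. The set \<open>Q\<close> is kept whole since in the
  applications it contains all identifications of points, which may be infinitely many.\<close>

lemma eqc_finite_support:
  assumes "(x, y) \<in> eqc (Q \<union> L)"
  shows "\<exists>L'. finite L' \<and> L' \<subseteq> L \<and> (x, y) \<in> eqc (Q \<union> L')"
proof -
  let ?T = "{y. \<exists>L'. finite L' \<and> L' \<subseteq> L \<and> (x, y) \<in> eqc (Q \<union> L')}"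
  have step: "v \<in> ?T" if "u \<in> ?T" "(u, v) \<in> Q \<union> L \<or> (v, u) \<in> Q \<union> L" for u v
  proof -
    from that(1) obtain L' where L': "finite L' \<and> L' \<subseteq> L \<and> (x, u) \<in> eqc (Q \<union> L')"
      unfolding mem_Collect_eq ..
    \<comment> \<open>Both orientations, because the chain may traverse a pair of \<open>L\<close>
      backwards.\<close>
    let ?L = "L' \<union> ({(u, v), (v, u)} \<inter> L)"
    have "(x, u) \<in> eqc (Q \<union> ?L)" using L' eqc_mono[of "Q \<union> L'" "Q \<union> ?L"] by blast
    moreover have "(u, v) \<in> Q \<union> ?L \<or> (v, u) \<in> Q \<union> ?L" using that(2) by blast
    ultimately have "(x, v) \<in> eqc (Q \<union> ?L)" by (rule eqc_step)
    moreover have "finite ?L" "?L \<subseteq> L" using L' by auto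
    ultimately show ?thesis by blast
  qed
  have "x \<in> ?T" by (auto intro: exI[of _ "{}"])
  moreover have "u \<in> ?T \<longleftrightarrow> v \<in> ?T" if "(u, v) \<in> Q \<union> L" for u v
    using step[of u v] step[of v u] that by blast
  ultimately have "y \<in> ?T" using eqc_invariant[OF assms, of ?T] by blast
  then show ?thesis by simp
qed

text \<open>Steinitz exchange for the closure operator \<open>L \<mapsto> eqc (Q \<union> L)\<close>.\<close>

lemma eqc_rank_bound:
  assumes "finite P" "finite L" "\<forall>p\<in>P. p \<notin> eqc (Q \<union> (P - {p}))" "P \<subseteq> eqc (Q \<union> L)"
  shows "card P \<le> card L"
  using assms
proof (induction "card (P - L)" arbitrary: P rule: less_induct)
  case less
  show ?case
  proof (cases "P \<subseteq> L")
    case True then show ?thesis using less.prems card_mono by blast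
  next
    case False
    then obtain p where p: "p \<in> P" "p \<notin> L" by auto
    let ?P = "P - {p}"
    \<comment> \<open>If \<open>P - {p}\<close> spanned \<open>L\<close>, it would span
      \<open>p\<close> as well, against independence. So some element of \<open>L\<close> can
      replace \<open>p\<close>.\<close>
    have "\<not> L \<subseteq> eqc (Q \<union> ?P)"
    proof
      assume "L \<subseteq> eqc (Q \<union> ?P)"
      moreover have "Q \<subseteq> eqc (Q \<union> ?P)" using subset_eqc[of "Q \<union> ?P"] by simp
      ultimately have "eqc (Q \<union> L) \<subseteq> eqc (Q \<union> ?P)" by (intro eqc_least) simp
      then show False using less.prems(3,4) p(1) by blast
    qed
    then obtain l where l: "l \<in> L" "l \<notin> eqc (Q \<union> ?P)" by auto
    then have lP: "l \<notin> ?P" "l \<noteq> p" using subset_eqc[of "Q \<union> ?P"] p by blast+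
    let ?P' = "insert l ?P"
    have ind: "\<forall>q\<in>?P'. q \<notin> eqc (Q \<union> (?P' - {q}))"
    proof
      fix q assume q: "q \<in> ?P'"
      show "q \<notin> eqc (Q \<union> (?P' - {q}))"
      proof (cases "q = l")
        case True then show ?thesis using l lP by simp
      next
        case False
        then have qP: "q \<in> P" "q \<noteq> p" using q by auto
        have eq: "Q \<union> (?P' - {q}) = insert l (Q \<union> (?P - {q}))" using False by auto
        show ?thesis
        proof
          assume "q \<in> eqc (Q \<union> (?P' - {q}))"
          then have "q \<in> eqc (insert l (Q \<union> (?P - {q})))" unfolding eq .
          moreover have "q \<notin> eqc (Q \<union> (?P - {q}))"
            using less.prems(3) qP eqc_mono[of "Q \<union> (?P - {q})" "Q \<union> (P - {q})"] by blast
          ultimately have "l \<in> eqc (insert q (Q \<union> (?P - {q})))" by (rule eqc_exchange)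
          moreover have "insert q (Q \<union> (?P - {q})) = Q \<union> ?P" using qP by auto
          ultimately show False using l by simp
        qed
      qed
    qed
    have "Q \<union> L \<subseteq> eqc (Q \<union> L)" by (rule subset_eqc)
    then have sub: "?P' \<subseteq> eqc (Q \<union> L)" using less.prems l by blast
    have "?P' - L = (P - L) - {p}" using l p by auto
    then have "card (?P' - L) < card (P - L)"
      using p less.prems(1) by (metis DiffI card_Diff1_less finite_Diff)
    from less.hyps[OF this _ less.prems(2) ind sub] less.prems(1)
    have "card ?P' \<le> card L" by simp
    moreover have "card ?P' = card P"
      using lP p less.prems(1) by (metis card.remove card_insert_disjoint finite_Diff)
    ultimately show ?thesis by simp
  qed
qed

text \<open>By exchange, an element \<open>q\<close> that becomes spanned through the addition of
  \<open>p\<close> would show that \<open>P\<close> already spans \<open>p\<close>. Consequently a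
  maximal independent set spans.\<close>

lemma eqc_maximal_spans:
  assumes "\<forall>q\<in>P. q \<notin> eqc (Q \<union> (P - {q}))" "p \<notin> eqc (Q \<union> P)"
  shows "\<forall>q\<in>insert p P. q \<notin> eqc (Q \<union> (insert p P - {q}))"
proof
  fix q assume q: "q \<in> insert p P"
  have pP: "p \<notin> P" using assms(2) subset_eqc[of "Q \<union> P"] by blast
  show "q \<notin> eqc (Q \<union> (insert p P - {q}))"
  proof (cases "q = p")
    case True then show ?thesis using assms(2) pP by simp
  next
    case False
    then have qP: "q \<in> P" using q by auto
    show ?thesis
    proof
      assume "q \<in> eqc (Q \<union> (insert p P - {q}))"
      moreover have "Q \<union> (insert p P - {q}) = insert p (Q \<union> (P - {q}))" using False by auto
      ultimately have "q \<in> eqc (insert p (Q \<union> (P - {q})))" by simp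
      then have "p \<in> eqc (insert q (Q \<union> (P - {q})))" using eqc_exchange assms(1) qP by blast
      moreover have "insert q (Q \<union> (P - {q})) = Q \<union> P" using qP by auto
      ultimately show False using assms(2) by simp
    qed
  qed
qed

section \<open>Ends and the topology\<close>

lemma conn_avoid_refl: "u \<in> V - S \<Longrightarrow> conn_avoid V E src tgt S u u"
  by (simp add: conn_avoid_def)

lemma conn_avoid_trans:
  "conn_avoid V E src tgt S u v \<Longrightarrow> conn_avoid V E src tgt S v w \<Longrightarrow> conn_avoid V E src tgt S u w"
  unfolding conn_avoid_def using rtrancl_trans[of u v _ w] by simp

lemma adj_sym: "adj E src tgt u w \<longleftrightarrow> adj E src tgt w u"
  by (simp add: adj_def insert_commute)

lemma conn_avoid_edge:
  "u \<in> V - S \<Longrightarrow> w \<in> V - S \<Longrightarrow> adj E src tgt u w \<Longrightarrow> conn_avoid V E src tgt S u w"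
  unfolding conn_avoid_def by (auto intro!: r_into_rtrancl)

lemma conn_avoid_in:
  assumes "conn_avoid V E src tgt S u w"
  shows "u \<in> V - S" "w \<in> V - S"
proof -
  show "u \<in> V - S" using assms by (simp add: conn_avoid_def)
  have "(u, w) \<in> {(x, y). x \<in> V - S \<and> y \<in> V - S \<and> adj E src tgt x y}\<^sup>*"
    using assms by (simp add: conn_avoid_def)
  then show "w \<in> V - S" by (cases rule: rtranclE) (use \<open>u \<in> V - S\<close> in auto)
qed

lemma conn_avoid_sym:
  assumes "conn_avoid V E src tgt S u w"
  shows "conn_avoid V E src tgt S w u"
proof -
  have "sym {(x, y). x \<in> V - S \<and> y \<in> V - S \<and> adj E src tgt x y}"
    by (auto simp: sym_def adj_sym)
  then have "sym ({(x, y). x \<in> V - S \<and> y \<in> V - S \<and> adj E src tgt x y}\<^sup>*)" by (rule sym_rtrancl)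
  then show ?thesis using assms conn_avoid_in[OF assms] unfolding conn_avoid_def sym_def by blast
qed

lemma conn_avoid_antimono:
  assumes "conn_avoid V E src tgt S' u w" "S \<subseteq> S'"
  shows "conn_avoid V E src tgt S u w"
proof -
  have "{(x, y). x \<in> V - S' \<and> y \<in> V - S' \<and> adj E src tgt x y}\<^sup>*
      \<subseteq> {(x, y). x \<in> V - S \<and> y \<in> V - S \<and> adj E src tgt x y}\<^sup>*"
    by (rule rtrancl_mono) (use assms(2) in auto)
  then show ?thesis using assms unfolding conn_avoid_def by blast
qed

lemma ray_conn_avoid:
  assumes "is_ray V E src tgt r" "\<forall>m\<ge>n. r m \<notin> S" "n \<le> m"
  shows "conn_avoid V E src tgt S (r n) (r m)"
  using assms(3)
proof (induction m rule: dec_induct)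
  case base then show ?case using assms is_ray_in by (intro conn_avoid_refl) fast
next
  case (step m)
  have "conn_avoid V E src tgt S (r m) (r (Suc m))"
    using assms is_ray_in[OF assms(1)] step.hyps by (intro conn_avoid_edge is_ray_adj[OF assms(1)]) auto
  with step.IH show ?case by (rule conn_avoid_trans)
qed

lemma ray_equiv_refl: 
  assumes "is_ray V E src tgt r" shows "ray_equiv V E src tgt r r"
  unfolding ray_equiv_def tails_same_comp_def
proof (intro allI impI)
  fix S assume "finite S \<and> S \<subseteq> V"
  then obtain n where n: "\<forall>m\<ge>n. r m \<notin> S" using is_ray_avoids_finite[OF assms] by blast
  then have "conn_avoid V E src tgt S (r n) (r n)" by (rule ray_conn_avoid[OF assms]) simp
  with n show "\<exists>n. (\<forall>m\<ge>n. r m \<notin> S \<and> r m \<notin> S) \<and> conn_avoid V E src tgt S (r n) (r n)" by blast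
qed

lemma ray_equiv_sym: "ray_equiv V E src tgt r s \<Longrightarrow> ray_equiv V E src tgt s r"
  unfolding ray_equiv_def tails_same_comp_def using conn_avoid_sym[of V E src tgt] by fast

text \<open>\<open>tails_same_comp\<close> compares two rays at a common index. Here the indices may
  differ, because a tail outside \<open>S\<close> stays in one component of the graph without
  \<open>S\<close>.\<close>

lemma ray_equivI:
  assumes r: "is_ray V E src tgt r" and s: "is_ray V E src tgt s"
    and c: "\<And>S n. finite S \<Longrightarrow> S \<subseteq> V \<Longrightarrow> \<forall>m\<ge>n. r m \<notin> S \<and> s m \<notin> S \<Longrightarrow>
      \<exists>a\<ge>n. \<exists>b\<ge>n. conn_avoid V E src tgt S (r a) (s b)"
  shows "ray_equiv V E src tgt r s"
  unfolding ray_equiv_def tails_same_comp_def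
proof (intro allI impI)
  fix S assume S: "finite S \<and> S \<subseteq> V"
  obtain n1 n2 where n12: "\<forall>m\<ge>n1. r m \<notin> S" "\<forall>m\<ge>n2. s m \<notin> S"
    using is_ray_avoids_finite[OF r] is_ray_avoids_finite[OF s] S by meson
  let ?n = "max n1 n2"
  have n: "\<forall>m\<ge>?n. r m \<notin> S \<and> s m \<notin> S" using n12 by auto
  obtain a b where ab: "a \<ge> ?n" "b \<ge> ?n" "conn_avoid V E src tgt S (r a) (s b)" using c[OF _ _ n] S by blast
  have "conn_avoid V E src tgt S (r ?n) (r a)" using n ab by (intro ray_conn_avoid[OF r]) auto
  moreover have "conn_avoid V E src tgt S (s b) (s ?n)"
    using n ab by (intro conn_avoid_sym[OF ray_conn_avoid[OF s]]) auto
  ultimately have "conn_avoid V E src tgt S (r ?n) (s ?n)" using ab conn_avoid_trans by metis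
  with n show "\<exists>n. (\<forall>m\<ge>n. r m \<notin> S \<and> s m \<notin> S) \<and> conn_avoid V E src tgt S (r n) (s n)" by blast
qed

text \<open>The index supplied by the definition is unknown; moving along the tails transfers the
  connection to any indices from which the rays avoid \<open>S\<close>.\<close>

lemma ray_equiv_conn:
  assumes r: "is_ray V E src tgt r" and s: "is_ray V E src tgt s" and "ray_equiv V E src tgt r s"
    and S: "finite S" "S \<subseteq> V" "\<forall>m\<ge>a. r m \<notin> S" "\<forall>m\<ge>b. s m \<notin> S"
  shows "conn_avoid V E src tgt S (r a) (s b)"
proof -
  obtain n where n: "\<forall>m\<ge>n. r m \<notin> S \<and> s m \<notin> S" "conn_avoid V E src tgt S (r n) (s n)"
    using assms(3) S(1,2) unfolding ray_equiv_def tails_same_comp_def by blast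
  have 1: "conn_avoid V E src tgt S (r a) (r n)"
  proof (cases "a \<le> n")
    case True then show ?thesis by (intro ray_conn_avoid[OF r S(3)])
  next
    case False then show ?thesis using n by (intro conn_avoid_sym[OF ray_conn_avoid[OF r]]) auto
  qed
  have 2: "conn_avoid V E src tgt S (s b) (s n)"
  proof (cases "b \<le> n")
    case True then show ?thesis by (intro ray_conn_avoid[OF s S(4)])
  next
    case False then show ?thesis using n by (intro conn_avoid_sym[OF ray_conn_avoid[OF s]]) auto
  qed
  show ?thesis using conn_avoid_trans[OF conn_avoid_trans[OF 1 n(2)] conn_avoid_sym[OF 2]] .
qed

lemma ray_equiv_trans:
  assumes r: "is_ray V E src tgt r" and s: "is_ray V E src tgt s" and t: "is_ray V E src tgt t"
    and "ray_equiv V E src tgt r s" "ray_equiv V E src tgt s t"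
  shows "ray_equiv V E src tgt r t"
proof (rule ray_equivI[OF r t])
  fix S n assume S: "finite S" "S \<subseteq> V" and n: "\<forall>m\<ge>n. r m \<notin> S \<and> t m \<notin> S"
  obtain k where k: "\<forall>m\<ge>k. s m \<notin> S" using is_ray_avoids_finite[OF s S(1)] by blast
  have "conn_avoid V E src tgt S (r n) (s k)" using n k by (intro ray_equiv_conn[OF r s assms(4) S]) auto
  moreover have "conn_avoid V E src tgt S (s k) (t n)" using n k by (intro ray_equiv_conn[OF s t assms(5) S]) auto
  ultimately have "conn_avoid V E src tgt S (r n) (t n)" by (rule conn_avoid_trans)
  then show "\<exists>a\<ge>n. \<exists>b\<ge>n. conn_avoid V E src tgt S (r a) (t b)" by blast
qed

lemma ray_equiv_tail:
  assumes r: "is_ray V E src tgt r"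
  shows "ray_equiv V E src tgt r (\<lambda>m. r (k + m))"
proof (rule ray_equivI[OF r is_ray_tail[OF r]])
  fix S n assume "\<forall>m\<ge>n. r m \<notin> S \<and> r (k + m) \<notin> S"
  then have "conn_avoid V E src tgt S (r (k + n)) (r (k + n))"
    using is_ray_in[OF r] by (intro conn_avoid_refl) auto
  then show "\<exists>a\<ge>n. \<exists>b\<ge>n. conn_avoid V E src tgt S (r a) (r (k + b))" by (metis le_add2 order_refl)
qed

text \<open>Among infinitely many common vertices there is one that comes late enough on both
  rays.\<close>

lemma infinite_meet_ray_equiv:
  assumes r: "is_ray V E src tgt r" and s: "is_ray V E src tgt s" and inf: "infinite (range r \<inter> range s)"
  shows "ray_equiv V E src tgt r s"
proof (rule ray_equivI[OF r s])
  fix S n assume S: "finite S" "S \<subseteq> V" and n: "\<forall>m\<ge>n. r m \<notin> S \<and> s m \<notin> S"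
  have "infinite (range r \<inter> range s - (r ` {..<n} \<union> s ` {..<n}))" using inf by simp
  then obtain x where "x \<in> range r \<inter> range s - (r ` {..<n} \<union> s ` {..<n})"
    using infinite_imp_nonempty by blast
  then obtain a b where ab: "x = r a" "x = s b" "x \<notin> r ` {..<n}" "x \<notin> s ` {..<n}" by blast
  then have "a \<ge> n" "b \<ge> n" by (metis imageI leI lessThan_iff)+
  moreover have "conn_avoid V E src tgt S (r a) (s b)"
    using n \<open>a \<ge> n\<close> ab is_ray_in[OF r, of a] by (auto intro!: conn_avoid_refl)
  ultimately show "\<exists>a\<ge>n. \<exists>b\<ge>n. conn_avoid V E src tgt S (r a) (s b)" by blast
qed

section \<open>Ends and components in a fixed graph\<close>

locale psi_graph =
  fixes V :: "'v set" and E :: "'e set" and src tgt :: "'e \<Rightarrow> 'v"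
    and \<Psi> :: "(nat \<Rightarrow> 'v) set set"
  assumes graph: "simple_graph V E src tgt"
    and Psi: "\<Psi> \<subseteq> graph_ends V E src tgt"
begin

abbreviation "ends \<equiv> graph_ends V E src tgt"
abbreviation "Cmp \<equiv> comp_of_end V E src tgt"
abbreviation "conn \<equiv> conn_avoid V E src tgt"
abbreviation "ray \<equiv> is_ray V E src tgt"
abbreviation "edge_adj \<equiv> adj E src tgt"
abbreviation "XPsi \<equiv> graph_space_Psi V E src tgt \<Psi>"
abbreviation "peq \<equiv> pt_equiv V E src tgt \<Psi>"
abbreviation "cls \<equiv> pt_class V E src tgt \<Psi>"
abbreviation "quot \<equiv> tildeG V E src tgt \<Psi>"
abbreviation "VPsi \<equiv> VPsi_points V \<Psi>"

lemma edge_in: "e \<in> E \<Longrightarrow> src e \<in> V" "e \<in> E \<Longrightarrow> tgt e \<in> V" "e \<in> E \<Longrightarrow> src e \<noteq> tgt e"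
  using graph by (auto simp: simple_graph_def)

lemma edge_unique: "e \<in> E \<Longrightarrow> f \<in> E \<Longrightarrow> {src e, tgt e} = {src f, tgt f} \<Longrightarrow> e = f"
  using graph by (auto simp: simple_graph_def)

lemma edge_adjI: "e \<in> E \<Longrightarrow> edge_adj (src e) (tgt e)" "e \<in> E \<Longrightarrow> edge_adj (tgt e) (src e)"
  unfolding adj_def by auto

lemma edge_adj_in: "edge_adj u w \<Longrightarrow> u \<in> V" "edge_adj u w \<Longrightarrow> w \<in> V"
  unfolding adj_def using edge_in by (auto simp: doubleton_eq_iff)

lemma end_cases:
  assumes "\<omega> \<in> ends"
  obtains r where "ray r" "r \<in> \<omega>" "\<omega> = {s. ray s \<and> ray_equiv V E src tgt r s}"
proof -
  obtain r where "ray r" "\<omega> = {s. ray s \<and> ray_equiv V E src tgt r s}"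
    using assms by (auto simp: graph_ends_def)
  then show ?thesis using that ray_equiv_refl by blast
qed

lemma end_ray: "\<omega> \<in> ends \<Longrightarrow> r \<in> \<omega> \<Longrightarrow> ray r"
  by (erule end_cases) blast

lemma end_equiv:
  assumes "\<omega> \<in> ends" "r \<in> \<omega>"
  shows "s \<in> \<omega> \<longleftrightarrow> ray s \<and> ray_equiv V E src tgt r s"
proof -
  obtain r0 where r0: "ray r0" "\<omega> = {s. ray s \<and> ray_equiv V E src tgt r0 s}"
    using end_cases[OF assms(1)] by blast
  have r: "ray r" "ray_equiv V E src tgt r0 r" using assms r0 by auto
  show ?thesis
    unfolding r0(2) using ray_equiv_trans[OF r(1) r0(1)] ray_equiv_trans[OF r0(1) r(1)] r
      ray_equiv_sym[OF r(2)] by blast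
qed

lemma end_tail: "\<omega> \<in> ends \<Longrightarrow> r \<in> \<omega> \<Longrightarrow> (\<lambda>m. r (n + m)) \<in> \<omega>"
  using end_equiv[of \<omega> r] end_ray ray_equiv_tail is_ray_tail by blast

lemma end_eqI:
  assumes "\<omega> \<in> ends" "\<omega>' \<in> ends" "r \<in> \<omega>" "r \<in> \<omega>'"
  shows "\<omega> = \<omega>'"
  using end_equiv[OF assms(1,3)] end_equiv[OF assms(2,4)] by blast

text \<open>\<open>comp_of_end\<close> ranges over all rays of the end; by equivalence of rays, each
  of them determines one and the same component.\<close>

lemma CmpD:
  assumes "w \<in> Cmp S \<omega>" "\<omega> \<in> ends" "finite S" "S \<subseteq> V" "r \<in> \<omega>" "\<forall>m\<ge>n. r m \<notin> S"
  shows "conn S (r n) w"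
proof -
  obtain s k where s: "s \<in> \<omega>" "\<forall>m\<ge>k. s m \<notin> S" "conn S (s k) w"
    using assms(1) unfolding comp_of_end_def by blast
  have "conn S (r n) (s k)"
    using end_equiv[OF assms(2,5)] s assms by (intro ray_equiv_conn) (auto intro: end_ray)
  then show ?thesis using s conn_avoid_trans by metis
qed

lemma CmpI: "r \<in> \<omega> \<Longrightarrow> \<forall>m\<ge>n. r m \<notin> S \<Longrightarrow> conn S (r n) w \<Longrightarrow> w \<in> Cmp S \<omega>"
  unfolding comp_of_end_def by blast

lemma CmpE:
  assumes "w \<in> Cmp S \<omega>"
  obtains r n where "r \<in> \<omega>" "\<forall>m\<ge>n. r m \<notin> S" "conn S (r n) w"
  using assms unfolding comp_of_end_def mem_Collect_eq by (elim bexE exE conjE)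

lemma Cmp_conn: "w \<in> Cmp S \<omega> \<Longrightarrow> conn S w w' \<Longrightarrow> w' \<in> Cmp S \<omega>"
  by (erule CmpE) (rule CmpI, assumption+, erule conn_avoid_trans)

lemma Cmp_in: "w \<in> Cmp S \<omega> \<Longrightarrow> w \<in> V - S"
  by (erule CmpE) (rule conn_avoid_in)

lemma Cmp_antimono:
  assumes "S \<subseteq> S'" shows "Cmp S' \<omega> \<subseteq> Cmp S \<omega>"
proof
  fix w assume "w \<in> Cmp S' \<omega>"
  then obtain r n where r: "r \<in> \<omega>" "\<forall>m\<ge>n. r m \<notin> S'" "conn S' (r n) w" by (rule CmpE)
  show "w \<in> Cmp S \<omega>"
    by (rule CmpI[OF r(1) _ conn_avoid_antimono[OF r(3) assms]]) (use r(2) assms in blast)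
qed

lemma Cmp_ray: "\<omega> \<in> ends \<Longrightarrow> r \<in> \<omega> \<Longrightarrow> \<forall>m\<ge>n. r m \<notin> S \<Longrightarrow> m \<ge> n \<Longrightarrow> r m \<in> Cmp S \<omega>"
  using ray_conn_avoid end_ray CmpI by metis

lemma ex_ray_in_Cmp:
  assumes "\<omega> \<in> ends" "finite S"
  shows "\<exists>r\<in>\<omega>. range r \<subseteq> Cmp S \<omega>"
proof -
  obtain r where r: "ray r" "r \<in> \<omega>" by (rule end_cases[OF assms(1)])
  obtain n where "\<forall>m\<ge>n. r m \<notin> S" using is_ray_avoids_finite[OF r(1) assms(2)] by blast
  then have "range (\<lambda>m. r (n + m)) \<subseteq> Cmp S \<omega>" using Cmp_ray[OF assms(1) r(2)] by auto
  then show ?thesis using end_tail[OF assms(1) r(2)] by blast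
qed

lemma Cmp_subset_Cmp:
  assumes w: "\<omega> \<in> ends" "\<omega>' \<in> ends" "finite S" "S \<subseteq> V" "r \<in> \<omega>" "range r \<subseteq> Cmp S \<omega>'"
  shows "Cmp S \<omega> \<subseteq> Cmp S \<omega>'"
proof
  fix w assume "w \<in> Cmp S \<omega>"
  have "\<forall>m\<ge>0. r m \<notin> S" using w(6) Cmp_in by blast
  then have "conn S (r 0) w" using CmpD[OF \<open>w \<in> Cmp S \<omega>\<close>] w by blast
  then show "w \<in> Cmp S \<omega>'" using Cmp_conn w(6) by blast
qed

text \<open>A set \<open>hatC\<close> contains the whole interior of every edge leaving the
  component. The endvertex of such an edge in \<open>S\<close> therefore cannot be on the other side
  of an open partition, although it is not a point of \<open>hatC\<close>; so it has to be
  included.\<close>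

definition nbhd :: "'v set \<Rightarrow> (nat \<Rightarrow> 'v) set \<Rightarrow> 'v set" where
  "nbhd S \<omega> = Cmp S \<omega> \<union> {w. \<exists>u\<in>Cmp S \<omega>. edge_adj u w}"

text \<open>Combinatorial form of the partitions of \<open>V \<union> \<Psi>\<close> into two disjoint open sets; see
  \<open>peq_iff\<close>.\<close>

definition split :: "'v set \<Rightarrow> (nat \<Rightarrow> 'v) set set \<Rightarrow> bool" where
  "split A \<Theta> \<longleftrightarrow> A \<subseteq> V \<and> \<Theta> \<subseteq> \<Psi> \<and>
     (\<forall>\<omega>\<in>\<Psi>. \<exists>S. finite S \<and> S \<subseteq> V \<and> (if \<omega> \<in> \<Theta> then nbhd S \<omega> \<subseteq> A else nbhd S \<omega> \<inter> A = {}))"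

lemma nbhd_in: "nbhd S \<omega> \<subseteq> V"
  unfolding nbhd_def using Cmp_in edge_adj_in by blast

lemma nbhd_antimono: "S \<subseteq> S' \<Longrightarrow> nbhd S' \<omega> \<subseteq> nbhd S \<omega>"
  unfolding nbhd_def using Cmp_antimono by blast

lemma split_compl: "split A \<Theta> \<Longrightarrow> split (V - A) (\<Psi> - \<Theta>)"
  unfolding split_def
proof (elim conjE, intro conjI ballI)
  fix \<omega> assume *: "\<omega> \<in> \<Psi>" "\<forall>\<omega>\<in>\<Psi>. \<exists>S. finite S \<and> S \<subseteq> V \<and> (if \<omega> \<in> \<Theta> then nbhd S \<omega> \<subseteq> A else nbhd S \<omega> \<inter> A = {})"
  from bspec[OF *(2) *(1)] obtain S where
    S: "finite S" "S \<subseteq> V" "if \<omega> \<in> \<Theta> then nbhd S \<omega> \<subseteq> A else nbhd S \<omega> \<inter> A = {}" by (elim exE conjE)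
  have "if \<omega> \<in> \<Psi> - \<Theta> then nbhd S \<omega> \<subseteq> V - A else nbhd S \<omega> \<inter> (V - A) = {}"
    using S(3) nbhd_in[of S \<omega>] *(1) by (auto split: if_splits)
  with S show "\<exists>S. finite S \<and> S \<subseteq> V \<and>
    (if \<omega> \<in> \<Psi> - \<Theta> then nbhd S \<omega> \<subseteq> V - A else nbhd S \<omega> \<inter> (V - A) = {})" by blast
qed auto

definition pts :: "'v set \<Rightarrow> (nat \<Rightarrow> 'v) set set \<Rightarrow> ('v, 'e) gpoint set" where
  "pts A \<Theta> = Vx ` A \<union> En ` \<Theta>"

text \<open>Edges that cross the partition are cut at their midpoint, which belongs to neither side.\<close>

definition side :: "'v set \<Rightarrow> (nat \<Rightarrow> 'v) set set \<Rightarrow> ('v, 'e) gpoint set" where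
  "side A \<Theta> = pts A \<Theta> \<union> {Ed f t | f t. f \<in> E \<and> 0 < t \<and> t < 1 \<and>
     (t \<le> 1/2 \<longrightarrow> src f \<in> A) \<and> (1/2 \<le> t \<longrightarrow> tgt f \<in> A)}"

section \<open>Basic open sets and the subspace belonging to the chosen ends\<close>

definition carrier :: "('v, 'e) gpoint set" where
  "carrier = Vx ` V \<union> En ` \<Psi> \<union> {Ed f t | f t. f \<in> E \<and> 0 < t \<and> t < 1}"

abbreviation "star \<equiv> \<lambda>v \<epsilon>. {Vx v} \<union> {Ed e t | e t. e \<in> E \<and> 0 < t \<and> t < 1 \<and>
                    ((src e = v \<and> t < \<epsilon>) \<or> (tgt e = v \<and> 1 - t < \<epsilon>))}"

abbreviation "hat \<equiv> hatC V E src tgt"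

lemma hat_vertex: "Vx w \<in> hat S \<omega> \<longleftrightarrow> w \<in> Cmp S \<omega>"
  by (auto simp: hatC_def Let_def)

lemma hat_edge: "Ed e t \<in> hat S \<omega> \<longleftrightarrow> e \<in> E \<and> 0 < t \<and> t < 1 \<and> (src e \<in> Cmp S \<omega> \<or> tgt e \<in> Cmp S \<omega>)"
  by (auto simp: hatC_def Let_def)

lemma hat_end: "En \<omega>' \<in> hat S \<omega> \<longleftrightarrow> \<omega>' \<in> ends \<and> (\<exists>r\<in>\<omega>'. range r \<subseteq> Cmp S \<omega>)"
  by (auto simp: hatC_def Let_def)

lemma star_basic: "v \<in> V \<Longrightarrow> 0 < \<epsilon> \<Longrightarrow> \<epsilon> \<le> 1 \<Longrightarrow> star v \<epsilon> \<in> basic_opens V E src tgt"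
  unfolding basic_opens_def by blast

lemma interval_basic: "e \<in> E \<Longrightarrow> 0 < t \<Longrightarrow> t < 1 \<Longrightarrow> 0 < \<epsilon> \<Longrightarrow> \<epsilon> \<le> 1 \<Longrightarrow>
    {Ed e s | s. 0 < s \<and> s < 1 \<and> \<bar>s - t\<bar> < \<epsilon>} \<in> basic_opens V E src tgt"
  unfolding basic_opens_def by blast

lemma hat_basic: "finite S \<Longrightarrow> S \<subseteq> V \<Longrightarrow> \<omega> \<in> ends \<Longrightarrow> hat S \<omega> \<in> basic_opens V E src tgt"
  unfolding basic_opens_def by blast

lemma En_in_hat: "\<omega> \<in> ends \<Longrightarrow> finite S \<Longrightarrow> En \<omega> \<in> hat S \<omega>"
  using ex_ray_in_Cmp by (simp add: hat_end)

lemma hat_mono_Cmp: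
  assumes "Cmp S \<omega> \<subseteq> Cmp S' \<omega>'"
  shows "hat S \<omega> \<subseteq> hat S' \<omega>'"
proof
  fix x assume "x \<in> hat S \<omega>"
  then show "x \<in> hat S' \<omega>'"
    using assms by (cases x) (simp_all add: hat_vertex hat_edge hat_end, blast+)
qed

lemma hat_antimono: "S \<subseteq> S' \<Longrightarrow> hat S' \<omega> \<subseteq> hat S \<omega>"
  by (intro hat_mono_Cmp Cmp_antimono)

lemma basic_cases:
  assumes "U \<in> basic_opens V E src tgt"
  obtains (star) v \<epsilon> where "v \<in> V" "0 < \<epsilon>" "\<epsilon> \<le> 1" "U = star v \<epsilon>"
    | (interval) e t \<epsilon> where "e \<in> E" "0 < t" "t < 1" "0 < \<epsilon>" "U = {Ed e s | s. 0 < s \<and> s < 1 \<and> \<bar>s - t\<bar> < \<epsilon>}"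
    | (hat) S \<omega> where "finite S" "S \<subseteq> V" "\<omega> \<in> ends" "U = hat S \<omega>"
  using assms unfolding basic_opens_def Un_iff mem_Collect_eq by (elim disjE exE conjE)

lemma topspace_graph_space:
  "topspace (graph_space V E src tgt) = Vx ` V \<union> En ` ends \<union> {Ed f t | f t. f \<in> E \<and> 0 < t \<and> t < 1}"
  (is "_ = ?T")
proof -
  have 1: "U \<subseteq> ?T" if "U \<in> basic_opens V E src tgt" for U
    using that by (cases rule: basic_cases) (use Cmp_in in \<open>auto simp: hatC_def Let_def\<close>)
  have 2: "x \<in> \<Union>(basic_opens V E src tgt)" if x: "x \<in> ?T" for x
  proof -
    consider v where "x = Vx v" "v \<in> V" | \<omega> where "x = En \<omega>" "\<omega> \<in> ends"
      | f t where "x = Ed f t" "f \<in> E" "0 < t" "t < 1" using x by blast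
    then show ?thesis
    proof cases
      case 1
      then have "star v 1 \<in> basic_opens V E src tgt" by (intro star_basic) simp_all
      moreover have "x \<in> star v 1" using 1 by simp
      ultimately show ?thesis by (rule UnionI)
    next
      case 2
      then have "hat {} \<omega> \<in> basic_opens V E src tgt" by (intro hat_basic) auto
      moreover have "x \<in> hat {} \<omega>" using 2 En_in_hat by simp
      ultimately show ?thesis by (rule UnionI)
    next
      case 3
      then have "{Ed f s | s. 0 < s \<and> s < 1 \<and> \<bar>s - t\<bar> < 1} \<in> basic_opens V E src tgt" by (intro interval_basic) auto
      moreover have "x \<in> {Ed f s | s. 0 < s \<and> s < 1 \<and> \<bar>s - t\<bar> < 1}" using 3 by simp
      ultimately show ?thesis by (rule UnionI)
    qed
  qed
  have "\<Union>(basic_opens V E src tgt) = ?T"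
  proof (rule equalityI)
    show "\<Union>(basic_opens V E src tgt) \<subseteq> ?T" by (rule Union_least) (rule 1)
    show "?T \<subseteq> \<Union>(basic_opens V E src tgt)" by (rule subsetI) (rule 2)
  qed
  then show ?thesis unfolding graph_space_def by (simp add: topology_generated_by_topspace)
qed

lemma carrier_eq: "topspace (graph_space V E src tgt) - En ` (ends - \<Psi>) = carrier"
  unfolding topspace_graph_space carrier_def using Psi by auto

lemma topspace_XPsi [simp]: "topspace XPsi = carrier"
proof -
  have "carrier \<subseteq> topspace (graph_space V E src tgt)" unfolding carrier_eq[symmetric] by (rule Diff_subset)
  then show ?thesis unfolding graph_space_Psi_def carrier_eq topspace_subtopology by (rule Int_absorb1)
qed

lemma openin_XPsiI:
  assumes "U \<subseteq> carrier" "\<And>x. x \<in> U \<Longrightarrow> \<exists>b\<in>basic_opens V E src tgt. x \<in> b \<and> b \<inter> carrier \<subseteq> U"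
  shows "openin XPsi U"
proof -
  define W where "W = \<Union>{b \<in> basic_opens V E src tgt. b \<inter> carrier \<subseteq> U}"
  have "openin (graph_space V E src tgt) W"
    unfolding W_def graph_space_def
    by (rule openin_Union) (simp add: topology_generated_by_Basis)
  moreover have "U = W \<inter> carrier" using assms unfolding W_def by blast
  ultimately show ?thesis
    unfolding graph_space_Psi_def carrier_eq openin_subtopology by blast
qed

text \<open>Induction over the generation of the topology; intersections take the smaller radius. A
  \<open>hat\<close> containing \<open>v\<close> contains even the star of radius 1, as it includes
  full edges.\<close>

lemma openin_graph_space_vertex:
  assumes "generate_topology_on (basic_opens V E src tgt) U" "Vx v \<in> U" "v \<in> V"
  shows "\<exists>\<epsilon>>0. \<epsilon> \<le> 1 \<and> star v \<epsilon> \<subseteq> U"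
  using assms(1,2)
proof (induction rule: generate_topology_on.induct)
  case (Int a b)
  have "Vx v \<in> a" "Vx v \<in> b" using Int.prems by simp_all
  from Int.IH(1)[OF this(1)] Int.IH(2)[OF this(2)] obtain \<epsilon>1 \<epsilon>2 where
    e: "\<epsilon>1 > 0" "\<epsilon>1 \<le> 1" "star v \<epsilon>1 \<subseteq> a" "\<epsilon>2 > 0" "\<epsilon>2 \<le> 1" "star v \<epsilon>2 \<subseteq> b" by (elim exE conjE)
  have "star v (min \<epsilon>1 \<epsilon>2) \<subseteq> star v \<epsilon>1" "star v (min \<epsilon>1 \<epsilon>2) \<subseteq> star v \<epsilon>2" by fastforce+
  then have "star v (min \<epsilon>1 \<epsilon>2) \<subseteq> a \<inter> b" using e by blast
  moreover have "min \<epsilon>1 \<epsilon>2 > 0" "min \<epsilon>1 \<epsilon>2 \<le> 1" using e by auto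
  ultimately show ?case by blast
next
  case (UN K) then show ?case by (meson Union_iff Union_upper subset_trans)
next
  case (Basis s)
  then show ?case
  proof (cases rule: basic_cases)
    case (star v' \<epsilon>) with Basis show ?thesis by (intro exI[of _ \<epsilon>]) auto
  next
    case interval with Basis show ?thesis by auto
  next
    case (hat S \<omega>)
    then have "v \<in> Cmp S \<omega>" using Basis hat_vertex by simp
    then have "star v 1 \<subseteq> hat S \<omega>" by (auto simp: hat_vertex hat_edge)
    with hat show ?thesis by (intro exI[of _ 1]) simp
  qed
qed auto

text \<open>A basic set containing \<omega> may be a \<open>hat\<close> around another end; the two
  ends then have the same component for that \<open>S\<close>, so it contains the corresponding
  \<open>hat\<close> around \<omega>.\<close>

lemma openin_graph_space_end:
  assumes "generate_topology_on (basic_opens V E src tgt) U" "En \<omega> \<in> U" "\<omega> \<in> ends"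
  shows "\<exists>S. finite S \<and> S \<subseteq> V \<and> hat S \<omega> \<subseteq> U"
  using assms(1,2)
proof (induction rule: generate_topology_on.induct)
  case (Int a b)
  have "En \<omega> \<in> a" "En \<omega> \<in> b" using Int.prems by simp_all
  from Int.IH(1)[OF this(1)] Int.IH(2)[OF this(2)] obtain S1 S2 where
    S: "finite S1" "S1 \<subseteq> V" "hat S1 \<omega> \<subseteq> a" "finite S2" "S2 \<subseteq> V" "hat S2 \<omega> \<subseteq> b" by (elim exE conjE)
  have "hat (S1 \<union> S2) \<omega> \<subseteq> a \<inter> b"
    using S hat_antimono[of S1 "S1 \<union> S2" \<omega>] hat_antimono[of S2 "S1 \<union> S2" \<omega>] by blast
  with S show ?case by (intro exI[of _ "S1 \<union> S2"]) simp
next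
  case (UN K) then show ?case by (meson Union_iff Union_upper subset_trans)
next
  case (Basis s)
  then show ?case
  proof (cases rule: basic_cases)
    case (hat S \<omega>')
    then obtain r where "r \<in> \<omega>" "range r \<subseteq> Cmp S \<omega>'" using Basis by (auto simp: hat_end)
    then have "hat S \<omega> \<subseteq> hat S \<omega>'" using hat assms(3) by (intro hat_mono_Cmp Cmp_subset_Cmp)
    with hat show ?thesis by blast
  qed (use Basis in auto)
qed auto

lemma openin_XPsiD:
  assumes "openin XPsi U"
  shows "\<exists>W. generate_topology_on (basic_opens V E src tgt) W \<and> U = W \<inter> carrier"
proof -
  have "\<exists>W. openin (graph_space V E src tgt) W \<and> U = W \<inter> carrier"
    using assms unfolding graph_space_Psi_def carrier_eq openin_subtopology .
  then show ?thesis unfolding graph_space_def openin_topology_generated_by_iff .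
qed

lemma openin_XPsi_vertex:
  assumes "openin XPsi U" "Vx v \<in> U" "v \<in> V"
  shows "\<exists>\<epsilon>>0. \<epsilon> \<le> 1 \<and> star v \<epsilon> \<subseteq> U"
proof -
  obtain W where W: "generate_topology_on (basic_opens V E src tgt) W" "U = W \<inter> carrier"
    using openin_XPsiD[OF assms(1)] by (elim exE conjE)
  obtain \<epsilon> where "\<epsilon> > 0" "\<epsilon> \<le> 1" "star v \<epsilon> \<subseteq> W" using openin_graph_space_vertex[OF W(1) _ assms(3)] assms(2) unfolding W(2) by blast
  moreover have "star v \<epsilon> \<subseteq> carrier" using assms(3) by (auto simp: carrier_def)
  ultimately show ?thesis using W by blast
qed

lemma openin_XPsi_end:
  assumes "openin XPsi U" "En \<omega> \<in> U" "\<omega> \<in> \<Psi>"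
  shows "\<exists>S. finite S \<and> S \<subseteq> V \<and> hat S \<omega> \<inter> carrier \<subseteq> U"
proof -
  obtain W where W: "generate_topology_on (basic_opens V E src tgt) W" "U = W \<inter> carrier"
    using openin_XPsiD[OF assms(1)] by (elim exE conjE)
  have "\<exists>S. finite S \<and> S \<subseteq> V \<and> hat S \<omega> \<subseteq> W"
    using openin_graph_space_end[OF W(1)] W assms Psi by auto
  then show ?thesis using W by blast
qed


lemma mem_side:
  "Vx v \<in> side A \<Theta> \<longleftrightarrow> v \<in> A"
  "En \<omega> \<in> side A \<Theta> \<longleftrightarrow> \<omega> \<in> \<Theta>"
  "Ed f t \<in> side A \<Theta> \<longleftrightarrow> f \<in> E \<and> 0 < t \<and> t < 1 \<and> (t \<le> 1/2 \<longrightarrow> src f \<in> A) \<and> (1/2 \<le> t \<longrightarrow> tgt f \<in> A)"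
  by (auto simp: side_def pts_def)

lemma mem_pts: "Vx v \<in> pts A \<Theta> \<longleftrightarrow> v \<in> A" "En \<omega> \<in> pts A \<Theta> \<longleftrightarrow> \<omega> \<in> \<Theta>" "Ed f t \<notin> pts A \<Theta>"
  by (auto simp: pts_def)

lemma mem_carrier: "Vx v \<in> carrier \<longleftrightarrow> v \<in> V" "En \<omega> \<in> carrier \<longleftrightarrow> \<omega> \<in> \<Psi>"
  "Ed f t \<in> carrier \<longleftrightarrow> f \<in> E \<and> 0 < t \<and> t < 1"
  by (auto simp: carrier_def)

lemma mem_VPsi: "Vx v \<in> VPsi \<longleftrightarrow> v \<in> V" "En \<omega> \<in> VPsi \<longleftrightarrow> \<omega> \<in> \<Psi>" "Ed f t \<notin> VPsi"
  by (auto simp: VPsi_points_def)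

lemma VPsi_cases:
  assumes "x \<in> VPsi"
  obtains v where "x = Vx v" "v \<in> V" | \<omega> where "x = En \<omega>" "\<omega> \<in> \<Psi>"
  using assms by (auto simp: VPsi_points_def)

lemma mem_star: "Vx w \<in> star v \<epsilon> \<longleftrightarrow> w = v" "En \<omega> \<notin> star v \<epsilon>"
  "Ed e t \<in> star v \<epsilon> \<longleftrightarrow> e \<in> E \<and> 0 < t \<and> t < 1 \<and> ((src e = v \<and> t < \<epsilon>) \<or> (tgt e = v \<and> 1 - t < \<epsilon>))"
  by auto

lemma splitD_in:
  assumes "split A \<Theta>" "\<omega> \<in> \<Theta>"
  obtains S where "finite S" "S \<subseteq> V" "nbhd S \<omega> \<subseteq> A"
proof -
  have "\<omega> \<in> \<Psi>" using assms by (auto simp: split_def)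
  then have "\<exists>S. finite S \<and> S \<subseteq> V \<and> (if \<omega> \<in> \<Theta> then nbhd S \<omega> \<subseteq> A else nbhd S \<omega> \<inter> A = {})"
    using assms(1) unfolding split_def by blast
  with assms(2) that show ?thesis by auto
qed

lemma splitD_out:
  assumes "split A \<Theta>" "\<omega> \<in> \<Psi>" "\<omega> \<notin> \<Theta>"
  obtains S where "finite S" "S \<subseteq> V" "nbhd S \<omega> \<inter> A = {}"
proof -
  have "\<exists>S. finite S \<and> S \<subseteq> V \<and> (if \<omega> \<in> \<Theta> then nbhd S \<omega> \<subseteq> A else nbhd S \<omega> \<inter> A = {})"
    using assms(1,2) unfolding split_def by blast
  with assms(3) that show ?thesis by auto
qed

lemma Cmp_nbhd: "w \<in> Cmp S \<omega> \<Longrightarrow> w \<in> nbhd S \<omega>"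
  by (simp add: nbhd_def)

lemma Cmp_adj_nbhd: "w \<in> Cmp S \<omega> \<Longrightarrow> edge_adj w u \<Longrightarrow> u \<in> nbhd S \<omega>"
  by (auto simp: nbhd_def)

lemma Cmp_edge_nbhd:
  assumes "e \<in> E" "src e \<in> Cmp S \<omega> \<or> tgt e \<in> Cmp S \<omega>"
  shows "src e \<in> nbhd S \<omega>" "tgt e \<in> nbhd S \<omega>"
  using assms Cmp_nbhd Cmp_adj_nbhd edge_adjI by metis+

lemma basic_nbhdI:
  "b \<in> basic_opens V E src tgt \<Longrightarrow> x \<in> b \<Longrightarrow> b \<inter> carrier \<subseteq> U \<Longrightarrow>
    \<exists>b\<in>basic_opens V E src tgt. x \<in> b \<and> b \<inter> carrier \<subseteq> U"
  by blast

text \<open>Stars of radius 1/2 do not reach the midpoints of edges. At an end of \<Theta>,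
  \<open>nbhd S \<omega> \<subseteq> A\<close> puts both endvertices of every edge meeting the
  \<open>hat\<close> into \<open>A\<close>, so none of these edges is cut.\<close>

lemma openin_side:
  assumes sp: "split A \<Theta>"
  shows "openin XPsi (side A \<Theta>)"
proof (rule openin_XPsiI)
  have A: "A \<subseteq> V" "\<Theta> \<subseteq> \<Psi>" using sp by (auto simp: split_def)
  show "side A \<Theta> \<subseteq> carrier"
  proof
    fix x assume "x \<in> side A \<Theta>"
    then show "x \<in> carrier" using A by (cases x) (auto simp: mem_side mem_carrier)
  qed
  fix x assume x: "x \<in> side A \<Theta>"
  show "\<exists>b\<in>basic_opens V E src tgt. x \<in> b \<and> b \<inter> carrier \<subseteq> side A \<Theta>"
  proof (cases x)
    case (Vx v)
    then have v: "v \<in> A" using x by (simp add: mem_side)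
    have "star v (1/2) \<in> basic_opens V E src tgt" by (rule star_basic) (use v A in auto)
    moreover have "x \<in> star v (1/2)" using Vx by simp
    moreover have "star v (1/2) \<inter> carrier \<subseteq> side A \<Theta>"
    proof
      fix y assume "y \<in> star v (1/2) \<inter> carrier"
      then show "y \<in> side A \<Theta>" using v by (cases y) (auto simp: mem_side)
    qed
    ultimately show ?thesis by (rule basic_nbhdI)
  next
    case (En \<omega>)
    then have w: "\<omega> \<in> \<Theta>" using x by (simp add: mem_side)
    then have we: "\<omega> \<in> ends" using A Psi by blast
    obtain S where S: "finite S" "S \<subseteq> V" "nbhd S \<omega> \<subseteq> A" by (rule splitD_in[OF sp w])
    have "hat S \<omega> \<in> basic_opens V E src tgt" using S we by (intro hat_basic)
    moreover have "x \<in> hat S \<omega>" using En En_in_hat[OF we S(1)] by simp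
    moreover have "hat S \<omega> \<inter> carrier \<subseteq> side A \<Theta>"
    proof
      fix y assume y: "y \<in> hat S \<omega> \<inter> carrier"
      show "y \<in> side A \<Theta>"
      proof (cases y)
        case (Vx w)
        then have "w \<in> nbhd S \<omega>" using y Cmp_nbhd by (simp add: hat_vertex)
        then show ?thesis using Vx S(3) by (auto simp: mem_side)
      next
        case (Ed e t)
        then have e: "e \<in> E" "0 < t" "t < 1" "src e \<in> Cmp S \<omega> \<or> tgt e \<in> Cmp S \<omega>" using y by (auto simp: hat_edge)
        then have "src e \<in> A" "tgt e \<in> A" using Cmp_edge_nbhd[OF e(1,4)] S(3) by auto
        then show ?thesis using Ed e by (simp add: mem_side)
      next
        case (En \<omega>')
        then have w': "\<omega>' \<in> \<Psi>" "\<omega>' \<in> ends" using y Psi by (auto simp: mem_carrier)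
        have "\<exists>r\<in>\<omega>'. range r \<subseteq> Cmp S \<omega>" using y En by (simp add: hat_end)
        then obtain r where r: "r \<in> \<omega>'" "range r \<subseteq> Cmp S \<omega>" by blast
        \<comment> \<open>A second end in the same \<open>hat\<close> has a ray within
          \<open>A\<close>; on the other side, a late vertex of this ray would have to be outside
          \<open>A\<close>.\<close>
        have "\<omega>' \<in> \<Theta>"
        proof (rule ccontr)
          assume "\<omega>' \<notin> \<Theta>"
          then obtain S2 where S2: "finite S2" "S2 \<subseteq> V" "nbhd S2 \<omega>' \<inter> A = {}"
            using splitD_out[OF sp w'(1)] by blast
          obtain n where "\<forall>m\<ge>n. r m \<notin> S2"
            using is_ray_avoids_finite[OF end_ray[OF w'(2) r(1)] S2(1)] by blast
          then have "r n \<in> Cmp S2 \<omega>'" using Cmp_ray[OF w'(2) r(1)] by blast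
          moreover have "r n \<in> A" using r(2) S(3) Cmp_nbhd by blast
          ultimately show False using S2(3) Cmp_nbhd by blast
        qed
        then show ?thesis using En by (simp add: mem_side)
      qed
    qed
    ultimately show ?thesis by (rule basic_nbhdI)
  next
    case (Ed f t)
    then have f: "f \<in> E" "0 < t" "t < 1" "t \<le> 1/2 \<longrightarrow> src f \<in> A" "1/2 \<le> t \<longrightarrow> tgt f \<in> A"
      using x by (auto simp: mem_side)
    \<comment> \<open>The interval must not reach the midpoint unless it is centred there; in that
      case both endvertices are in \<open>A\<close> and any radius would do.\<close>
    define \<epsilon> where "\<epsilon> = (if t = 1/2 then 1/2 else \<bar>t - 1/2\<bar>)"
    have e: "\<epsilon> > 0" "\<epsilon> \<le> 1" using f unfolding \<epsilon>_def by (auto simp: abs_if)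
    have "{Ed f s | s. 0 < s \<and> s < 1 \<and> \<bar>s - t\<bar> < \<epsilon>} \<in> basic_opens V E src tgt"
      using f e by (intro interval_basic)
    moreover have "x \<in> {Ed f s | s. 0 < s \<and> s < 1 \<and> \<bar>s - t\<bar> < \<epsilon>}" using Ed f e by simp
    moreover have "Ed f s \<in> side A \<Theta>" if "0 < s" "s < 1" "\<bar>s - t\<bar> < \<epsilon>" for s
      using that f unfolding \<epsilon>_def mem_side by (auto split: if_splits simp: abs_if)
    then have "{Ed f s | s. 0 < s \<and> s < 1 \<and> \<bar>s - t\<bar> < \<epsilon>} \<inter> carrier \<subseteq> side A \<Theta>" by blast
    ultimately show ?thesis by (rule basic_nbhdI)
  qed
qed

lemma side_disjoint: "A \<inter> B = {} \<Longrightarrow> \<Theta> \<inter> \<Theta>' = {} \<Longrightarrow> side A \<Theta> \<inter> side B \<Theta>' = {}"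
proof -
  assume a: "A \<inter> B = {}" "\<Theta> \<inter> \<Theta>' = {}"
  have "x \<notin> side B \<Theta>'" if "x \<in> side A \<Theta>" for x
    using that a by (cases x) (auto simp: mem_side)
  then show ?thesis by blast
qed

lemma VPsi_side: "x \<in> VPsi \<Longrightarrow> x \<in> side A \<Theta> \<longleftrightarrow> x \<in> pts A \<Theta>"
  by (erule VPsi_cases) (simp_all add: mem_side mem_pts)

text \<open>The traces of two open sets on vertices and ends. For the neighbours of a component, an
  edge reaching from the open set of \<omega> to a vertex of the other open set would have interior
  points in both.\<close>

lemma split_of_opens:
  assumes O: "openin XPsi O1" "openin XPsi O2" "O1 \<inter> O2 = {}" "VPsi \<subseteq> O1 \<union> O2"
  shows "split {v \<in> V. Vx v \<in> O1} {\<omega> \<in> \<Psi>. En \<omega> \<in> O1}"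
proof -
  have key: "\<exists>S. finite S \<and> S \<subseteq> V \<and> (\<forall>w\<in>nbhd S \<omega>. Vx w \<in> U)"
    if w: "\<omega> \<in> \<Psi>" and wU: "En \<omega> \<in> U" and U: "openin XPsi U" "openin XPsi W" "U \<inter> W = {}" "VPsi \<subseteq> U \<union> W"
    for \<omega> U W
  proof -
    obtain S where S: "finite S" "S \<subseteq> V" "hat S \<omega> \<inter> carrier \<subseteq> U"
      using openin_XPsi_end[OF U(1) wU w] by blast
    have C: "Vx u \<in> U" if "u \<in> Cmp S \<omega>" for u
    proof -
      have "Vx u \<in> hat S \<omega> \<inter> carrier" using that Cmp_in[OF that] by (simp add: hat_vertex mem_carrier)
      then show ?thesis using S(3) by blast
    qed
    have N: "Vx x \<in> U" if u: "u \<in> Cmp S \<omega>" "edge_adj u x" for u x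
    proof (rule ccontr)
      assume "Vx x \<notin> U"
      have x: "x \<in> V" using edge_adj_in(2)[OF u(2)] .
      then have "Vx x \<in> W" using \<open>Vx x \<notin> U\<close> U(4) by (auto simp: VPsi_points_def)
      then obtain \<epsilon> where eps: "\<epsilon> > 0" "\<epsilon> \<le> 1" "star x \<epsilon> \<subseteq> W" using openin_XPsi_vertex[OF U(2) _ x] by blast
      obtain e where e: "e \<in> E" "{src e, tgt e} = {u, x}" using u(2) by (auto simp: adj_def)
      \<comment> \<open>A point of \<open>e\<close> close to \<open>x\<close>, hence in the star;
        the orientation of \<open>e\<close> decides from which end the distance is measured.\<close>
      define t where "t = (if src e = x then \<epsilon>/2 else 1 - \<epsilon>/2)"
      have t: "0 < t" "t < 1" using eps by (auto simp: t_def)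
      have xs: "src e = x \<or> tgt e = x" using e(2) by (auto simp: doubleton_eq_iff)
      have "Ed e t \<in> star x \<epsilon>" unfolding mem_star using e(1) t xs eps by (cases "src e = x") (auto simp: t_def)
      moreover have "Ed e t \<in> hat S \<omega> \<inter> carrier"
        using e u(1) t by (auto simp: hat_edge mem_carrier doubleton_eq_iff)
      ultimately show False using eps(3) S(3) U(3) by blast
    qed
    show ?thesis using S(1,2) C N unfolding nbhd_def by blast
  qed
  show ?thesis unfolding split_def
  proof (intro conjI ballI)
    fix \<omega> assume w: "\<omega> \<in> \<Psi>"
    let ?A = "{v \<in> V. Vx v \<in> O1}"
    show "\<exists>S. finite S \<and> S \<subseteq> V \<and> (if \<omega> \<in> {\<omega> \<in> \<Psi>. En \<omega> \<in> O1} then nbhd S \<omega> \<subseteq> ?A else nbhd S \<omega> \<inter> ?A = {})"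
    proof (cases "En \<omega> \<in> O1")
      case True
      from key[OF w True O] obtain S where "finite S" "S \<subseteq> V" "\<forall>w\<in>nbhd S \<omega>. Vx w \<in> O1" by blast
      moreover from this have "nbhd S \<omega> \<subseteq> ?A" using nbhd_in[of S \<omega>] by blast
      ultimately show ?thesis using w True by auto
    next
      case False
      then have F: "En \<omega> \<in> O2" using w O(4) by (auto simp: VPsi_points_def)
      have "O2 \<inter> O1 = {}" "VPsi \<subseteq> O2 \<union> O1" using O(3,4) by blast+
      from key[OF w F O(2,1) this] obtain S where "finite S" "S \<subseteq> V" "\<forall>w\<in>nbhd S \<omega>. Vx w \<in> O2" by blast
      moreover from this have "nbhd S \<omega> \<inter> ?A = {}" using O(3) by blast
      ultimately show ?thesis using w False by auto
    qed
  qed auto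
qed

text \<open>This turns the topological equivalence into a combinatorial one: a split gives the two
  open sets \<open>side\<close>, and two open sets give a split.\<close>

lemma peq_iff:
  "peq x y \<longleftrightarrow> x \<in> VPsi \<and> y \<in> VPsi \<and> (\<forall>A \<Theta>. split A \<Theta> \<longrightarrow> (x \<in> pts A \<Theta> \<longleftrightarrow> y \<in> pts A \<Theta>))"
proof (rule iffI)
  assume xy: "peq x y"
  show "x \<in> VPsi \<and> y \<in> VPsi \<and> (\<forall>A \<Theta>. split A \<Theta> \<longrightarrow> (x \<in> pts A \<Theta> \<longleftrightarrow> y \<in> pts A \<Theta>))"
  proof (intro conjI allI impI)
  show x: "x \<in> VPsi" and y: "y \<in> VPsi" using xy by (auto simp: pt_equiv_def)
  fix A \<Theta> assume sp: "split A \<Theta>"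
  let ?O1 = "side A \<Theta>" and ?O2 = "side (V - A) (\<Psi> - \<Theta>)"
  have "openin XPsi ?O1" "openin XPsi ?O2" using openin_side sp split_compl by blast+
  moreover have "?O1 \<inter> ?O2 = {}" by (rule side_disjoint) auto
  moreover have "VPsi \<subseteq> ?O1 \<union> ?O2" by (auto simp: VPsi_points_def mem_side)
  ultimately have "x \<in> ?O1 \<longleftrightarrow> y \<in> ?O1" using xy unfolding pt_equiv_def by blast
  then show "x \<in> pts A \<Theta> \<longleftrightarrow> y \<in> pts A \<Theta>" using VPsi_side x y by simp
  qed
next
  assume xy: "x \<in> VPsi \<and> y \<in> VPsi \<and> (\<forall>A \<Theta>. split A \<Theta> \<longrightarrow> (x \<in> pts A \<Theta> \<longleftrightarrow> y \<in> pts A \<Theta>))"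
  have "x \<in> O1 \<longleftrightarrow> y \<in> O1" if "openin XPsi O1" "openin XPsi O2" "O1 \<inter> O2 = {}" "VPsi \<subseteq> O1 \<union> O2" for O1 O2
  proof -
    let ?A = "{v \<in> V. Vx v \<in> O1}" and ?T = "{\<omega> \<in> \<Psi>. En \<omega> \<in> O1}"
    have "z \<in> pts ?A ?T \<longleftrightarrow> z \<in> O1" if "z \<in> VPsi" for z
      using that by (cases z) (auto simp: mem_pts mem_VPsi)
    then show ?thesis using xy split_of_opens[OF that] by blast
  qed
  then show "peq x y" using xy unfolding pt_equiv_def by blast
qed

section \<open>Equivalence classes of vertices and ends\<close>

lemma peq_refl: "x \<in> VPsi \<Longrightarrow> peq x x"
  by (simp add: pt_equiv_def)

lemma peq_sym: "peq x y \<Longrightarrow> peq y x"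
  by (simp add: pt_equiv_def)

lemma peq_trans: "peq x y \<Longrightarrow> peq y z \<Longrightarrow> peq x z"
  unfolding peq_iff by simp

lemma peq_in: "peq x y \<Longrightarrow> x \<in> VPsi" "peq x y \<Longrightarrow> y \<in> VPsi"
  by (simp_all add: pt_equiv_def)

lemma not_peqE:
  assumes "x \<in> VPsi" "y \<in> VPsi" "\<not> peq x y"
  obtains A \<Theta> where "split A \<Theta>" "x \<in> pts A \<Theta>" "y \<notin> pts A \<Theta>"
proof -
  obtain A \<Theta> where sp: "split A \<Theta>" "(x \<in> pts A \<Theta>) \<noteq> (y \<in> pts A \<Theta>)" using assms peq_iff by blast
  show ?thesis
  proof (cases "x \<in> pts A \<Theta>")
    case True with sp that show ?thesis by blast
  next
    case False
    then have "y \<in> pts A \<Theta>" using sp by simp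
    moreover have "x \<in> pts (V - A) (\<Psi> - \<Theta>)" using assms(1) False by (cases x) (auto simp: mem_pts mem_VPsi)
    moreover have "y \<notin> pts (V - A) (\<Psi> - \<Theta>)" using \<open>y \<in> pts A \<Theta>\<close> by (auto simp: pts_def)
    ultimately show ?thesis by (intro that[OF split_compl[OF sp(1)]])
  qed
qed

text \<open>A split respects equivalence, so the whole class of \<open>v\<close> lies in
  \<open>A\<close>, and the finite set that keeps \<open>nbhd S \<omega>\<close> out of
  \<open>A\<close> works for all its members at once.\<close>

lemma separate_class_end:
  assumes "\<omega> \<in> \<Psi>" "v \<in> V" "\<not> peq (Vx v) (En \<omega>)"
  shows "\<exists>S. finite S \<and> S \<subseteq> V \<and> (\<forall>u. peq (Vx v) (Vx u) \<longrightarrow> u \<notin> nbhd S \<omega>)"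
proof -
  have "Vx v \<in> VPsi" "En \<omega> \<in> VPsi" using assms by (simp_all add: mem_VPsi)
  then obtain A \<Theta> where sp: "split A \<Theta>" "Vx v \<in> pts A \<Theta>" "En \<omega> \<notin> pts A \<Theta>"
    using not_peqE[OF _ _ assms(3)] by blast
  obtain S where S: "finite S" "S \<subseteq> V" "nbhd S \<omega> \<inter> A = {}"
    using splitD_out[OF sp(1) assms(1)] sp(3) by (auto simp: mem_pts)
  have "u \<in> A" if "peq (Vx v) (Vx u)" for u
  proof -
    have "Vx v \<in> pts A \<Theta> \<longleftrightarrow> Vx u \<in> pts A \<Theta>" using that sp(1) unfolding peq_iff by blast
    then show ?thesis using sp(2) by (simp add: mem_pts)
  qed
  then show ?thesis using S by blast
qed

definition special :: "'v \<Rightarrow> bool" where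
  "special v \<longleftrightarrow> (\<exists>\<omega>\<in>\<Psi>. peq (Vx v) (En \<omega>))"

text \<open>The vertex \<open>v\<close> alone, without any ends, is one part of a split, since each
  end of \<Psi> can be separated from it. Hence nontrivial identifications of vertices occur only
  through ends.\<close>

lemma nonspecial_class:
  assumes v: "v \<in> V" "\<not> special v" and eq: "peq (Vx v) y"
  shows "y = Vx v"
proof -
  have "split {v} {}"
    unfolding split_def
  proof (intro conjI ballI)
    fix \<omega> assume w: "\<omega> \<in> \<Psi>"
    then have "\<not> peq (Vx v) (En \<omega>)" using v by (auto simp: special_def)
    from separate_class_end[OF w v(1) this] obtain S where
      S: "finite S" "S \<subseteq> V" "\<forall>u. peq (Vx v) (Vx u) \<longrightarrow> u \<notin> nbhd S \<omega>" by blast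
    have "v \<notin> nbhd S \<omega>" using S(3) peq_refl v by (simp add: mem_VPsi)
    with S show "\<exists>S. finite S \<and> S \<subseteq> V \<and> (if \<omega> \<in> {} then nbhd S \<omega> \<subseteq> {v} else nbhd S \<omega> \<inter> {v} = {})" by auto
  qed (use v in auto)
  then have "Vx v \<in> pts {v} {} \<longleftrightarrow> y \<in> pts {v} {}" using eq unfolding peq_iff by blast
  then show ?thesis by (auto simp: pts_def)
qed

lemma cls_VPsi: "x \<in> VPsi \<Longrightarrow> cls x = {y. peq x y}"
  by (simp add: pt_class_def)

lemma cls_Ed: "cls (Ed e t) = {Ed e t}"
  by (simp add: pt_class_def mem_VPsi)

lemma cls_eq_iff: "x \<in> VPsi \<Longrightarrow> y \<in> VPsi \<Longrightarrow> cls x = cls y \<longleftrightarrow> peq x y"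
  unfolding cls_VPsi using peq_refl[of y] peq_sym[of x y] peq_trans[of x y] peq_trans[of y x] by blast

lemma mem_cls: "x \<in> VPsi \<Longrightarrow> x \<in> cls x"
  by (simp add: cls_VPsi peq_refl)

lemma cls_neq_Ed:
  assumes "x \<in> VPsi" shows "cls x \<noteq> cls (Ed e t)"
proof
  assume "cls x = cls (Ed e t)"
  then have "x = Ed e t" using mem_cls[OF assms] unfolding cls_Ed by simp
  then show False using assms by (simp add: mem_VPsi)
qed

lemma cls_Ed_eq_iff: "cls (Ed e t) = cls y \<longleftrightarrow> y = Ed e t"
proof (cases "y \<in> VPsi")
  case True
  have "y \<noteq> Ed e t" using True by (cases y) (simp_all add: mem_VPsi)
  then show ?thesis using cls_neq_Ed[OF True, of e t] by simp
next
  case False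
  then have "cls y = {y}" by (simp add: pt_class_def)
  then show ?thesis by (auto simp: cls_Ed)
qed

lemma carrier_cases:
  assumes "x \<in> carrier"
  obtains "x \<in> VPsi" | f t where "x = Ed f t" "f \<in> E" "0 < t" "t < 1"
  using assms by (auto simp: carrier_def VPsi_points_def)

section \<open>The quotient topology and its Hausdorff property\<close>

lemma openin_quot:
  "openin quot U \<longleftrightarrow> U \<subseteq> cls ` carrier \<and> openin XPsi {x \<in> carrier. cls x \<in> U}"
proof -
  have "istopology (\<lambda>U. U \<subseteq> cls ` carrier \<and> openin XPsi {x \<in> carrier. cls x \<in> U})"
    unfolding istopology_def
  proof (intro conjI allI impI)
    fix S T assume "S \<subseteq> cls ` carrier \<and> openin XPsi {x \<in> carrier. cls x \<in> S}"
      "T \<subseteq> cls ` carrier \<and> openin XPsi {x \<in> carrier. cls x \<in> T}"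
    moreover have "{x \<in> carrier. cls x \<in> S \<inter> T} = {x \<in> carrier. cls x \<in> S} \<inter> {x \<in> carrier. cls x \<in> T}" by blast
    ultimately show "S \<inter> T \<subseteq> cls ` carrier" "openin XPsi {x \<in> carrier. cls x \<in> S \<inter> T}"
      by auto
  next
    fix K assume K: "\<forall>S\<in>K. S \<subseteq> cls ` carrier \<and> openin XPsi {x \<in> carrier. cls x \<in> S}"
    then show "\<Union>K \<subseteq> cls ` carrier" by blast
    have "{x \<in> carrier. cls x \<in> \<Union>K} = \<Union>((\<lambda>S. {x \<in> carrier. cls x \<in> S}) ` K)" by blast
    then show "openin XPsi {x \<in> carrier. cls x \<in> \<Union>K}" using K by auto
  qed
  then show ?thesis unfolding tildeG_def quotient_top_def topspace_XPsi by (simp add: topology_inverse')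
qed

lemma topspace_quot: "topspace quot = cls ` carrier"
proof
  have "openin quot (topspace quot)" by simp
  then show "topspace quot \<subseteq> cls ` carrier" unfolding openin_quot by blast
  have "{x \<in> carrier. cls x \<in> cls ` carrier} = topspace XPsi" by auto
  then have "openin quot (cls ` carrier)" unfolding openin_quot by (metis openin_topspace order_refl)
  then show "cls ` carrier \<subseteq> topspace quot" by (rule openin_subset)
qed

text \<open>Inner points of edges form classes of their own, so saturation has to be checked for
  equivalent vertices and ends only.\<close>

lemma openin_quot_image:
  assumes "openin XPsi U" "\<And>x y. x \<in> U \<Longrightarrow> peq x y \<Longrightarrow> y \<in> U"
  shows "openin quot (cls ` U)"
proof -
  have U: "U \<subseteq> carrier" using openin_subset[OF assms(1)] by simp
  have "x \<in> U" if x: "x \<in> carrier" "cls x \<in> cls ` U" for x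
  proof -
    obtain u where u: "u \<in> U" "cls x = cls u" using x by blast
    show ?thesis
    proof (cases "u \<in> VPsi")
      case True
      have "x \<in> VPsi"
      proof (rule ccontr)
        assume "x \<notin> VPsi"
        with x(1) obtain f t where "x = Ed f t" using carrier_cases by blast
        then show False using u cls_neq_Ed[OF True, of f t] by simp
      qed
      then show ?thesis using assms(2)[OF u(1)] True u cls_eq_iff peq_sym by blast
    next
      case False
      with u U obtain f t where "u = Ed f t" using carrier_cases by blast
      then show ?thesis using u cls_Ed_eq_iff[of f t x] by auto
    qed
  qed
  then have "{x \<in> carrier. cls x \<in> cls ` U} = U" using U by blast
  then show ?thesis unfolding openin_quot using assms(1) U by (simp add: image_mono)
qed

lemma openin_quot_side:
  assumes "split A \<Theta>" shows "openin quot (cls ` side A \<Theta>)"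
proof (rule openin_quot_image[OF openin_side[OF assms]])
  fix x y assume x: "x \<in> side A \<Theta>" and xy: "peq x y"
  have "x \<in> pts A \<Theta> \<longleftrightarrow> y \<in> pts A \<Theta>" using xy assms unfolding peq_iff by blast
  then show "y \<in> side A \<Theta>" using x VPsi_side peq_in[OF xy] by simp
qed

lemma openin_quot_edge:
  assumes f: "f \<in> E" and T: "open T" "T \<subseteq> {0<..<1}"
  shows "openin quot (cls ` Ed f ` T)"
proof (rule openin_quot_image)
  show "openin XPsi (Ed f ` T)"
  proof (rule openin_XPsiI)
    show "Ed f ` T \<subseteq> carrier" using f T by (auto simp: mem_carrier)
    fix x :: "('v, 'e) gpoint" assume "x \<in> Ed f ` T"
    then obtain t where t: "x = Ed f t" "t \<in> T" by blast
    then have t01: "0 < t" "t < 1" using T by auto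
    obtain \<delta> where d: "\<delta> > 0" "\<And>s. \<bar>s - t\<bar> < \<delta> \<Longrightarrow> s \<in> T"
      using T(1) t(2) unfolding open_dist dist_real_def by metis
    let ?b = "{Ed f s | s. 0 < s \<and> s < 1 \<and> \<bar>s - t\<bar> < min \<delta> 1}"
    have "?b \<in> basic_opens V E src tgt" using d f t01 by (intro interval_basic) auto
    moreover have "x \<in> ?b" using t t01 d by simp
    moreover have "?b \<inter> carrier \<subseteq> Ed f ` T" using d by auto
    ultimately show "\<exists>b\<in>basic_opens V E src tgt. x \<in> b \<and> b \<inter> carrier \<subseteq> Ed f ` T" by (rule basic_nbhdI)
  qed
  fix x y assume "x \<in> Ed f ` T" "peq x y"
  then show "y \<in> Ed f ` T" using peq_in(1)[of x y] by (auto simp: mem_VPsi)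
qed

text \<open>As \<open>K\<close> keeps a distance from both ends of the edge, small stars miss it.
  Around an end of the graph, deleting the two endvertices of \<open>f\<close> yields a
  \<open>hat\<close> without any point of \<open>f\<close>.\<close>

lemma openin_quot_edge_compl:
  assumes f: "f \<in> E" and K: "closed K" "K \<subseteq> {a..b}" "0 < a" "b < 1"
  shows "openin quot (topspace quot - cls ` Ed f ` K)"
proof -
  have "openin XPsi (carrier - Ed f ` K)"
  proof (rule openin_XPsiI)
    fix x assume x: "x \<in> carrier - Ed f ` K"
    show "\<exists>u\<in>basic_opens V E src tgt. x \<in> u \<and> u \<inter> carrier \<subseteq> carrier - Ed f ` K"
    proof (cases x)
      case (Vx v)
      define \<epsilon> where "\<epsilon> = min 1 (min a (1 - b))"
      have v: "v \<in> V" using x Vx by (simp add: mem_carrier)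
      have e: "0 < \<epsilon>" "\<epsilon> \<le> 1" "\<epsilon> \<le> a" "\<epsilon> \<le> 1 - b" using K by (auto simp: \<epsilon>_def)
      have "star v \<epsilon> \<in> basic_opens V E src tgt" by (rule star_basic[OF v e(1,2)])
      moreover have "x \<in> star v \<epsilon>" using Vx by simp
      moreover have "Ed f t \<notin> star v \<epsilon>" if "t \<in> K" for t
      proof -
        have "a \<le> t" "t \<le> b" using that K(2) by auto
        then show ?thesis using e by auto
      qed
      then have "star v \<epsilon> \<inter> carrier \<subseteq> carrier - Ed f ` K" by blast
      ultimately show ?thesis by (rule basic_nbhdI)
    next
      case (En \<omega>)
      have w: "\<omega> \<in> ends" using x En Psi by (auto simp: mem_carrier)
      let ?S = "{src f, tgt f}"
      have S: "finite ?S" "?S \<subseteq> V" using edge_in f by auto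
      have "hat ?S \<omega> \<in> basic_opens V E src tgt" by (rule hat_basic[OF S w])
      moreover have "x \<in> hat ?S \<omega>" using En En_in_hat[OF w S(1)] by simp
      moreover have "Ed f t \<notin> hat ?S \<omega>" for t
        unfolding hat_edge using Cmp_in[of "src f" ?S \<omega>] Cmp_in[of "tgt f" ?S \<omega>] by blast
      then have "hat ?S \<omega> \<inter> carrier \<subseteq> carrier - Ed f ` K" by blast
      ultimately show ?thesis by (rule basic_nbhdI)
    next
      case (Ed g t)
      have gt: "g \<in> E" "0 < t" "t < 1" using x Ed by (auto simp: mem_carrier)
      obtain \<delta> where d: "\<delta> > 0" "\<And>s. g = f \<Longrightarrow> \<bar>s - t\<bar> < \<delta> \<Longrightarrow> s \<notin> K"
      proof (cases "g = f")
        case True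
        then have "t \<in> - K" using x Ed by auto
        moreover have "open (- K)" using K(1) by auto
        ultimately obtain \<delta> where "\<delta> > 0" "\<And>s. \<bar>s - t\<bar> < \<delta> \<Longrightarrow> s \<in> - K"
          unfolding open_dist dist_real_def by metis
        then show ?thesis using that by blast
      next
        case False then show ?thesis using that[of 1] by simp
      qed
      let ?b = "{Ed g s | s. 0 < s \<and> s < 1 \<and> \<bar>s - t\<bar> < min \<delta> 1}"
      have "?b \<in> basic_opens V E src tgt" using d gt by (intro interval_basic) auto
      moreover have "x \<in> ?b" using Ed gt d by simp
      moreover have "?b \<inter> carrier \<subseteq> carrier - Ed f ` K" using d by auto
      ultimately show ?thesis by (rule basic_nbhdI)
    qed
  qed auto
  moreover have "x \<in> carrier \<Longrightarrow> cls x \<in> topspace quot - cls ` Ed f ` K \<longleftrightarrow> x \<notin> Ed f ` K" for x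
    unfolding topspace_quot using cls_Ed_eq_iff[of f _ x] by (auto simp: eq_commute)
  then have "{x \<in> carrier. cls x \<in> topspace quot - cls ` Ed f ` K} = carrier - Ed f ` K" by blast
  ultimately show ?thesis unfolding openin_quot by (metis Diff_subset topspace_quot)
qed

lemma cls_side_disjoint:
  assumes sp: "split A \<Theta>"
  shows "cls ` side A \<Theta> \<inter> cls ` side (V - A) (\<Psi> - \<Theta>) = {}"
proof -
  have "cls u \<noteq> cls w" if uw: "u \<in> side A \<Theta>" "w \<in> side (V - A) (\<Psi> - \<Theta>)" for u w
  proof
    assume eq: "cls u = cls w"
    have c: "u \<in> carrier" "w \<in> carrier"
      using uw openin_subset[OF openin_side[OF sp]] openin_subset[OF openin_side[OF split_compl[OF sp]]]
      by auto
    show False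
    proof (cases "u \<in> VPsi \<and> w \<in> VPsi")
      case True
      then have "peq u w" using eq cls_eq_iff by blast
      then have "u \<in> pts A \<Theta> \<longleftrightarrow> w \<in> pts A \<Theta>" using sp unfolding peq_iff by blast
      then have "w \<in> side A \<Theta>" using uw True VPsi_side by simp
      then show False using uw side_disjoint[of A "V - A" \<Theta> "\<Psi> - \<Theta>"] by blast
    next
      case False
      then have "u = w" using eq cls_Ed_eq_iff carrier_cases[OF c(1)] carrier_cases[OF c(2)] by metis
      then show False using uw side_disjoint[of A "V - A" \<Theta> "\<Psi> - \<Theta>"] by blast
    qed
  qed
  then show ?thesis by blast
qed

text \<open>Inequivalent vertices or ends are separated by a split; this is what the identification
  achieves. An inner point of an edge is separated from any other point by a small interval and the
  complement of its closure.\<close>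

lemma Hausdorff_quot: "Hausdorff_space quot"
  unfolding Hausdorff_space_def
proof (intro allI impI)
  fix p q assume pq: "p \<in> topspace quot \<and> q \<in> topspace quot \<and> p \<noteq> q"
  then obtain x y where x: "p = cls x" "x \<in> carrier" and y: "q = cls y" "y \<in> carrier"
    by (auto simp: topspace_quot)
  have edge: "\<exists>U W. openin quot U \<and> openin quot W \<and> cls (Ed f t) \<in> U \<and> cls y \<in> W \<and> disjnt U W"
    if f: "f \<in> E" "0 < t" "t < 1" and y: "y \<in> carrier" "y \<noteq> Ed f t" for f t y
  proof -
    \<comment> \<open>Small enough that the closed interval stays inside the edge and misses
      \<open>y\<close> if \<open>y\<close> is on the same edge.\<close>
    obtain \<delta> where d: "\<delta> > 0" "\<delta> < t" "\<delta> < 1 - t" "\<And>s. y = Ed f s \<Longrightarrow> \<delta> < \<bar>s - t\<bar>"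
    proof (cases "\<exists>s. y = Ed f s")
      case True
      then obtain s where s: "y = Ed f s" by blast
      define d where "d = min (min t (1 - t)) \<bar>s - t\<bar> / 2"
      have "s \<noteq> t" using s y by auto
      then have m: "min (min t (1 - t)) \<bar>s - t\<bar> > 0" using f by auto
      have "min (min t (1 - t)) \<bar>s - t\<bar> \<le> t" "min (min t (1 - t)) \<bar>s - t\<bar> \<le> 1 - t"
        "min (min t (1 - t)) \<bar>s - t\<bar> \<le> \<bar>s - t\<bar>" by auto
      with m have "d > 0" "d < t" "d < 1 - t" "d < \<bar>s - t\<bar>" unfolding d_def by linarith+
      then show ?thesis using that[of d] s by auto
    next
      case False
      then show ?thesis using that[of "min t (1 - t) / 2"] f by auto
    qed
    let ?U = "cls ` Ed f ` {t-\<delta><..<t+\<delta>}" and ?W = "topspace quot - cls ` Ed f ` {t-\<delta>..t+\<delta>}"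
    have "openin quot ?U" by (rule openin_quot_edge[OF f(1)]) (use d in auto)
    moreover have "openin quot ?W" by (rule openin_quot_edge_compl[OF f(1), of _ "t-\<delta>" "t+\<delta>"]) (use d in auto)
    moreover have "cls (Ed f t) \<in> ?U" using d(1) by auto
    moreover have "cls y \<in> ?W"
    proof -
      have "cls y \<notin> cls ` Ed f ` {t-\<delta>..t+\<delta>}"
      proof
        assume "cls y \<in> cls ` Ed f ` {t-\<delta>..t+\<delta>}"
        then obtain s where "s \<in> {t-\<delta>..t+\<delta>}" "cls (Ed f s) = cls y" by auto
        then have "y = Ed f s" "\<bar>s - t\<bar> \<le> \<delta>" using cls_Ed_eq_iff by auto
        then show False using d(4) by force
      qed
      then show ?thesis using y by (simp add: topspace_quot)
    qed
    moreover have "disjnt ?U ?W" unfolding disjnt_def by auto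
    ultimately show ?thesis by blast
  qed
  show "\<exists>U W. openin quot U \<and> openin quot W \<and> p \<in> U \<and> q \<in> W \<and> disjnt U W"
  proof (cases "x \<in> VPsi \<and> y \<in> VPsi")
    case True
    then have "\<not> peq x y" using pq x y cls_eq_iff by blast
    then obtain A \<Theta> where sp: "split A \<Theta>" "x \<in> pts A \<Theta>" "y \<notin> pts A \<Theta>" using not_peqE True by blast
    let ?U = "side A \<Theta>" and ?W = "side (V - A) (\<Psi> - \<Theta>)"
    have "x \<in> ?U" using sp True VPsi_side by simp
    moreover have "y \<in> ?W"
      using True sp(3) by (elim conjE VPsi_cases[of y]) (auto simp: mem_side mem_pts)
    moreover have "openin quot (cls ` ?U)" "openin quot (cls ` ?W)"
      using openin_quot_side sp(1) split_compl by blast+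
    moreover have "disjnt (cls ` ?U) (cls ` ?W)"
      using cls_side_disjoint[OF sp(1)] by (simp add: disjnt_def)
    ultimately show ?thesis unfolding x y by blast
  next
    case False
    then consider f t where "x = Ed f t" "f \<in> E" "0 < t" "t < 1" | f t where "y = Ed f t" "f \<in> E" "0 < t" "t < 1"
      using carrier_cases x(2) y(2) by metis
    then show ?thesis
    proof cases
      case 1
      have "y \<noteq> x" using pq x y by auto
      then show ?thesis using edge[OF 1(2-4) y(2)] 1(1) x y by auto
    next
      case 2
      have "x \<noteq> y" using pq x y by auto
      then obtain U W where "openin quot U" "openin quot W" "q \<in> U" "p \<in> W" "disjnt U W"
        using edge[OF 2(2-4) x(2)] 2(1) x y by auto
      then show ?thesis using disjnt_sym by blast
    qed
  qed
qed

end

section \<open>Circles and partitions\<close>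

lemma topological_circle_map:
  assumes "topological_circle X C"
  obtains f where "homeomorphic_map (top_of_set (sphere (0::complex) 1)) (subtopology X C) f"
    "f ` sphere 0 1 = C" "inj_on f (sphere 0 1)"
proof -
  have "subtopology X C homeomorphic_space top_of_set (sphere (0::complex) 1)" and C: "C \<subseteq> topspace X"
    using assms by (auto simp: topological_circle_def)
  then have "top_of_set (sphere (0::complex) 1) homeomorphic_space subtopology X C"
    using homeomorphic_space_sym by blast
  then obtain f where f: "homeomorphic_map (top_of_set (sphere (0::complex) 1)) (subtopology X C) f"
    unfolding homeomorphic_space by blast
  have "f ` sphere 0 1 = C" using homeomorphic_imp_surjective_map[OF f] C by (simp add: Int_absorb1)
  moreover have "inj_on f (sphere 0 1)" using homeomorphic_imp_injective_map[OF f] by simp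
  ultimately show ?thesis using that f by blast
qed

lemma topological_circle_connected_image:
  assumes f: "homeomorphic_map (top_of_set S) (subtopology X C) f" and T: "T \<subseteq> S" "connected T"
  shows "connectedin X (f ` T)"
proof -
  have "connectedin (top_of_set S) T" using T by (simp add: connectedin_subtopology)
  then have "connectedin (subtopology X C) (f ` T)"
    by (rule connectedin_continuous_map_image[OF homeomorphic_imp_continuous_map[OF f]])
  then show ?thesis by (simp add: connectedin_subtopology)
qed

lemma topological_circle_connected:
  assumes "topological_circle X C"
  shows "connectedin X C"
proof -
  obtain f where f: "homeomorphic_map (top_of_set (sphere (0::complex) 1)) (subtopology X C) f"
    "f ` sphere 0 1 = C" by (rule topological_circle_map[OF assms])
  have "connected (sphere (0::complex) 1)" by (rule connected_sphere) simp
  then show ?thesis using topological_circle_connected_image[OF f(1)] f(2) by blast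
qed

text \<open>A circle has no cut point: the punctured sphere is homeomorphic to a hyperplane of the
  plane, that is, to a line.\<close>

lemma topological_circle_punctured:
  assumes "topological_circle X C" "p \<in> C"
  shows "connectedin X (C - {p})"
proof -
  obtain f where f: "homeomorphic_map (top_of_set (sphere (0::complex) 1)) (subtopology X C) f"
    "f ` sphere 0 1 = C" "inj_on f (sphere 0 1)" by (rule topological_circle_map[OF assms(1)])
  obtain z where z: "z \<in> sphere 0 1" "p = f z" using assms(2) f(2) by blast
  have "(sphere 0 1 - {z}) homeomorphic {x::complex. 1 \<bullet> x = 0}"
    by (rule homeomorphic_punctured_sphere_hyperplane) (use z in auto)
  moreover have "connected {x::complex. 1 \<bullet> x = 0}" by (intro convex_connected convex_hyperplane)
  ultimately have "connected (sphere 0 1 - {z})" using homeomorphic_connectedness by blast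
  then have "connectedin X (f ` (sphere 0 1 - {z}))"
    by (intro topological_circle_connected_image[OF f(1)]) auto
  moreover have "f ` (sphere 0 1 - {z}) = C - {p}" using f(2,3) z by (simp add: inj_on_image_set_diff)
  ultimately show ?thesis by simp
qed

lemma topological_circle_three_points:
  assumes "topological_circle X C"
  obtains a b c where "a \<in> C" "b \<in> C" "c \<in> C" "a \<noteq> b" "b \<noteq> c" "a \<noteq> c"
proof -
  obtain f where f: "f ` sphere (0::complex) 1 = C" "inj_on f (sphere 0 1)"
    by (rule topological_circle_map[OF assms])
  have s: "1 \<in> sphere (0::complex) 1" "-1 \<in> sphere (0::complex) 1" "\<i> \<in> sphere (0::complex) 1" by auto
  have n: "(1::complex) \<noteq> -1" "-1 \<noteq> \<i>" "1 \<noteq> \<i>" by (auto simp: complex_eq_iff)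
  show ?thesis
    by (rule that[of "f 1" "f (-1)" "f \<i>"]) (use s n f inj_on_eq_iff[OF f(2)] in auto)
qed

lemma punctured_circle_not_separated:
  assumes "topological_circle X C" "p \<in> C" "openin X U" "openin X W" "C - {p} \<subseteq> U \<union> W"
    "U \<inter> W \<inter> (C - {p}) = {}" "u \<in> U" "u \<in> C" "u \<noteq> p" "w \<in> W" "w \<in> C" "w \<noteq> p"
  shows False
  using connectedinD[OF topological_circle_punctured[OF assms(1,2)] assms(3-6)] assms(7-) by blast

context psi_graph
begin

section \<open>Circles in the quotient and the edges they meet\<close>

abbreviation "epoint f t \<equiv> cls (Ed f t)"

lemma epoint_eq_iff: "epoint f t = epoint g s \<longleftrightarrow> f = g \<and> t = s"
  by (simp add: cls_Ed)

lemma epoint_in_image_iff: "epoint f t \<in> epoint f ` T \<longleftrightarrow> t \<in> T"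
  by (simp add: image_iff epoint_eq_iff)

lemma openin_epoints: "f \<in> E \<Longrightarrow> open T \<Longrightarrow> T \<subseteq> {0<..<1} \<Longrightarrow> openin quot (epoint f ` T)"
  using openin_quot_edge[of f T] by (simp add: image_image)

lemma openin_epoints_compl:
  assumes "f \<in> E" "0 < s" "s < 1" "0 < t" "t < 1"
  shows "openin quot (topspace quot - epoint f ` closed_segment s t)"
  using openin_quot_edge_compl[OF assms(1), of "closed_segment s t" "min s t" "max s t"] assms
  by (auto simp: image_image closed_segment_eq_real_ivl)

text \<open>Of three points of a circle on one open edge, the middle one would be a cut
  point.\<close>

lemma circle_not_in_edge:
  assumes C: "topological_circle quot C" and f: "f \<in> E"
  shows "\<not> C \<subseteq> epoint f ` {0<..<1}"
proof
  assume sub: "C \<subseteq> epoint f ` {0<..<1}"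
  obtain x y z where xyz: "x \<in> C" "y \<in> C" "z \<in> C" "x \<noteq> y" "y \<noteq> z" "x \<noteq> z"
    by (rule topological_circle_three_points[OF C])
  have "\<exists>r\<in>{0<..<1}. v = epoint f r" if "v \<in> C" for v using that sub by blast
  with xyz(1-3) obtain r s t where r: "x = epoint f r" "y = epoint f s" "z = epoint f t"
    "r \<in> {0<..<1}" "s \<in> {0<..<1}" "t \<in> {0<..<1}" by meson
  have mid: False if "a < b" "b < c" "epoint f a \<in> C" "epoint f b \<in> C" "epoint f c \<in> C"
    "0 < a" "c < 1" for a b c :: real
  proof (rule punctured_circle_not_separated[OF C that(4)])
    show "openin quot (epoint f ` {0<..<b})" "openin quot (epoint f ` {b<..<1})"
      using that f by (auto intro!: openin_epoints)
    show "C - {epoint f b} \<subseteq> epoint f ` {0<..<b} \<union> epoint f ` {b<..<1}"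
    proof
      fix x assume x: "x \<in> C - {epoint f b}"
      then obtain u where u: "x = epoint f u" "u \<in> {0<..<1}" using sub by blast
      with x have "u \<noteq> b" by blast
      then have "u \<in> {0<..<b} \<or> u \<in> {b<..<1}" using u by auto
      then show "x \<in> epoint f ` {0<..<b} \<union> epoint f ` {b<..<1}" using u by blast
    qed
    have "x \<notin> epoint f ` {b<..<1}" if "x \<in> epoint f ` {0<..<b}" for x
      using that by (elim imageE) (simp add: epoint_in_image_iff)
    then show "epoint f ` {0<..<b} \<inter> epoint f ` {b<..<1} \<inter> (C - {epoint f b}) = {}" by blast
    show "epoint f a \<in> epoint f ` {0<..<b}" "epoint f c \<in> epoint f ` {b<..<1}"
      using that by (simp_all add: epoint_in_image_iff)
    show "epoint f a \<noteq> epoint f b" "epoint f c \<noteq> epoint f b" using that by (simp_all add: epoint_eq_iff)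
    show "epoint f a \<in> C" "epoint f c \<in> C" using that by simp_all
  qed
  have "r \<noteq> s" "s \<noteq> t" "r \<noteq> t" using r xyz by auto
  then consider "r < s" "s < t" | "r < t" "t < s" | "s < r" "r < t" | "s < t" "t < r" | "t < r" "r < s" | "t < s" "s < r"
    by linarith
  then show False using mid r xyz by cases simp_all
qed

text \<open>The part of \<open>C\<close> strictly between \<open>t\<close> and \<open>s\<close> is
  bounded by the point at \<open>t\<close> and by a point that \<open>C\<close> misses. Deleting the
  point at \<open>t\<close> would cut it off from a point of \<open>C\<close> outside the edge,
  which exists by \<open>circle_not_in_edge\<close>.\<close>

lemma circle_edge_gap:
  assumes C: "topological_circle quot C" and f: "f \<in> E"
    and s: "0 < s" "s < 1" "epoint f s \<notin> C"
    and t: "0 < t" "t < 1" "epoint f t \<in> C"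
    and u: "u \<in> open_segment t s" "epoint f u \<in> C"
  shows False
proof -
  have ts: "t \<noteq> s" using s t by auto
  obtain w where w: "w \<in> C" "w \<notin> epoint f ` {0<..<1}" using circle_not_in_edge[OF C f] by blast
  have CT: "C \<subseteq> topspace quot" using C by (simp add: topological_circle_def)
  have seg: "closed_segment t s \<subseteq> {0<..<1}" "open_segment t s \<subseteq> {0<..<1}"
    using s t by (auto simp: closed_segment_eq_real_ivl open_segment_eq_real_ivl split: if_splits)
  show False
  proof (rule punctured_circle_not_separated[OF C t(3)])
    show "openin quot (epoint f ` open_segment t s)" using f seg
      by (intro openin_epoints) (auto simp: open_segment_eq_real_ivl)
    show "openin quot (topspace quot - epoint f ` closed_segment t s)" using f s t by (intro openin_epoints_compl)
    show "C - {epoint f t} \<subseteq> epoint f ` open_segment t s \<union> (topspace quot - epoint f ` closed_segment t s)"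
    proof
      fix x assume x: "x \<in> C - {epoint f t}"
      show "x \<in> epoint f ` open_segment t s \<union> (topspace quot - epoint f ` closed_segment t s)"
      proof (cases "x \<in> epoint f ` closed_segment t s")
        case True
        then obtain v where v: "x = epoint f v" "v \<in> closed_segment t s" by blast
        then have "v \<noteq> t" "v \<noteq> s" using x s(3) by auto
        then have "v \<in> open_segment t s" using v by (simp add: open_segment_def)
        then show ?thesis using v(1) by simp
      qed (use x CT in blast)
    qed
    show "epoint f ` open_segment t s \<inter> (topspace quot - epoint f ` closed_segment t s) \<inter> (C - {epoint f t}) = {}"
      using segment_open_subset_closed[of t s] by blast
    show "epoint f u \<in> epoint f ` open_segment t s" "epoint f u \<in> C" using u by simp_all
    show "epoint f u \<noteq> epoint f t" using u by (simp add: epoint_eq_iff open_segment_def)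
    show "w \<in> topspace quot - epoint f ` closed_segment t s" using w CT seg by blast
    show "w \<in> C" by fact
    have "t \<in> {0<..<1}" using t by simp
    then show "w \<noteq> epoint f t" using w(2) by blast
  qed
qed

text \<open>If \<open>C\<close> missed the point at \<open>s\<close>, then by
  \<open>circle_edge_gap\<close> the point at \<open>t\<close> would be the only one of
  \<open>C\<close> on its side of \<open>s\<close>, hence isolated in \<open>C\<close>.
  Connectedness would then force all of \<open>C\<close> into the edge.\<close>

lemma circle_contains_edge:
  assumes C: "topological_circle quot C" and f: "f \<in> E"
    and t: "0 < t" "t < 1" "epoint f t \<in> C"
  shows "f \<in> circle_edges V E src tgt \<Psi> C"
proof (rule ccontr)
  assume "f \<notin> circle_edges V E src tgt \<Psi> C"
  then obtain s where s: "0 < s" "s < 1" "epoint f s \<notin> C" using f by (auto simp: circle_edges_def)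
  have ts: "t \<noteq> s" using s t by auto
  define H where "H = (if t < s then {0<..<s} else {s<..<1})"
  have H: "open H" "H \<subseteq> {0<..<1}" "t \<in> H" using s t ts by (auto simp: H_def)
  have uniq: "u = t" if u: "u \<in> H" "epoint f u \<in> C" for u
  proof (rule ccontr)
    assume "u \<noteq> t"
    then have "u \<in> open_segment t s \<or> t \<in> open_segment u s"
      using u(1) ts by (auto simp: H_def open_segment_eq_real_ivl split: if_splits)
    moreover have "0 < u" "u < 1" using H u by auto
    ultimately show False using circle_edge_gap[OF C f s] t u by blast
  qed
  have seg: "closed_segment t s \<subseteq> insert s H" using ts by (auto simp: H_def closed_segment_eq_real_ivl split: if_splits) (use s t in auto)
  have CT: "C \<subseteq> topspace quot" using C by (simp add: topological_circle_def)
  have "C \<subseteq> epoint f ` H \<union> (topspace quot - epoint f ` closed_segment t s)"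
  proof
    fix x assume x: "x \<in> C"
    show "x \<in> epoint f ` H \<union> (topspace quot - epoint f ` closed_segment t s)"
    proof (cases "x \<in> epoint f ` closed_segment t s")
      case True
      then obtain u where u: "x = epoint f u" "u \<in> insert s H" using seg by blast
      then have "u \<noteq> s" using x s(3) by auto
      then show ?thesis using u by simp
    next
      case False then show ?thesis using x CT by blast
    qed
  qed
  moreover have "epoint f ` H \<inter> (topspace quot - epoint f ` closed_segment t s) \<inter> C = {}"
  proof -
    have "v \<in> closed_segment t s" if "v \<in> H" "epoint f v \<in> C" for v using uniq[OF that] by simp
    then show ?thesis by blast
  qed
  moreover have "openin quot (epoint f ` H)" "openin quot (topspace quot - epoint f ` closed_segment t s)"
    using openin_epoints[OF f H(1,2)] openin_epoints_compl[OF f t(1,2) s(1,2)] by auto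
  moreover have "epoint f ` H \<inter> C \<noteq> {}" using H(3) t(3) by blast
  ultimately have "\<not> (topspace quot - epoint f ` closed_segment t s) \<inter> C \<noteq> {}"
    using connectedinD[OF topological_circle_connected[OF C]] by metis
  then have "C \<subseteq> epoint f ` closed_segment t s" using CT by blast
  then have "C \<subseteq> epoint f ` insert s H" using seg by blast
  moreover have "insert s H \<subseteq> {0<..<1}" using H s by simp
  ultimately have "C \<subseteq> epoint f ` {0<..<1}" by blast
  then show False using circle_not_in_edge[OF C f] by blast
qed

text \<open>Only midpoints of crossing edges lie on neither side. If \<open>e\<close> were the only
  crossing edge of \<open>C\<close>, deleting its midpoint would leave a set covered by two disjoint
  open sets, each containing a point of \<open>e\<close>, although a punctured circle is
  connected.\<close>

lemma circle_crosses_split_twice: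
  assumes C: "topological_circle quot C" and sp: "split A \<Theta>"
    and e: "e \<in> circle_edges V E src tgt \<Psi> C" "(src e \<in> A) \<noteq> (tgt e \<in> A)"
  shows "\<exists>f\<in>circle_edges V E src tgt \<Psi> C. f \<noteq> e \<and> (src f \<in> A) \<noteq> (tgt f \<in> A)"
proof (rule ccontr)
  assume no: "\<not> ?thesis"
  let ?U = "side A \<Theta>" and ?W = "side (V - A) (\<Psi> - \<Theta>)"
  have eE: "e \<in> E" and ep: "epoint e t \<in> C" if "0 < t" "t < 1" for t using e(1) that by (auto simp: circle_edges_def)
  have eE: "e \<in> E" using e(1) by (auto simp: circle_edges_def)
  have open_: "openin quot (cls ` ?U)" "openin quot (cls ` ?W)"
    using openin_quot_side sp split_compl by blast+
  have sub: "C - {epoint e (1/2)} \<subseteq> cls ` ?U \<union> cls ` ?W"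
  proof
    fix x assume x: "x \<in> C - {epoint e (1/2)}"
    then have "x \<in> topspace quot" using C by (auto simp: topological_circle_def)
    then obtain y where y: "x = cls y" "y \<in> carrier" by (auto simp: topspace_quot)
    have "y \<in> ?U \<union> ?W"
    proof (cases y)
      case (Ed f t)
      then have f: "f \<in> E" "0 < t" "t < 1" using y by (auto simp: mem_carrier)
      \<comment> \<open>A crossing edge whose midpoint is in \<open>C\<close> belongs to
        \<open>C\<close> entirely and is therefore \<open>e\<close>, whose midpoint has been
        deleted.\<close>
      have "(src f \<in> A) = (tgt f \<in> A)" if "t = 1/2"
      proof (rule ccontr)
        assume a: "(src f \<in> A) \<noteq> (tgt f \<in> A)"
        have "f \<in> circle_edges V E src tgt \<Psi> C"
          using circle_contains_edge[OF C f] x y Ed by auto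
        then have "f = e" using no a by blast
        then show False using x y Ed that by auto
      qed
      then show ?thesis using Ed f edge_in[OF f(1)] by (auto simp: mem_side)
    qed (use y in \<open>auto simp: mem_side mem_carrier\<close>)
    then show "x \<in> cls ` ?U \<union> cls ` ?W" using y by blast
  qed
  have dis: "cls ` ?U \<inter> cls ` ?W = {}" by (rule cls_side_disjoint[OF sp])
  have V: "src e \<in> V" "tgt e \<in> V" using edge_in[OF eE] by auto
  have q: "epoint e (1/4) \<in> C" "epoint e (3/4) \<in> C" "epoint e (1/2) \<in> C" using ep by auto
  have n: "epoint e (1/4) \<noteq> epoint e (1/2)" "epoint e (3/4) \<noteq> epoint e (1/2)" by (simp_all add: epoint_eq_iff)
  show False
  proof (cases "src e \<in> A")
    case True
    then have "Ed e (1/4) \<in> ?U" "Ed e (3/4) \<in> ?W" using eE V e(2) by (auto simp: mem_side)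
    then have "epoint e (1/4) \<in> cls ` ?U" "epoint e (3/4) \<in> cls ` ?W" by blast+
    from punctured_circle_not_separated[OF C q(3) open_ sub _ this(1) q(1) n(1) this(2) q(2) n(2)] dis
    show False by blast
  next
    case False
    then have "Ed e (3/4) \<in> ?U" "Ed e (1/4) \<in> ?W" using eE V e(2) by (auto simp: mem_side)
    then have "epoint e (3/4) \<in> cls ` ?U" "epoint e (1/4) \<in> cls ` ?W" by blast+
    from punctured_circle_not_separated[OF C q(3) open_ sub _ this(1) q(2) n(2) this(2) q(1) n(1)] dis
    show False by blast
  qed
qed

end

section \<open>Finite circles\<close>

definition join_maps :: "(real \<Rightarrow> 'a) \<Rightarrow> (real \<Rightarrow> 'a) \<Rightarrow> real \<Rightarrow> 'a" where
  "join_maps g h t = (if t \<le> 1/2 then g (2 * t) else h (2 * t - 1))"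

lemma continuous_join_maps:
  assumes g: "continuous_map (top_of_set {0..1}) X g" and h: "continuous_map (top_of_set {0..1}) X h"
    and eq: "g 1 = h 0"
  shows "continuous_map (top_of_set {0..1}) X (join_maps g h)"
proof -
  let ?T = "top_of_set {0..1::real}"
  have "continuous_map ?T X (\<lambda>t. if t \<le> 1/2 then (g \<circ> (\<lambda>t. 2 * t)) t else (h \<circ> (\<lambda>t. 2 * t - 1)) t)"
  proof (rule continuous_map_cases_le)
    show "continuous_map ?T euclideanreal (\<lambda>t. t)" by simp
    show "continuous_map ?T euclideanreal (\<lambda>t. 1/2)" by simp
    have "continuous_map (subtopology ?T {x \<in> topspace ?T. x \<le> 1/2}) ?T (\<lambda>t. 2 * t)"
      by (auto simp: subtopology_subtopology continuous_map_in_subtopology intro!: continuous_intros)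
    then show "continuous_map (subtopology ?T {x \<in> topspace ?T. x \<le> 1/2}) X (g \<circ> (\<lambda>t. 2 * t))"
      using g by (rule continuous_map_compose)
    have "continuous_map (subtopology ?T {x \<in> topspace ?T. 1/2 \<le> x}) ?T (\<lambda>t. 2 * t - 1)"
      by (auto simp: subtopology_subtopology continuous_map_in_subtopology intro!: continuous_intros)
    then show "continuous_map (subtopology ?T {x \<in> topspace ?T. 1/2 \<le> x}) X (h \<circ> (\<lambda>t. 2 * t - 1))"
      using h by (rule continuous_map_compose)
    show "(g \<circ> (\<lambda>t. 2 * t)) x = (h \<circ> (\<lambda>t. 2 * t - 1)) x" if "x = 1/2" for x :: real
    proof -
      have "2 * x = 1" using that by simp
      then show ?thesis using eq by simp
    qed
  qed
  then show ?thesis unfolding join_maps_def[abs_def] comp_def .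
qed

lemma join_maps_image: "join_maps g h ` {0..1} \<subseteq> g ` {0..1} \<union> h ` {0..1}"
  by (auto simp: join_maps_def)

lemma join_maps_ends: "join_maps g h 0 = g 0" "join_maps g h 1 = h 1"
  by (auto simp: join_maps_def)

text \<open>The flag \<open>P\<close> allows the two arcs to meet in their outer ends as well:
  \<open>False\<close> yields an arc, \<open>True\<close> a closed curve.\<close>

lemma join_maps_eq_cases:
  assumes g: "inj_on g {0..1}" and h: "inj_on h {0..1}" and eq: "g 1 = h 0"
    and meet: "\<forall>a\<in>{0..1}. \<forall>b\<in>{0..1}. g a = h b \<longrightarrow> (a = 1 \<and> b = 0) \<or> (a = 0 \<and> b = 1 \<and> P)"
    and st: "s \<in> {0..1}" "t \<in> {0..1}" "s \<le> t" "join_maps g h s = join_maps g h t"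
  shows "s = t \<or> (s = 0 \<and> t = 1 \<and> P)"
proof -
  consider "s \<le> 1/2" "t \<le> 1/2" | "s \<le> 1/2" "t > 1/2" | "s > 1/2" "t > 1/2" using st(3) by linarith
  then show ?thesis
  proof cases
    case 1
    then have "g (2 * s) = g (2 * t)" using st by (simp add: join_maps_def)
    then have "2 * s = 2 * t" by (rule inj_onD[OF g]) (use 1 st in auto)
    then show ?thesis by simp
  next
    case 2
    then have "g (2 * s) = h (2 * t - 1)" using st by (simp add: join_maps_def)
    then have "(2 * s = 1 \<and> 2 * t - 1 = 0) \<or> (2 * s = 0 \<and> 2 * t - 1 = 1 \<and> P)"
      by (rule meet[rule_format, rotated 2]) (use 2 st in auto)
    then show ?thesis by auto
  next
    case 3
    then have "h (2 * s - 1) = h (2 * t - 1)" using st by (simp add: join_maps_def)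
    then have "2 * s - 1 = 2 * t - 1" by (rule inj_onD[OF h]) (use 3 st in auto)
    then show ?thesis by simp
  qed
qed

lemma cis_eq_unit_interval:
  assumes "s \<in> {0..1}" "t \<in> {0..1}" "s \<le> t" "cis (2 * pi * s) = cis (2 * pi * t)"
  shows "s = t \<or> (s = 0 \<and> t = 1)"
proof -
  have "sin (2 * pi * s) = sin (2 * pi * t) \<and> cos (2 * pi * s) = cos (2 * pi * t)"
    using assms(4) by (simp add: complex_eq_iff)
  then obtain n where "2 * pi * s = 2 * pi * t + 2 * pi * real_of_int n"
    unfolding sin_cos_eq_iff by auto
  then have "2 * pi * s = 2 * pi * (t + real_of_int n)" by (simp add: distrib_left)
  then have n: "s = t + real_of_int n" by simp
  then have "real_of_int n \<ge> -1" "real_of_int n \<le> 0" using assms by auto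
  then have "n = 0 \<or> n = -1" by linarith
  then show ?thesis using n assms by auto
qed

text \<open>The exponential map is a quotient map from the interval onto the circle,
  \<open>h\<close> factors through it, and the induced injection of a compact space into a Hausdorff
  space is an embedding.\<close>

lemma closed_curve_circle:
  fixes h :: "real \<Rightarrow> 'a"
  assumes X: "Hausdorff_space X" and h: "continuous_map (top_of_set {0..1}) X h"
    and closed: "h 0 = h 1"
    and inj: "\<And>s t. s \<in> {0..1} \<Longrightarrow> t \<in> {0..1} \<Longrightarrow> s \<le> t \<Longrightarrow> h s = h t \<Longrightarrow> s = t \<or> (s = 0 \<and> t = 1)"
  shows "topological_circle X (h ` {0..1})"
proof -
  let ?I = "top_of_set {0..1::real}" and ?S = "top_of_set (sphere (0::complex) 1)"
  let ?q = "\<lambda>t::real. cis (2 * pi * t)"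
  have comp: "compact_space ?I" "compact_space ?S" by (simp_all add: compact_space_subtopology)
  have haus: "Hausdorff_space ?S" by (simp add: Hausdorff_space_subtopology)
  have surj: "?q ` {0..1} = sphere 0 1"
  proof
    show "?q ` {0..1} \<subseteq> sphere 0 1" by auto
    show "sphere 0 1 \<subseteq> ?q ` {0..1}"
    proof
      fix z :: complex assume z: "z \<in> sphere 0 1"
      then have "z \<noteq> 0" "norm z = 1" by auto
      have "\<exists>t. 0 \<le> t \<and> t < 2 * pi \<and> z = cis t"
        using Arg2pi[of z] \<open>norm z = 1\<close> by (intro exI[of _ "Arg2pi z"]) (simp add: cis_conv_exp is_Arg_def)
      then obtain t where t: "0 \<le> t" "t < 2 * pi" "z = cis t" by blast
      have "t / (2 * pi) \<in> {0..1}" using t by (simp add: field_simps)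
      moreover have "?q (t / (2 * pi)) = z" using t by simp
      ultimately show "z \<in> ?q ` {0..1}" by (metis image_eqI)
    qed
  qed
  have "continuous_map ?I ?S ?q"
    using surj by (auto simp: continuous_map_in_subtopology cis_conv_exp intro!: continuous_intros)
  then have quot: "quotient_map ?I ?S ?q"
    using comp haus surj by (intro T1_Spaces.continuous_imp_quotient_map) auto
  have cong: "h x = h y" if "x \<in> {0..1}" "y \<in> {0..1}" "?q x = ?q y" for x y
  proof (cases "x \<le> y")
    case True
    from cis_eq_unit_interval[OF that(1,2) True that(3)] show ?thesis using closed by blast
  next
    case False
    then have "y \<le> x" by simp
    from cis_eq_unit_interval[OF that(2,1) this that(3)[symmetric]] show ?thesis
      using closed[symmetric] by blast
  qed
  obtain k where k: "continuous_map ?S X k" "k ` topspace ?S = h ` topspace ?I"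
    "\<And>x. x \<in> topspace ?I \<Longrightarrow> k (?q x) = h x"
  proof (rule quotient_map_lift_exists[OF quot h])
    show "h x = h y" if "x \<in> topspace ?I" "y \<in> topspace ?I" "?q x = ?q y" for x y
      using cong[of x y] that by simp
  qed (rule that)
  have kim: "k ` sphere 0 1 = h ` {0..1}" using k(2) by simp
  have kq: "k (?q x) = h x" if "x \<in> {0..1}" for x using k(3) that by simp
  have hX: "h ` {0..1} \<subseteq> topspace X" using continuous_map_image_subset_topspace[OF h] by simp
  have "inj_on k (sphere 0 1)"
  proof (rule inj_onI)
    fix z w assume zw: "z \<in> sphere 0 1" "w \<in> sphere 0 1" "k z = k w"
    then obtain s t where st: "s \<in> {0..1}" "t \<in> {0..1}" "z = ?q s" "w = ?q t"
      unfolding surj[symmetric] by blast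
    then have hst: "h s = h t" using zw(3) kq by simp
    have "s = t \<or> (s = 0 \<and> t = 1) \<or> (s = 1 \<and> t = 0)"
    proof (cases "s \<le> t")
      case True
      from inj[OF st(1,2) True hst] show ?thesis by blast
    next
      case False
      then have "t \<le> s" by simp
      from inj[OF st(2,1) this hst[symmetric]] show ?thesis by blast
    qed
    then show "z = w" unfolding st by (elim disjE conjE) simp_all
  qed
  then have "homeomorphic_map ?S (subtopology X (h ` {0..1})) k"
    using comp X kim hX k(1)
    by (intro continuous_imp_homeomorphic_map)
      (auto simp: continuous_map_in_subtopology Hausdorff_space_subtopology Int_absorb1)
  then have "?S homeomorphic_space subtopology X (h ` {0..1})"
    using homeomorphic_space by blast
  then show ?thesis using hX homeomorphic_space_sym unfolding topological_circle_def by blast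
qed

context psi_graph
begin

section \<open>Edges as arcs of the quotient\<close>

lemma openin_graph_space_edge:
  assumes "generate_topology_on (basic_opens V E src tgt) U" "Ed e t \<in> U"
  shows "\<exists>\<delta>>0. \<forall>s. 0 < s \<and> s < 1 \<and> \<bar>s - t\<bar> < \<delta> \<longrightarrow> Ed e s \<in> U"
  using assms
proof (induction rule: generate_topology_on.induct)
  case (Int a b)
  have "Ed e t \<in> a" "Ed e t \<in> b" using Int.prems by simp_all
  from Int.IH(1)[OF this(1)] Int.IH(2)[OF this(2)] obtain \<delta>1 \<delta>2 where
    d: "\<delta>1 > 0" "\<forall>s. 0 < s \<and> s < 1 \<and> \<bar>s - t\<bar> < \<delta>1 \<longrightarrow> Ed e s \<in> a"
      "\<delta>2 > 0" "\<forall>s. 0 < s \<and> s < 1 \<and> \<bar>s - t\<bar> < \<delta>2 \<longrightarrow> Ed e s \<in> b" by (elim exE conjE)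
  then show ?case by (intro exI[of _ "min \<delta>1 \<delta>2"]) simp
next
  case (UN K)
  then obtain k where "k \<in> K" "Ed e t \<in> k" by blast
  with UN.IH show ?case by (metis UnionI)
next
  case (Basis s)
  then show ?case
  proof (cases rule: basic_cases)
    case (star v \<epsilon>)
    then have e: "e \<in> E" "(src e = v \<and> t < \<epsilon>) \<or> (tgt e = v \<and> 1 - t < \<epsilon>)" using Basis by auto
    then show ?thesis
    proof (elim disjE)
      assume "src e = v \<and> t < \<epsilon>"
      then have "\<forall>u. 0 < u \<and> u < 1 \<and> \<bar>u - t\<bar> < \<epsilon> - t \<longrightarrow> Ed e u \<in> s"
        using e(1) unfolding star(4) by auto
      then show ?thesis using \<open>src e = v \<and> t < \<epsilon>\<close> by (intro exI[of _ "\<epsilon> - t"]) simp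
    next
      assume "tgt e = v \<and> 1 - t < \<epsilon>"
      then have "\<forall>u. 0 < u \<and> u < 1 \<and> \<bar>u - t\<bar> < \<epsilon> - (1 - t) \<longrightarrow> Ed e u \<in> s"
        using e(1) unfolding star(4) by auto
      then show ?thesis using \<open>tgt e = v \<and> 1 - t < \<epsilon>\<close> by (intro exI[of _ "\<epsilon> - (1 - t)"]) simp
    qed
  next
    case (interval f u \<epsilon>)
    then have "e = f" "\<bar>t - u\<bar> < \<epsilon>" using Basis by auto
    then have "\<forall>v. 0 < v \<and> v < 1 \<and> \<bar>v - t\<bar> < \<epsilon> - \<bar>t - u\<bar> \<longrightarrow> Ed e v \<in> s"
      unfolding interval(5) by auto
    then show ?thesis using \<open>\<bar>t - u\<bar> < \<epsilon>\<close> by (intro exI[of _ "\<epsilon> - \<bar>t - u\<bar>"]) simp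
  next
    case (hat S \<omega>)
    then have "\<forall>u. 0 < u \<and> u < 1 \<and> \<bar>u - t\<bar> < 1 \<longrightarrow> Ed e u \<in> s" using Basis by (simp add: hat_edge)
    then show ?thesis by (intro exI[of _ 1]) simp
  qed
qed auto

text \<open>Constant beyond both ends of the interval, so that continuity can be checked with
  neighbourhoods in the whole real line.\<close>

definition edge_map :: "'e \<Rightarrow> real \<Rightarrow> ('v, 'e) gpoint set" where
  "edge_map f t = cls (if t \<le> 0 then Vx (src f) else if 1 \<le> t then Vx (tgt f) else Ed f t)"

lemma edge_map_ends: "edge_map f 0 = cls (Vx (src f))" "edge_map f 1 = cls (Vx (tgt f))"
  by (simp_all add: edge_map_def)

lemma edge_map_inner: "0 < t \<Longrightarrow> t < 1 \<Longrightarrow> edge_map f t = epoint f t"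
  by (simp add: edge_map_def)

lemma continuous_cls: "continuous_map XPsi quot cls"
  unfolding continuous_map
proof (intro conjI allI impI)
  show "cls ` topspace XPsi \<subseteq> topspace quot" by (simp add: topspace_quot)
  fix U assume "openin quot U"
  then show "openin XPsi {x \<in> topspace XPsi. cls x \<in> U}" by (simp add: openin_quot)
qed

lemma continuous_edge_map:
  assumes f: "f \<in> E"
  shows "continuous_map (top_of_set {0..1}) quot (edge_map f)"
proof -
  let ?g = "\<lambda>t. if t \<le> 0 then Vx (src f) else if 1 \<le> t then Vx (tgt f) else Ed f t"
  have "continuous_map (top_of_set {0..1}) XPsi ?g"
    unfolding continuous_map
  proof (intro conjI allI impI)
    show "?g ` topspace (top_of_set {0..1}) \<subseteq> topspace XPsi" using f edge_in[OF f] by (auto simp: mem_carrier)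
    fix U assume U: "openin XPsi U"
    have "\<exists>\<delta>>0. \<forall>s. \<bar>s - t\<bar> < \<delta> \<longrightarrow> ?g s \<in> U" if t: "?g t \<in> U" for t
    proof -
      consider "t < 0" | "t = 0" | "0 < t" "t < 1" | "t = 1" | "1 < t" by linarith
      then show ?thesis
      proof cases
        case 1
        then have "\<forall>s. \<bar>s - t\<bar> < - t \<longrightarrow> ?g s \<in> U" using t by simp
        then show ?thesis using 1 by (intro exI[of _ "- t"]) simp
      next
        case 2
        then have "Vx (src f) \<in> U" using t by simp
        then obtain \<epsilon> where e: "\<epsilon> > 0" "\<epsilon> \<le> 1" "star (src f) \<epsilon> \<subseteq> U"
          using openin_XPsi_vertex[OF U _ edge_in(1)[OF f]] by blast
        have "?g s \<in> U" if "\<bar>s - t\<bar> < \<epsilon>" for s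
        proof (cases "s \<le> 0")
          case False
          then have "Ed f s \<in> star (src f) \<epsilon>" unfolding mem_star using that 2 e f by simp
          then show ?thesis using e(3) False that 2 e(2) by auto
        qed (use \<open>Vx (src f) \<in> U\<close> in simp)
        then show ?thesis using e by blast
      next
        case 3
        then have "Ed f t \<in> U" using t by simp
        obtain W where W: "generate_topology_on (basic_opens V E src tgt) W" "U = W \<inter> carrier"
          using openin_XPsiD[OF U] by (elim exE conjE)
        then obtain \<delta> where d: "\<delta> > 0" "\<forall>s. 0 < s \<and> s < 1 \<and> \<bar>s - t\<bar> < \<delta> \<longrightarrow> Ed f s \<in> W"
          using openin_graph_space_edge[OF W(1)] \<open>Ed f t \<in> U\<close> by blast
        have "\<forall>s. \<bar>s - t\<bar> < min \<delta> (min t (1 - t)) \<longrightarrow> ?g s \<in> U"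
          using d(2) f unfolding W(2) by (auto simp: mem_carrier)
        then show ?thesis using d(1) 3 by (intro exI[of _ "min \<delta> (min t (1 - t))"]) simp
      next
        case 4
        then have "Vx (tgt f) \<in> U" using t by simp
        then obtain \<epsilon> where e: "\<epsilon> > 0" "\<epsilon> \<le> 1" "star (tgt f) \<epsilon> \<subseteq> U"
          using openin_XPsi_vertex[OF U _ edge_in(2)[OF f]] by blast
        have "?g s \<in> U" if "\<bar>s - t\<bar> < \<epsilon>" for s
        proof (cases "1 \<le> s")
          case False
          then have "Ed f s \<in> star (tgt f) \<epsilon>" unfolding mem_star using that 4 e f by simp
          then show ?thesis using e(3) False that 4 e(2) by auto
        qed (use \<open>Vx (tgt f) \<in> U\<close> in simp)
        then show ?thesis using e by blast
      next
        case 5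
        then have "\<forall>s. \<bar>s - t\<bar> < t - 1 \<longrightarrow> ?g s \<in> U" using t by simp
        then show ?thesis using 5 by (intro exI[of _ "t - 1"]) simp
      qed
    qed
    then have "open {t. ?g t \<in> U}" unfolding open_dist dist_real_def by blast
    moreover have "{x \<in> topspace (top_of_set {0..1}). ?g x \<in> U} = {0..1} \<inter> {t. ?g t \<in> U}" by auto
    ultimately show "openin (top_of_set {0..1}) {x \<in> topspace (top_of_set {0..1}). ?g x \<in> U}"
      by (simp only: openin_open_Int)
  qed
  from continuous_map_compose[OF this continuous_cls] show ?thesis
    by (simp add: edge_map_def[abs_def] comp_def)
qed

text \<open>Inner points of edges are never identified with anything, so two edges meet only in the
  classes of their endvertices.\<close>

lemma edge_map_eq_cases:
  assumes f: "f \<in> E" and g: "g \<in> E" and t: "t \<in> {0..1}" and s: "s \<in> {0..1}" and eq: "edge_map f t = edge_map g s"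
  shows "(f = g \<and> t = s) \<or> (t \<in> {0, 1} \<and> s \<in> {0, 1})"
proof -
  have V: "Vx (src f) \<in> VPsi" "Vx (tgt f) \<in> VPsi" "Vx (src g) \<in> VPsi" "Vx (tgt g) \<in> VPsi"
    using edge_in f g by (auto simp: mem_VPsi)
  consider "t \<in> {0, 1}" "s \<in> {0, 1}" | "0 < t" "t < 1" "0 < s" "s < 1" | "t \<in> {0, 1}" "0 < s" "s < 1" | "0 < t" "t < 1" "s \<in> {0, 1}"
    using s t by fastforce
  then show ?thesis
  proof cases
    case 2 then show ?thesis using eq by (simp add: edge_map_inner epoint_eq_iff)
  next
    case 3
    then have "edge_map f t \<in> {cls (Vx (src f)), cls (Vx (tgt f))}" by (auto simp: edge_map_ends)
    then have False using eq 3 cls_neq_Ed[OF V(1), of g s] cls_neq_Ed[OF V(2), of g s]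
      by (auto simp: edge_map_inner)
    then show ?thesis ..
  next
    case 4
    then have "edge_map g s \<in> {cls (Vx (src g)), cls (Vx (tgt g))}" by (auto simp: edge_map_ends)
    then have False using eq 4 cls_neq_Ed[OF V(3), of f t] cls_neq_Ed[OF V(4), of f t]
      by (auto simp: edge_map_inner)
    then show ?thesis ..
  qed simp
qed

lemma edge_map_inj:
  assumes "f \<in> E" "cls (Vx (src f)) \<noteq> cls (Vx (tgt f))"
  shows "inj_on (edge_map f) {0..1}"
proof (rule inj_onI)
  fix s t assume st: "s \<in> {0..1}" "t \<in> {0..1}" "edge_map f s = edge_map f t"
  then have "s = t \<or> (s \<in> {0,1} \<and> t \<in> {0,1})" using edge_map_eq_cases[OF assms(1,1)] by blast
  then show "s = t" using assms(2) st(3) by (auto simp: edge_map_ends)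
qed

definition arc_from :: "'e set \<Rightarrow> ('v, 'e) gpoint set \<Rightarrow> ('v, 'e) gpoint set \<Rightarrow> (real \<Rightarrow> ('v, 'e) gpoint set) \<Rightarrow> bool" where
  "arc_from J p q g \<longleftrightarrow> continuous_map (top_of_set {0..1}) quot g \<and> inj_on g {0..1} \<and> g 0 = p \<and> g 1 = q \<and>
     g ` {0..1} \<subseteq> (\<Union>f\<in>J. edge_map f ` {0..1})"

lemma arc_from_image: "arc_from J p q g \<Longrightarrow> x \<in> g ` {0..1} \<Longrightarrow> x \<in> (\<Union>f\<in>J. edge_map f ` {0..1})"
  by (simp add: arc_from_def subset_iff)

lemma edge_arc:
  assumes f: "f \<in> E" and pq: "{p, q} = {cls (Vx (src f)), cls (Vx (tgt f))}" "p \<noteq> q"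
  shows "\<exists>g. arc_from {f} p q g"
proof -
  have ne: "cls (Vx (src f)) \<noteq> cls (Vx (tgt f))" using pq by (auto simp: doubleton_eq_iff)
  note inj = edge_map_inj[OF f ne]
  show ?thesis
  proof (cases "p = cls (Vx (src f))")
    case True
    then have "q = cls (Vx (tgt f))" using pq by (auto simp: doubleton_eq_iff)
    then have "arc_from {f} p q (edge_map f)"
      unfolding arc_from_def using True inj continuous_edge_map[OF f] by (simp add: edge_map_ends)
    then show ?thesis by blast
  next
    case False
    then have p: "p = cls (Vx (tgt f))" "q = cls (Vx (src f))" using pq by (auto simp: doubleton_eq_iff)
    have "continuous_map (top_of_set {0..1}) (top_of_set {0..1::real}) (\<lambda>t. 1 - t)"
      by (auto simp: continuous_map_in_subtopology intro!: continuous_intros)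
    from continuous_map_compose[OF this continuous_edge_map[OF f]]
    have "continuous_map (top_of_set {0..1}) quot (edge_map f \<circ> (\<lambda>t. 1 - t))" .
    moreover have "inj_on (edge_map f \<circ> (\<lambda>t. 1 - t)) {0..1}"
      by (rule comp_inj_on) (auto intro!: inj_onI inj_on_subset[OF inj])
    ultimately have "arc_from {f} p q (edge_map f \<circ> (\<lambda>t. 1 - t))"
      unfolding arc_from_def using p by (auto simp: edge_map_ends)
    then show ?thesis by blast
  qed
qed

lemma arc_join:
  assumes g: "arc_from J p q g" and h: "arc_from K q r h"
    and meet: "\<And>x. x \<in> g ` {0..1} \<Longrightarrow> x \<in> h ` {0..1} \<Longrightarrow> x = q"
  shows "arc_from (J \<union> K) p r (join_maps g h)"
proof -
  have inj: "inj_on g {0..1}" "inj_on h {0..1}" and e: "g 1 = q" "h 0 = q"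
    using g h by (auto simp: arc_from_def)
  have m: "\<forall>a\<in>{0..1}. \<forall>b\<in>{0..1}. g a = h b \<longrightarrow> (a = 1 \<and> b = 0) \<or> (a = 0 \<and> b = 1 \<and> False)"
  proof (intro ballI impI)
    fix a b :: real assume that: "a \<in> {0..1}" "b \<in> {0..1}" "g a = h b"
    have "g a = q" using meet[of "g a"] that by (metis image_eqI)
    then have "a = 1" "b = 0" using inj_onD[OF inj(1), of a 1] inj_onD[OF inj(2), of b 0] e that by auto
    then show "(a = 1 \<and> b = 0) \<or> (a = 0 \<and> b = 1 \<and> False)" by simp
  qed
  have "inj_on (join_maps g h) {0..1}"
  proof (rule inj_onI)
    fix s t :: real
    assume st: "s \<in> {0..1}" "t \<in> {0..1}" "join_maps g h s = join_maps g h t"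
    have gh: "g 1 = h 0" using e by simp
    show "s = t"
    proof (cases "s \<le> t")
      case True
      from join_maps_eq_cases[where P = False, OF inj gh m st(1,2) True st(3)] show ?thesis by simp
    next
      case False
      then have "t \<le> s" by simp
      from join_maps_eq_cases[where P = False, OF inj gh m st(2,1) this st(3)[symmetric]] show ?thesis by simp
    qed
  qed
  moreover have "continuous_map (top_of_set {0..1}) quot (join_maps g h)"
    using g h by (intro continuous_join_maps) (auto simp: arc_from_def)
  moreover have "join_maps g h ` {0..1} \<subseteq> (\<Union>f\<in>J\<union>K. edge_map f ` {0..1})"
    unfolding UN_Un
    by (rule order_trans[OF join_maps_image Un_mono]) (use g h in \<open>simp_all add: arc_from_def\<close>)
  ultimately show ?thesis using g h by (simp add: arc_from_def join_maps_ends)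
qed

lemma arcs_circle:
  assumes g: "arc_from J p q g" and h: "arc_from K q p h"
    and meet: "\<And>x. x \<in> g ` {0..1} \<Longrightarrow> x \<in> h ` {0..1} \<Longrightarrow> x = p \<or> x = q"
  shows "\<exists>C. topological_circle quot C \<and> C \<subseteq> (\<Union>f\<in>J\<union>K. edge_map f ` {0..1})"
proof -
  have inj: "inj_on g {0..1}" "inj_on h {0..1}" and e: "g 0 = p" "g 1 = q" "h 0 = q" "h 1 = p"
    using g h by (auto simp: arc_from_def)
  have gh: "g 1 = h 0" using e by simp
  have pq: "p \<noteq> q" using inj_onD[OF inj(1), of 0 1] e by auto
  have m: "\<forall>a\<in>{0..1}. \<forall>b\<in>{0..1}. g a = h b \<longrightarrow> (a = 1 \<and> b = 0) \<or> (a = 0 \<and> b = 1 \<and> True)"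
  proof (intro ballI impI)
    fix a b :: real assume ab: "a \<in> {0..1}" "b \<in> {0..1}" "g a = h b"
    then have "g a = p \<or> g a = q" using meet[of "g a"] by (metis image_eqI)
    then show "(a = 1 \<and> b = 0) \<or> (a = 0 \<and> b = 1 \<and> True)"
    proof
      assume "g a = p"
      then have "a = 0" "b = 1" using inj_onD[OF inj(1), of a 0] inj_onD[OF inj(2), of b 1] e ab by auto
      then show ?thesis by simp
    next
      assume "g a = q"
      then have "a = 1" "b = 0" using inj_onD[OF inj(1), of a 1] inj_onD[OF inj(2), of b 0] e ab by auto
      then show ?thesis by simp
    qed
  qed
  have "topological_circle quot (join_maps g h ` {0..1})"
  proof (rule closed_curve_circle[OF Hausdorff_quot])
    show "continuous_map (top_of_set {0..1}) quot (join_maps g h)"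
      using g h by (intro continuous_join_maps) (auto simp: arc_from_def)
    show "join_maps g h 0 = join_maps g h 1" using e by (simp add: join_maps_ends)
    fix s t :: real assume "s \<in> {0..1}" "t \<in> {0..1}" "s \<le> t" "join_maps g h s = join_maps g h t"
    from join_maps_eq_cases[where P = True, OF inj gh m this] show "s = t \<or> (s = 0 \<and> t = 1)" by simp
  qed
  moreover have "join_maps g h ` {0..1} \<subseteq> (\<Union>f\<in>J\<union>K. edge_map f ` {0..1})"
    unfolding UN_Un
    by (rule order_trans[OF join_maps_image Un_mono]) (use g h in \<open>simp_all add: arc_from_def\<close>)
  ultimately show ?thesis by blast
qed

text \<open>The midpoint of an edge lies on no other edge, so it reveals which edges the circle can
  contain.\<close>

lemma circle_edges_of_union:
  assumes "C \<subseteq> (\<Union>f\<in>J. edge_map f ` {0..1})" "J \<subseteq> E"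
  shows "circle_edges V E src tgt \<Psi> C \<subseteq> J"
proof
  fix e assume e: "e \<in> circle_edges V E src tgt \<Psi> C"
  then have eE: "e \<in> E" and "epoint e (1/2) \<in> C" by (auto simp: circle_edges_def)
  then obtain f t where f: "f \<in> J" "t \<in> {0..1}" "epoint e (1/2) = edge_map f t" using assms(1) by blast
  then have "edge_map e (1/2) = edge_map f t" by (simp add: edge_map_inner)
  then have "(e = f \<and> 1/2 = t) \<or> ((1/2::real) \<in> {0, 1} \<and> t \<in> {0, 1})"
    using edge_map_eq_cases[of e f "1/2" t] f assms(2) eE by auto
  then show "e \<in> J" using f(1) by auto
qed

section \<open>Finite cycles of the quotient graph as circles\<close>

definition edge_pair :: "'e \<Rightarrow> ('v, 'e) gpoint \<times> ('v, 'e) gpoint" where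
  "edge_pair f = (Vx (src f), Vx (tgt f))"

text \<open>The connections of the graph with edge set \<open>J\<close> after identifying equivalent points.\<close>

definition Rel :: "'e set \<Rightarrow> (('v, 'e) gpoint \<times> ('v, 'e) gpoint) set" where
  "Rel J = edge_pair ` J \<union> {(x, y). peq x y}"

text \<open>Adjacency of classes: the identification steps of \<open>Rel\<close> become equalities,
  so a path without repeated points is a path through distinct points of the quotient.\<close>

definition cadj :: "'e set \<Rightarrow> (('v, 'e) gpoint set \<times> ('v, 'e) gpoint set) set" where
  "cadj J = {(p, q). \<exists>f\<in>J. {p, q} = {cls (Vx (src f)), cls (Vx (tgt f))}}"

lemma Rel_imp_cadj:
  assumes "(x, y) \<in> eqc (Rel J)"
  shows "(cls x, cls y) \<in> (cadj J)\<^sup>*"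
proof -
  let ?T = "{y. (cls x, cls y) \<in> (cadj J)\<^sup>*}"
  have "a \<in> ?T \<longleftrightarrow> b \<in> ?T" if ab: "(a, b) \<in> Rel J" for a b
  proof (cases "peq a b")
    case True
    then have "cls a = cls b" using cls_eq_iff peq_in by blast
    then show ?thesis by simp
  next
    case False
    then obtain f where f: "f \<in> J" "a = Vx (src f)" "b = Vx (tgt f)"
      using ab by (auto simp: Rel_def edge_pair_def)
    then have "(cls a, cls b) \<in> cadj J" "(cls b, cls a) \<in> cadj J"
      unfolding cadj_def by (auto simp: insert_commute)
    then show ?thesis using rtrancl_into_rtrancl[of "cls x" _ "cadj J"] unfolding mem_Collect_eq by blast
  qed
  then have "x \<in> ?T \<longleftrightarrow> y \<in> ?T" by (rule eqc_invariant[OF assms])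
  then show ?thesis by simp
qed

lemma shortest_path:
  assumes "(a, b) \<in> R\<^sup>*"
  obtains p n where "p 0 = a" "p n = b" "\<forall>i<n. (p i, p (Suc i)) \<in> R" "inj_on p {..n::nat}"
proof -
  define n where "n = (LEAST n. (a, b) \<in> R ^^ n)"
  have "\<exists>n. (a, b) \<in> R ^^ n" using assms rtrancl_imp_relpow by blast
  then have n: "(a, b) \<in> R ^^ n" unfolding n_def by (rule LeastI_ex)
  have least: "n \<le> m" if "(a, b) \<in> R ^^ m" for m unfolding n_def using that by (rule Least_le)
  obtain p where p: "p 0 = a" "p n = b" "\<forall>i<n. (p i, p (Suc i)) \<in> R"
    using n unfolding relpow_fun_conv by blast
  have neq: "p i \<noteq> p j" if ij: "i < j" "j \<le> n" for i j
  proof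
    assume eq: "p i = p j"
    have "(p 0, p i) \<in> R ^^ i" unfolding relpow_fun_conv using p ij by (intro exI[of _ p]) auto
    moreover have "(p j, p n) \<in> R ^^ (n - j)"
      unfolding relpow_fun_conv using p ij by (intro exI[of _ "\<lambda>k. p (j + k)"]) auto
    ultimately have "(a, b) \<in> R ^^ (i + (n - j))" unfolding relpow_add using p eq by auto
    then have "n \<le> i + (n - j)" by (rule least)
    then show False using ij by simp
  qed
  have "inj_on p {..n}"
  proof (rule inj_onI)
    fix i j assume "i \<in> {..n}" "j \<in> {..n}" "p i = p j"
    then show "i = j" using neq[of i j] neq[of j i] by (cases i j rule: linorder_cases) auto
  qed
  with p show ?thesis using that by blast
qed

lemma edge_map_meets_path:
  assumes f: "f \<in> E" and J: "J \<subseteq> E" "f \<notin> J"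
    and x: "x \<in> edge_map f ` {0..1}" "x \<in> (\<Union>g\<in>J. edge_map g ` {0..1})"
  shows "x \<in> {cls (Vx (src f)), cls (Vx (tgt f))} \<and> (\<exists>g\<in>J. x \<in> {cls (Vx (src g)), cls (Vx (tgt g))})"
proof -
  obtain t where t: "t \<in> {0..1}" "x = edge_map f t" using x(1) by blast
  obtain g s where g: "g \<in> J" "s \<in> {0..1}" "x = edge_map g s" using x(2) by blast
  have "f \<noteq> g" using g J by blast
  have "edge_map f t = edge_map g s" using t g by simp
  then have "t \<in> {0, 1}" "s \<in> {0, 1}"
    using edge_map_eq_cases[OF f subsetD[OF J(1) g(1)] t(1) g(2)] \<open>f \<noteq> g\<close> by blast+
  then have "edge_map f t \<in> {cls (Vx (src f)), cls (Vx (tgt f))}" "edge_map g s \<in> {cls (Vx (src g)), cls (Vx (tgt g))}"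
    by (elim insertE; simp add: edge_map_ends)+
  then have "x \<in> {cls (Vx (src f)), cls (Vx (tgt f))}" "x \<in> {cls (Vx (src g)), cls (Vx (tgt g))}"
    using t(2) g(3) by simp_all
  then show ?thesis using g(1) by blast
qed

text \<open>The last conjunct carries the induction. Every edge used so far joins two earlier
  classes of the path, so the next class is an end of none of them, and the next edge meets the arc
  only in \<open>p n\<close>.\<close>

lemma arc_of_path:
  assumes J: "J \<subseteq> E" and p: "\<forall>i<n. (p i, p (Suc i)) \<in> cadj J" "inj_on p {..n}" and n: "n > 0"
  shows "\<exists>K g. finite K \<and> K \<subseteq> J \<and> arc_from K (p 0) (p n) g \<and>
    (\<forall>f\<in>K. \<exists>i<n. {p i, p (Suc i)} = {cls (Vx (src f)), cls (Vx (tgt f))})"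
  using n p
proof (induction n rule: nat_induct_non_zero)
  case 1
  then have "(p 0, p (Suc 0)) \<in> cadj J" by simp
  then obtain f where f: "f \<in> J" "{p 0, p (Suc 0)} = {cls (Vx (src f)), cls (Vx (tgt f))}" by (auto simp: cadj_def)
  have "p 0 \<noteq> p (Suc 0)" using inj_onD[OF 1(2), of 0 1] by auto
  then obtain g where "arc_from {f} (p 0) (p (Suc 0)) g" using edge_arc[OF _ f(2)] f(1) J by blast
  then show ?case using f by (intro exI[of _ "{f}"] exI[of _ g]) auto
next
  case (Suc n)
  have inj: "inj_on p {..n}" by (rule inj_on_subset[OF Suc.prems(2)]) simp
  obtain K g where K: "finite K" "K \<subseteq> J" "arc_from K (p 0) (p n) g"
    "\<forall>f\<in>K. \<exists>i<n. {p i, p (Suc i)} = {cls (Vx (src f)), cls (Vx (tgt f))}"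
    using Suc.IH[OF _ inj] Suc.prems(1) by auto
  have neq: "p i \<noteq> p (Suc n)" if "i \<le> n" for i using inj_onD[OF Suc.prems(2), of i "Suc n"] that by auto
  have "(p n, p (Suc n)) \<in> cadj J" using Suc.prems by simp
  then obtain f where f: "f \<in> J" "{p n, p (Suc n)} = {cls (Vx (src f)), cls (Vx (tgt f))}" by (auto simp: cadj_def)
  have fE: "f \<in> E" using f J by blast
  obtain h where h: "arc_from {f} (p n) (p (Suc n)) h" using edge_arc[OF fE f(2)] neq[of n] by auto
  have notin: "p (Suc n) \<notin> {cls (Vx (src e)), cls (Vx (tgt e))}" if eK: "e \<in> K" for e
  proof -
    obtain i where i: "i < n" "{p i, p (Suc i)} = {cls (Vx (src e)), cls (Vx (tgt e))}" using bspec[OF K(4) eK] by (elim exE conjE)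
    then have "p (Suc n) \<notin> {p i, p (Suc i)}" using neq[of i] neq[of "Suc i"] by auto
    then show ?thesis unfolding i(2) .
  qed
  have "f \<notin> K" using notin[of f] f(2) by auto
  have "x = p n" if "x \<in> g ` {0..1}" "x \<in> h ` {0..1}" for x
  proof -
    have "x \<in> edge_map f ` {0..1}" "x \<in> (\<Union>g\<in>K. edge_map g ` {0..1})"
      using arc_from_image[OF h that(2)] arc_from_image[OF K(3) that(1)] by simp_all
    from edge_map_meets_path[OF fE _ \<open>f \<notin> K\<close> this] K(2) J
    have "x \<in> {p n, p (Suc n)}" "\<exists>e\<in>K. x \<in> {cls (Vx (src e)), cls (Vx (tgt e))}" unfolding f(2) by auto
    then show ?thesis using notin by blast
  qed
  from arc_join[OF K(3) h this] have "arc_from (K \<union> {f}) (p 0) (p (Suc n)) (join_maps g h)" .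
  moreover have "\<forall>e\<in>K \<union> {f}. \<exists>i<Suc n. {p i, p (Suc i)} = {cls (Vx (src e)), cls (Vx (tgt e))}"
  proof
    fix e assume "e \<in> K \<union> {f}"
    then show "\<exists>i<Suc n. {p i, p (Suc i)} = {cls (Vx (src e)), cls (Vx (tgt e))}"
    proof
      assume "e \<in> K" then show ?thesis using K(4) less_SucI by blast
    next
      assume "e \<in> {f}" then show ?thesis using f(2) by blast
    qed
  qed
  moreover have "finite (K \<union> {f})" "K \<union> {f} \<subseteq> J" using K f by auto
  ultimately show ?case by blast
qed

text \<open>An edge with equivalent endvertices is a circle by itself; otherwise a path of distinct
  classes closes up with \<open>e\<close>. The set \<open>K\<close> has to be finite because
  \<open>fin_indep\<close> speaks about finite sets of edges.\<close>

lemma finite_circle_exists: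
  assumes e: "e \<in> E" and J: "J \<subseteq> E" "e \<notin> J" and c: "edge_pair e \<in> eqc (Rel J)"
  shows "\<exists>C K. topological_circle quot C \<and> finite K \<and> K \<subseteq> insert e J \<and> circle_edges V E src tgt \<Psi> C \<subseteq> K"
proof -
  let ?s = "cls (Vx (src e))" and ?t = "cls (Vx (tgt e))"
  have "\<exists>C K. topological_circle quot C \<and> finite K \<and> K \<subseteq> insert e J \<and> C \<subseteq> (\<Union>f\<in>K. edge_map f ` {0..1})"
  proof (cases "?s = ?t")
    case True
    have "topological_circle quot (edge_map e ` {0..1})"
    proof (rule closed_curve_circle[OF Hausdorff_quot continuous_edge_map[OF e]])
      show "edge_map e 0 = edge_map e 1" using True by (simp add: edge_map_ends)
      fix s t :: real assume st: "s \<in> {0..1}" "t \<in> {0..1}" "s \<le> t" "edge_map e s = edge_map e t"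
      then show "s = t \<or> (s = 0 \<and> t = 1)" using edge_map_eq_cases[OF e e st(1,2,4)] by auto
    qed
    then show ?thesis by (intro exI[of _ "edge_map e ` {0..1}"] exI[of _ "{e}"]) auto
  next
    case False
    have "(?s, ?t) \<in> (cadj J)\<^sup>*" using Rel_imp_cadj c by (simp add: edge_pair_def)
    then obtain p n where p: "p 0 = ?s" "p n = ?t" "\<forall>i<n. (p i, p (Suc i)) \<in> cadj J" "inj_on p {..n::nat}"
      by (rule shortest_path)
    then have "n > 0" using False by (cases n) auto
    from arc_of_path[OF J(1) p(3,4) this] p(1,2) obtain K g where
      K: "finite K" "K \<subseteq> J" "arc_from K ?s ?t g" by auto
    obtain h where h: "arc_from {e} ?t ?s h" using edge_arc[OF e, of ?t ?s] False by (auto simp: insert_commute)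
    have "x = ?s \<or> x = ?t" if "x \<in> g ` {0..1}" "x \<in> h ` {0..1}" for x
    proof -
      have "x \<in> edge_map e ` {0..1}" "x \<in> (\<Union>g\<in>K. edge_map g ` {0..1})"
        using arc_from_image[OF h that(2)] arc_from_image[OF K(3) that(1)] by simp_all
      moreover have "K \<subseteq> E" "e \<notin> K" using K(2) J by auto
      ultimately show ?thesis using edge_map_meets_path[OF e] by blast
    qed
    from arcs_circle[OF K(3) h this] obtain C where
      "topological_circle quot C" "C \<subseteq> (\<Union>f\<in>K \<union> {e}. edge_map f ` {0..1})" by blast
    moreover have "finite (K \<union> {e})" "K \<union> {e} \<subseteq> insert e J" using K by auto
    ultimately show ?thesis by blast
  qed
  then obtain C K where C: "topological_circle quot C" "finite K" "K \<subseteq> insert e J"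
    "C \<subseteq> (\<Union>f\<in>K. edge_map f ` {0..1})" by blast
  have "K \<subseteq> E" using C(3) J e by blast
  then show ?thesis using C circle_edges_of_union[OF C(4)] by blast
qed

end

section \<open>Separating forest components from ends\<close>

context psi_graph
begin

section \<open>Forests of the quotient graph and their pieces\<close>

lemma Rel_mono: "J \<subseteq> K \<Longrightarrow> Rel J \<subseteq> Rel K"
  unfolding Rel_def by blast

lemma eqc_Rel_mono: "J \<subseteq> K \<Longrightarrow> (x, y) \<in> eqc (Rel J) \<Longrightarrow> (x, y) \<in> eqc (Rel K)"
  using eqc_mono[OF Rel_mono] by blast

lemma eqc_Rel_peq: "peq x y \<Longrightarrow> (x, y) \<in> eqc (Rel J)"
  by (rule eqc_base) (simp add: Rel_def)

lemma eqc_Rel_edge: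
  assumes "f \<in> J" "{src f, tgt f} = {u, w}"
  shows "(Vx u, Vx w) \<in> eqc (Rel J)"
proof -
  have "(Vx (src f), Vx (tgt f)) \<in> eqc (Rel J)"
    using assms(1) by (intro eqc_base) (auto simp: Rel_def edge_pair_def)
  then show ?thesis using assms(2) eqc_sym by (auto simp: doubleton_eq_iff)
qed

lemma eqc_Rel_closed:
  assumes xy: "(x, y) \<in> eqc (Rel J)" and x: "x \<in> T"
    and edge: "\<And>f u w. f \<in> J \<Longrightarrow> {src f, tgt f} = {u, w} \<Longrightarrow> Vx u \<in> T \<Longrightarrow> Vx w \<in> T"
    and eq: "\<And>a b. peq a b \<Longrightarrow> a \<in> T \<Longrightarrow> b \<in> T"
  shows "y \<in> T"
proof -
  have "a \<in> T \<longleftrightarrow> b \<in> T" if ab: "(a, b) \<in> Rel J" for a b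
  proof (cases "peq a b")
    case True then show ?thesis using eq peq_sym by blast
  next
    case False
    then obtain f where f: "f \<in> J" "a = Vx (src f)" "b = Vx (tgt f)"
      using ab by (auto simp: Rel_def edge_pair_def)
    then show ?thesis using edge[OF f(1) refl] edge[OF f(1) insert_commute] by blast
  qed
  then have "x \<in> T \<longleftrightarrow> y \<in> T" by (rule eqc_invariant[OF xy])
  then show ?thesis using x by blast
qed

definition forest :: "'e set \<Rightarrow> bool" where
  "forest J \<longleftrightarrow> J \<subseteq> E \<and> (\<forall>e\<in>J. edge_pair e \<notin> eqc (Rel (J - {e})))"

definition piece :: "'e set \<Rightarrow> 'v \<Rightarrow> 'v set" where
  "piece J y = {w \<in> V. (Vx y, Vx w) \<in> eqc (Rel J)}"

text \<open>The end \<omega> lies in the closure of \<open>W\<close>.\<close>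

definition bad :: "'v set \<Rightarrow> (nat \<Rightarrow> 'v) set \<Rightarrow> bool" where
  "bad W \<omega> \<longleftrightarrow> (\<forall>S. finite S \<and> S \<subseteq> V \<longrightarrow> W \<inter> Cmp S \<omega> \<noteq> {})"

lemma forest_subset: "forest J \<Longrightarrow> K \<subseteq> J \<Longrightarrow> forest K"
  unfolding forest_def edge_pair_def
proof (intro conjI ballI notI, elim conjE)
  fix e assume J: "J \<subseteq> E \<and> (\<forall>e\<in>J. (Vx (src e), Vx (tgt e)) \<notin> eqc (Rel (J - {e})))" and K: "K \<subseteq> J"
    and e: "e \<in> K" "(Vx (src e), Vx (tgt e)) \<in> eqc (Rel (K - {e}))"
  have "K - {e} \<subseteq> J - {e}" using K by blast
  from eqc_Rel_mono[OF this e(2)] show False using J K e(1) by blast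
qed blast

lemma forest_endpoints:
  assumes "forest J" "g \<in> J" "{src g, tgt g} = {u, z}"
  shows "(Vx u, Vx z) \<notin> eqc (Rel (J - {g}))"
proof
  assume a: "(Vx u, Vx z) \<in> eqc (Rel (J - {g}))"
  then have "(Vx (src g), Vx (tgt g)) \<in> eqc (Rel (J - {g}))"
    using assms(3) eqc_sym[OF a] by (auto simp: doubleton_eq_iff)
  then show False using assms(1,2) unfolding forest_def edge_pair_def by blast
qed

lemma piece_self: "y \<in> V \<Longrightarrow> y \<in> piece J y"
  by (simp add: piece_def)

lemma piece_peq:
  assumes "w \<in> piece J y" "peq (Vx w) (Vx u)"
  shows "u \<in> piece J y"
proof -
  have "(Vx y, Vx u) \<in> eqc (Rel J)"
    using assms eqc_trans[OF _ eqc_Rel_peq[OF assms(2)]] by (simp add: piece_def)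
  then show ?thesis using peq_in(2)[OF assms(2)] by (simp add: piece_def mem_VPsi)
qed

lemma piece_subset_piece:
  assumes "J \<subseteq> K" "(Vx y, Vx z) \<in> eqc (Rel K)"
  shows "piece J z \<subseteq> piece K y"
  using eqc_trans[OF assms(2) eqc_Rel_mono[OF assms(1)]] by (auto simp: piece_def)

text \<open>One vertex for each end of \<Psi> is enough. A piece is closed under equivalence, so one
  that avoids the finite set \<open>Sp\<close> has no special vertices at all.\<close>

lemma special_reps:
  assumes "finite \<Psi>"
  shows "\<exists>Sp. finite Sp \<and> Sp \<subseteq> V \<and> (\<forall>v. special v \<longrightarrow> (\<exists>s\<in>Sp. peq (Vx v) (Vx s)))"
proof -
  define c where "c \<omega> = (SOME v. peq (Vx v) (En \<omega>))" for \<omega>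
  \<comment> \<open>For an end equivalent to no vertex, \<open>SOME\<close> returns an arbitrary
    value, which the intersection may discard.\<close>
  let ?Sp = "c ` \<Psi> \<inter> V"
  have "\<exists>s\<in>?Sp. peq (Vx v) (Vx s)" if sv: "special v" for v
  proof -
    obtain \<omega> where w: "\<omega> \<in> \<Psi>" "peq (Vx v) (En \<omega>)" using sv by (auto simp: special_def)
    then have c: "peq (Vx (c \<omega>)) (En \<omega>)" unfolding c_def by (intro someI)
    then have "peq (Vx v) (Vx (c \<omega>))" using peq_trans[OF w(2)] peq_sym by blast
    moreover have "c \<omega> \<in> V" using peq_in(1)[OF c] by (simp add: mem_VPsi)
    ultimately show ?thesis using w(1) by blast
  qed
  then show ?thesis using assms by (intro exI[of _ ?Sp]) blast
qed

text \<open>Without special vertices all identifications within the piece are trivial, so its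
  connections are genuine paths of the graph, and they avoid \<open>S\<close> because the piece
  does.\<close>

lemma piece_conn:
  assumes J: "J \<subseteq> E" and z: "z \<in> V" and S: "piece J z \<inter> S = {}"
    and ns: "\<And>w. w \<in> piece J z \<Longrightarrow> \<not> special w" and w: "w \<in> piece J z"
  shows "conn S z w"
proof -
  let ?T = "{Vx w | w. conn S z w \<and> w \<in> piece J z} :: ('v, 'e) gpoint set"
  have "Vx w \<in> ?T"
  proof (rule eqc_Rel_closed)
    show "(Vx z, Vx w) \<in> eqc (Rel J)" using w by (simp add: piece_def)
    have "z \<in> piece J z" by (rule piece_self[OF z])
    then show "Vx z \<in> ?T" using z S conn_avoid_refl[of z V S] by blast
  next
    fix f u v assume f: "f \<in> J" "{src f, tgt f} = {u, v}" "Vx u \<in> ?T"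
    then have u: "conn S z u" "u \<in> piece J z" by auto
    have adj: "edge_adj u v" using f J by (auto simp: adj_def)
    have vV: "v \<in> V" using edge_adj_in(2)[OF adj] .
    have "(Vx z, Vx v) \<in> eqc (Rel J)" using u(2) eqc_trans[OF _ eqc_Rel_edge[OF f(1,2)]] by (simp add: piece_def)
    then have v: "v \<in> piece J z" using vV by (simp add: piece_def)
    then have "conn S u v" using S u vV by (intro conn_avoid_edge[OF _ _ adj]) (auto simp: piece_def)
    then show "Vx v \<in> ?T" using v conn_avoid_trans[OF u(1)] by blast
  next
    fix a b assume ab: "peq a b" "a \<in> ?T"
    then obtain u where u: "a = Vx u" "u \<in> piece J z" by blast
    have "b = Vx u" using nonspecial_class[OF _ ns[OF u(2)]] u ab(1) by (auto simp: piece_def)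
    then show "b \<in> ?T" using ab u by simp
  qed
  then show ?thesis by simp
qed

text \<open>Infinitely many children would make the class of \<open>y\<close> equivalent to \<open>\<omega>\<close> unless one of
  them already fails to be separated from \<open>\<omega>\<close>; iterating produces a ray of \<open>\<omega>\<close>.\<close>

lemma bad_child:
  assumes fin: "finite \<Psi>" and J: "forest J" and w: "\<omega> \<in> \<Psi>" and y: "y \<in> V"
    and nw: "\<And>v. v \<in> piece J y \<Longrightarrow> \<not> peq (Vx v) (En \<omega>)" and b: "bad (piece J y) \<omega>"
  shows "\<exists>g\<in>J. \<exists>u z. {src g, tgt g} = {u, z} \<and> peq (Vx y) (Vx u) \<and> bad (piece (J - {g}) z) \<omega> \<and>
    y \<notin> piece (J - {g}) z"
proof -
  have JE: "J \<subseteq> E" using J by (simp add: forest_def)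
  \<comment> \<open>The edges leaving the class of \<open>y\<close>: each has an end
    \<open>U g\<close> in the class, and the child \<open>?D g\<close> is the branch behind its
    other end \<open>Z g\<close>.\<close>
  define \<Gamma> where "\<Gamma> = {g \<in> J. \<exists>u z. {src g, tgt g} = {u, z} \<and> peq (Vx y) (Vx u)}"
  have "\<forall>g. \<exists>u z. g \<in> \<Gamma> \<longrightarrow> {src g, tgt g} = {u, z} \<and> peq (Vx y) (Vx u)" unfolding \<Gamma>_def by blast
  then obtain U Z where UZ: "\<And>g. g \<in> \<Gamma> \<Longrightarrow> {src g, tgt g} = {U g, Z g}" "\<And>g. g \<in> \<Gamma> \<Longrightarrow> peq (Vx y) (Vx (U g))"
    by metis
  have GJ: "\<Gamma> \<subseteq> J" by (auto simp: \<Gamma>_def)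
  have UV: "U g \<in> V" "Z g \<in> V" if "g \<in> \<Gamma>" for g
  proof -
    have "g \<in> E" using that GJ JE by blast
    from edge_in[OF this] show "U g \<in> V" "Z g \<in> V"
      using UZ(1)[OF that] by (auto simp: doubleton_eq_iff)
  qed
  let ?D = "\<lambda>g. piece (J - {g}) (Z g)"
  \<comment> \<open>Otherwise \<open>g\<close> would lie on a cycle through the class of
    \<open>y\<close>.\<close>
  have UD: "v \<notin> ?D g" if g: "g \<in> \<Gamma>" and v: "peq (Vx y) (Vx v)" for g v
  proof
    assume "v \<in> ?D g"
    moreover have "peq (Vx v) (Vx (U g))" using peq_trans[OF peq_sym[OF v] UZ(2)[OF g]] .
    ultimately have "U g \<in> ?D g" by (rule piece_peq)
    then have "(Vx (U g), Vx (Z g)) \<in> eqc (Rel (J - {g}))" by (auto simp: piece_def intro: eqc_sym)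
    then show False using forest_endpoints[OF J _ UZ(1)[OF g]] g GJ by blast
  qed
  have cover: "peq (Vx y) (Vx v) \<or> (\<exists>g\<in>\<Gamma>. v \<in> ?D g)" if v: "v \<in> piece J y" for v
  proof -
    let ?T = "{p. peq (Vx y) p \<or> (\<exists>g\<in>\<Gamma>. (Vx (Z g), p) \<in> eqc (Rel (J - {g})))}"
    have "Vx v \<in> ?T"
    proof (rule eqc_Rel_closed)
      show "(Vx y, Vx v) \<in> eqc (Rel J)" using v by (simp add: piece_def)
      show "Vx y \<in> ?T" using y peq_refl by (simp add: mem_VPsi)
    next
      fix h a b assume h: "h \<in> J" "{src h, tgt h} = {a, b}" "Vx a \<in> ?T"
      then consider "peq (Vx y) (Vx a)" | g where "g \<in> \<Gamma>" "(Vx (Z g), Vx a) \<in> eqc (Rel (J - {g}))" by blast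
      then show "Vx b \<in> ?T"
      proof cases
        case 1
        then have hG: "h \<in> \<Gamma>" using h by (auto simp: \<Gamma>_def)
        then have "b = Z h \<or> b = U h" using UZ(1)[OF hG] h(2) by (auto simp: doubleton_eq_iff)
        then show ?thesis
        proof
          assume "b = Z h"
          then have "(Vx (Z h), Vx b) \<in> eqc (Rel (J - {h}))" by simp
          then show ?thesis using hG by blast
        qed (use UZ(2)[OF hG] in simp)
      next
        case 2
        show ?thesis
        proof (cases "h = g")
          case True
          then have "b = Z g \<or> b = U g" using UZ(1)[OF 2(1)] h(2) by (auto simp: doubleton_eq_iff)
          then show ?thesis
          proof
            assume "b = Z g"
            then have "(Vx (Z g), Vx b) \<in> eqc (Rel (J - {g}))" by simp
            then show ?thesis using 2(1) by blast
          qed (use UZ(2)[OF 2(1)] in simp)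
        next
          case False
          then have "(Vx a, Vx b) \<in> eqc (Rel (J - {g}))" using h by (intro eqc_Rel_edge[of h]) auto
          from eqc_trans[OF 2(2) this] show ?thesis using 2(1) by blast
        qed
      qed
    next
      fix a b assume ab: "peq a b" "a \<in> ?T"
      then consider "peq (Vx y) a" | g where "g \<in> \<Gamma>" "(Vx (Z g), a) \<in> eqc (Rel (J - {g}))" by blast
      then show "b \<in> ?T"
      proof cases
        case 1 from peq_trans[OF 1 ab(1)] show ?thesis by simp
      next
        case 2 from eqc_trans[OF 2(2) eqc_Rel_peq[OF ab(1)]] show ?thesis using 2(1) by blast
      qed
    qed
    then show ?thesis using v by (auto simp: piece_def)
  qed
  \<comment> \<open>A connection inside the branch of \<open>g\<close> cannot use \<open>h\<close>,
    as it would reach \<open>U h\<close> in the class of \<open>y\<close>. So a common vertex of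
    both branches closes a cycle through \<open>g\<close> and \<open>h\<close>.\<close>
  have disj: "v \<notin> ?D h" if g: "g \<in> \<Gamma>" and h: "h \<in> \<Gamma>" and gh: "g \<noteq> h" and v: "v \<in> ?D g" for g h v
  proof
    assume vh: "v \<in> ?D h"
    let ?T = "{p. (Vx (Z g), p) \<in> eqc (Rel (J - {g} - {h}))}"
    have "Vx v \<in> ?T"
    proof (rule eqc_Rel_closed)
      show "(Vx (Z g), Vx v) \<in> eqc (Rel (J - {g}))" using v by (simp add: piece_def)
      show "Vx (Z g) \<in> ?T" by simp
    next
      fix f a b assume f: "f \<in> J - {g}" "{src f, tgt f} = {a, b}" "Vx a \<in> ?T"
      show "Vx b \<in> ?T"
      proof (cases "f = h")
        case False
        then have e1: "(Vx a, Vx b) \<in> eqc (Rel (J - {g} - {h}))" using f by (intro eqc_Rel_edge[of f]) auto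
        have "(Vx (Z g), Vx a) \<in> eqc (Rel (J - {g} - {h}))" using f(3) by simp
        from eqc_trans[OF this e1] show ?thesis by simp
      next
        case True
        have "(Vx (Z g), Vx a) \<in> eqc (Rel (J - {g} - {h}))" using f(3) by simp
        then have a: "(Vx (Z g), Vx a) \<in> eqc (Rel (J - {g}))" by (rule eqc_Rel_mono[rotated]) blast
        then have "(Vx (Z g), Vx b) \<in> eqc (Rel (J - {g}))" using eqc_trans[OF a eqc_Rel_edge[OF f(1,2)]] by simp
        moreover have "U h = a \<or> U h = b" using UZ(1)[OF h] f(2) True by (auto simp: doubleton_eq_iff)
        ultimately have "U h \<in> ?D g" using a UV[OF h] by (auto simp: piece_def)
        then show ?thesis using UD[OF g UZ(2)[OF h]] by blast
      qed
    next
      fix a b assume ab: "peq a b" "a \<in> ?T"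
      from ab(2) have "(Vx (Z g), a) \<in> eqc (Rel (J - {g} - {h}))" by simp
      from eqc_trans[OF this eqc_Rel_peq[OF ab(1)]] show "b \<in> ?T" by simp
    qed
    then have "(Vx (Z g), Vx v) \<in> eqc (Rel (J - {g} - {h}))" by simp
    then have 1: "(Vx (Z g), Vx v) \<in> eqc (Rel (J - {h}))" by (rule eqc_Rel_mono[rotated]) blast
    have 2: "(Vx (Z h), Vx v) \<in> eqc (Rel (J - {h}))" using vh by (simp add: piece_def)
    have "g \<in> J - {h}" using g GJ gh by blast
    then have 3: "(Vx (U g), Vx (Z g)) \<in> eqc (Rel (J - {h}))" using UZ(1)[OF g] by (rule eqc_Rel_edge)
    have 4: "(Vx (U h), Vx (U g)) \<in> eqc (Rel (J - {h}))"
      by (rule eqc_Rel_peq[OF peq_trans[OF peq_sym[OF UZ(2)[OF h]] UZ(2)[OF g]]])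
    have "(Vx (U h), Vx (Z h)) \<in> eqc (Rel (J - {h}))"
      by (rule eqc_trans[OF eqc_trans[OF eqc_trans[OF 4 3] 1] eqc_sym[OF 2]])
    then show False using forest_endpoints[OF J _ UZ(1)[OF h]] h GJ by blast
  qed
  obtain Sp where Sp: "finite Sp" "Sp \<subseteq> V" "\<And>v. special v \<Longrightarrow> \<exists>s\<in>Sp. peq (Vx v) (Vx s)"
    using special_reps[OF fin] by blast
  obtain S0 where S0: "finite S0" "S0 \<subseteq> V" "\<forall>u. peq (Vx y) (Vx u) \<longrightarrow> u \<notin> nbhd S0 \<omega>"
    using separate_class_end[OF w y nw[OF piece_self[OF y]]] by blast
  \<comment> \<open>Disjointness leaves only finitely many such branches. All others avoid
    \<open>S0\<close> and contain no special vertices.\<close>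
  define \<Gamma>0 where "\<Gamma>0 = {g \<in> \<Gamma>. ?D g \<inter> (S0 \<union> Sp) \<noteq> {}}"
  have "finite \<Gamma>0"
  proof -
    have "\<forall>g. \<exists>v. g \<in> \<Gamma>0 \<longrightarrow> v \<in> ?D g \<inter> (S0 \<union> Sp)" unfolding \<Gamma>0_def by blast
    from choice[OF this] obtain c where c: "\<And>g. g \<in> \<Gamma>0 \<Longrightarrow> c g \<in> ?D g \<inter> (S0 \<union> Sp)" by blast
    have "inj_on c \<Gamma>0"
    proof (rule inj_onI, rule ccontr)
      fix g h assume gh: "g \<in> \<Gamma>0" "h \<in> \<Gamma>0" "c g = c h" "g \<noteq> h"
      then show False using disj[of g h "c g"] c[of g] c[of h] by (auto simp: \<Gamma>0_def)
    qed
    moreover have "c ` \<Gamma>0 \<subseteq> S0 \<union> Sp" using c by blast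
    ultimately show ?thesis using S0(1) Sp(1) by (meson finite_UnI inj_on_finite)
  qed
  have "\<exists>g\<in>\<Gamma>. bad (?D g) \<omega>"
  proof (rule ccontr)
    assume "\<not> ?thesis"
    then have "\<forall>g. \<exists>S. g \<in> \<Gamma> \<longrightarrow> finite S \<and> S \<subseteq> V \<and> ?D g \<inter> Cmp S \<omega> = {}" unfolding bad_def by blast
    from choice[OF this] obtain S where S: "\<And>g. g \<in> \<Gamma> \<Longrightarrow> finite (S g) \<and> S g \<subseteq> V \<and> ?D g \<inter> Cmp (S g) \<omega> = {}"
      by blast
    \<comment> \<open>Separates \<omega> from the class of \<open>y\<close> and from all exceptional
      branches, provided that none of them is bad.\<close>
    define S' where "S' = S0 \<union> (\<Union>g\<in>\<Gamma>0. S g)"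
    have G0: "g \<in> \<Gamma>" if "g \<in> \<Gamma>0" for g using that by (simp add: \<Gamma>0_def)
    have "finite S'" "S' \<subseteq> V" unfolding S'_def using S0 \<open>finite \<Gamma>0\<close> S G0 by auto
    then obtain v where v: "v \<in> piece J y" "v \<in> Cmp S' \<omega>" using b unfolding bad_def by blast
    have vS0: "v \<in> Cmp S0 \<omega>" using v(2) Cmp_antimono[of S0 S' \<omega>] by (auto simp: S'_def)
    then have "\<not> peq (Vx y) (Vx v)" using S0(3) Cmp_nbhd by blast
    then obtain g where g: "g \<in> \<Gamma>" "v \<in> ?D g" using cover[OF v(1)] by blast
    have "g \<notin> \<Gamma>0"
    proof
      assume "g \<in> \<Gamma>0"
      then have "S g \<subseteq> S'" unfolding S'_def by blast
      then have "v \<in> Cmp (S g) \<omega>" using v(2) Cmp_antimono by blast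
      then show False using S[OF g(1)] g(2) by blast
    qed
    then have av: "?D g \<inter> (S0 \<union> Sp) = {}" using g(1) by (simp add: \<Gamma>0_def)
    have "\<not> special x" if x: "x \<in> ?D g" for x
    proof
      assume "special x"
      then obtain s where "s \<in> Sp" "peq (Vx x) (Vx s)" using Sp(3) by blast
      then show False using piece_peq[OF x] av by blast
    qed
    \<comment> \<open>The branch is connected outside \<open>S0\<close>, so \<open>Z g\<close> is in
      the component of \<omega> together with \<open>v\<close>. Its neighbour \<open>U g\<close> is
      then in \<open>nbhd S0 \<omega>\<close> although it is equivalent to \<open>y\<close>.\<close>
    then have "conn S0 (Z g) v"
      using av JE UV(2)[OF g(1)] g(2) by (intro piece_conn[of "J - {g}"]) auto
    then have "Z g \<in> Cmp S0 \<omega>" by (rule Cmp_conn[OF vS0 conn_avoid_sym])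
    moreover have "edge_adj (Z g) (U g)"
      unfolding adj_def using UZ(1)[OF g(1)] g(1) GJ JE by (auto simp: insert_commute)
    ultimately have "U g \<in> nbhd S0 \<omega>" by (rule Cmp_adj_nbhd)
    then show False using S0(3) UZ(2)[OF g(1)] by blast
  qed
  then obtain g where g: "g \<in> \<Gamma>" "bad (?D g) \<omega>" by blast
  have "y \<notin> ?D g" by (rule UD[OF g(1)]) (simp add: peq_refl mem_VPsi y)
  then show ?thesis using g UZ[OF g(1)] GJ by blast
qed

text \<open>\<open>nw\<close> and \<open>nr\<close> exclude the two ways of being attached to
  \<omega>, by an equivalent vertex and by a ray. If no finite set separated the piece,
  \<open>bad_child\<close> could be iterated for ever, and the roots of the nested bad branches
  would eventually trace a ray of \<omega> inside the piece.\<close>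

lemma separate_piece_end:
  assumes fin: "finite \<Psi>" and J: "forest J" and w: "\<omega> \<in> \<Psi>" and y: "y \<in> V"
    and nw: "\<And>v. v \<in> piece J y \<Longrightarrow> \<not> peq (Vx v) (En \<omega>)"
    and nr: "\<And>r. r \<in> \<omega> \<Longrightarrow> r 0 \<in> piece J y \<Longrightarrow> \<not> (\<forall>n. \<exists>f\<in>J. {src f, tgt f} = {r n, r (Suc n)})"
  shows "\<exists>S. finite S \<and> S \<subseteq> V \<and> piece J y \<inter> Cmp S \<omega> = {}"
proof (rule ccontr)
  assume "\<not> ?thesis"
  then have b: "bad (piece J y) \<omega>" unfolding bad_def by blast
  have JE: "J \<subseteq> E" using J by (simp add: forest_def)
  \<comment> \<open>A state consists of the edges not yet deleted and the root of the current
    branch.\<close>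
  define inv where "inv p \<longleftrightarrow> fst p \<subseteq> J \<and> snd p \<in> V \<and> piece (fst p) (snd p) \<subseteq> piece J y \<and>
    bad (piece (fst p) (snd p)) \<omega>" for p
  define nxt where "nxt p q \<longleftrightarrow> (\<exists>g\<in>fst p. \<exists>u. fst q = fst p - {g} \<and> {src g, tgt g} = {u, snd q} \<and>
    peq (Vx (snd p)) (Vx u) \<and> snd p \<notin> piece (fst q) (snd q))" for p q
  have step: "\<exists>q. inv q \<and> nxt p q" if p: "inv p" for p
  proof -
    have i: "fst p \<subseteq> J" "snd p \<in> V" "piece (fst p) (snd p) \<subseteq> piece J y" "bad (piece (fst p) (snd p)) \<omega>"
      using p by (auto simp: inv_def)
    obtain g u z where g: "g \<in> fst p" "{src g, tgt g} = {u, z}" "peq (Vx (snd p)) (Vx u)"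
      "bad (piece (fst p - {g}) z) \<omega>" "snd p \<notin> piece (fst p - {g}) z"
      using bad_child[OF fin forest_subset[OF J i(1)] w i(2) nw[OF subsetD[OF i(3)]] i(4)] by blast
    have "g \<in> E" using g(1) i(1) JE by blast
    then have z: "z \<in> V" using edge_in[of g] g(2) by (auto simp: doubleton_eq_iff)
    have "(Vx (snd p), Vx z) \<in> eqc (Rel (fst p))"
      by (rule eqc_trans[OF eqc_Rel_peq[OF g(3)] eqc_Rel_edge[OF g(1,2)]])
    then have "piece (fst p - {g}) z \<subseteq> piece (fst p) (snd p)" by (intro piece_subset_piece) auto
    then have "inv (fst p - {g}, z)" using i z g(4) by (auto simp: inv_def)
    moreover have "nxt p (fst p - {g}, z)" using g by (auto simp: nxt_def)
    ultimately show ?thesis by blast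
  qed
  have "\<exists>F. F 0 = (J, y) \<and> (\<forall>n. inv (F n) \<and> nxt (F n) (F (Suc n)))"
  proof -
    \<comment> \<open>The clause for \<open>n = 0\<close> fixes the initial state, which
      \<open>dependent_nat_choice\<close> would leave open.\<close>
    have "\<exists>F. \<forall>n. (inv (F n) \<and> (n = 0 \<longrightarrow> F n = (J, y))) \<and> nxt (F n) (F (Suc n))"
    proof (rule dependent_nat_choice)
      show "\<exists>p. inv p \<and> (0 = (0::nat) \<longrightarrow> p = (J, y))" using y b by (intro exI[of _ "(J, y)"]) (simp add: inv_def)
    next
      fix p and n :: nat assume "inv p \<and> (n = 0 \<longrightarrow> p = (J, y))"
      then show "\<exists>q. (inv q \<and> (Suc n = 0 \<longrightarrow> q = (J, y))) \<and> nxt p q" using step[of p] by simp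
    qed
    then show ?thesis by blast
  qed
  then obtain F where F: "F 0 = (J, y)" "\<And>n. inv (F n)" "\<And>n. nxt (F n) (F (Suc n))" by blast
  define Jn where "Jn n = fst (F n)" for n
  define yn where "yn n = snd (F n)" for n
  have J0: "Jn 0 = J" "yn 0 = y" using F(1) by (simp_all add: Jn_def yn_def)
  have inv: "Jn n \<subseteq> J" "yn n \<in> V" "piece (Jn n) (yn n) \<subseteq> piece J y" "bad (piece (Jn n) (yn n)) \<omega>" for n
    using F(2)[of n] by (auto simp: inv_def Jn_def yn_def)
  have "\<forall>n. \<exists>g u. g \<in> Jn n \<and> Jn (Suc n) = Jn n - {g} \<and> {src g, tgt g} = {u, yn (Suc n)} \<and>
    peq (Vx (yn n)) (Vx u) \<and> yn n \<notin> piece (Jn (Suc n)) (yn (Suc n))"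
    using F(3) unfolding nxt_def Jn_def yn_def by blast
  then obtain g u where gu: "\<And>n. g n \<in> Jn n" "\<And>n. Jn (Suc n) = Jn n - {g n}"
    "\<And>n. {src (g n), tgt (g n)} = {u n, yn (Suc n)}" "\<And>n. peq (Vx (yn n)) (Vx (u n))"
    "\<And>n. yn n \<notin> piece (Jn (Suc n)) (yn (Suc n))" by metis
  have Jdec: "Jn m \<subseteq> Jn n" if "n \<le> m" for n m
    using that by (induction m rule: dec_induct) (use gu(2) in auto)
  have link: "(Vx (yn n), Vx (yn (Suc n))) \<in> eqc (Rel K)" if "g n \<in> K" for n K
    by (rule eqc_trans[OF eqc_Rel_peq[OF gu(4)] eqc_Rel_edge[OF that gu(3)]])
  have Pstep: "piece (Jn (Suc n)) (yn (Suc n)) \<subseteq> piece (Jn n) (yn n)" for n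
    using gu(2)[of n] link[OF gu(1)[of n]] by (intro piece_subset_piece) auto
  have Pdec: "piece (Jn m) (yn m) \<subseteq> piece (Jn n) (yn n)" if "n \<le> m" for n m
    using that
  proof (induction m rule: dec_induct)
    case (step m) then show ?case using Pstep[of m] by blast
  qed simp
  have gneq: "g n \<noteq> g m" if "n < m" for n m
  proof -
    have "g m \<in> Jn (Suc n)" using gu(1)[of m] Jdec[of "Suc n" m] that by auto
    then have "g m \<in> Jn n - {g n}" unfolding gu(2)[of n] .
    then show ?thesis by auto
  qed
  have ginj: "inj g"
  proof (rule injI)
    fix n m assume "g n = g m"
    then show "n = m" using gneq[of n m] gneq[of m n] by (cases n m rule: linorder_cases) auto
  qed
  \<comment> \<open>The connection from \<open>y\<close> to \<open>v\<close> uses finitely many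
    edges and so avoids some \<open>g n\<close>. If \<open>v\<close> were in all branches, it would
    link the two ends of \<open>g n\<close> in the forest without \<open>g n\<close>.\<close>
  have vanish: "\<exists>n. v \<notin> piece (Jn n) (yn n)" for v
  proof (rule ccontr)
    assume "\<not> ?thesis"
    then have all: "v \<in> piece (Jn n) (yn n)" for n by blast
    have "(Vx y, Vx v) \<in> eqc ({(x, y). peq x y} \<union> edge_pair ` J)"
      using all[of 0] J0 by (simp add: piece_def Rel_def Un_commute)
    then obtain L where L: "finite L" "L \<subseteq> edge_pair ` J" "(Vx y, Vx v) \<in> eqc ({(x, y). peq x y} \<union> L)"
      using eqc_finite_support by metis
    then obtain Z where Z: "Z \<subseteq> J" "finite Z" "L = edge_pair ` Z" using finite_subset_image by metis
    have c: "(Vx y, Vx v) \<in> eqc (Rel Z)" using L(3) Z(3) by (simp add: Rel_def Un_commute)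
    have "infinite (range g)" using range_inj_infinite[OF ginj] .
    then obtain n where n: "g n \<notin> Z" using Z(2) by (meson finite_subset image_subset_iff)
    let ?K = "J - {g n}"
    have 1: "(Vx (yn 0), Vx (yn k)) \<in> eqc (Rel ?K)" if "k \<le> n" for k
      using that
    proof (induction k)
      case (Suc k)
      have "g k \<in> ?K" using gu(1)[of k] inv(1)[of k] gneq[of k n] Suc.prems by auto
      from eqc_trans[OF Suc.IH link[OF this]] Suc.prems show ?case by simp
    qed simp
    have 2: "(Vx y, Vx v) \<in> eqc (Rel ?K)" using eqc_Rel_mono[OF _ c, of ?K] Z(1) n by blast
    have "(Vx (yn (Suc n)), Vx v) \<in> eqc (Rel (Jn (Suc n)))" using all[of "Suc n"] by (simp add: piece_def)
    moreover have "Jn (Suc n) \<subseteq> ?K" using gu(2)[of n] inv(1)[of n] by auto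
    ultimately have 3: "(Vx (yn (Suc n)), Vx v) \<in> eqc (Rel ?K)" using eqc_Rel_mono by blast
    have 4: "(Vx (u n), Vx (yn n)) \<in> eqc (Rel ?K)" by (rule eqc_Rel_peq[OF peq_sym[OF gu(4)]])
    have "(Vx y, Vx (yn n)) \<in> eqc (Rel ?K)" using 1[of n] J0 by simp
    from eqc_trans[OF eqc_trans[OF eqc_trans[OF 4 eqc_sym[OF this]] 2] eqc_sym[OF 3]]
    have "(Vx (u n), Vx (yn (Suc n))) \<in> eqc (Rel ?K)" .
    moreover have "g n \<in> J" using gu(1)[of n] inv(1)[of n] by auto
    ultimately show False using forest_endpoints[OF J _ gu(3)] by blast
  qed
  have vanish_finite: "\<exists>N. \<forall>n\<ge>N. piece (Jn n) (yn n) \<inter> S = {}" if S: "finite S" for S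
  proof -
    obtain nv where nv: "\<And>v. v \<notin> piece (Jn (nv v)) (yn (nv v))" using vanish by metis
    obtain N where N: "\<forall>k\<in>nv ` S. k \<le> N" using finite_nat_set_iff_bounded_le[of "nv ` S"] S by blast
    have "v \<notin> piece (Jn n) (yn n)" if "n \<ge> N" "v \<in> S" for n v
      using nv[of v] Pdec[of "nv v" n] N that by (meson image_eqI order_trans subsetD)
    then show ?thesis by blast
  qed
  obtain Sp where Sp: "finite Sp" "Sp \<subseteq> V" "\<And>v. special v \<Longrightarrow> \<exists>s\<in>Sp. peq (Vx v) (Vx s)"
    using special_reps[OF fin] by blast
  obtain N where N: "\<And>n. n \<ge> N \<Longrightarrow> piece (Jn n) (yn n) \<inter> Sp = {}" using vanish_finite[OF Sp(1)] by blast
  have ns: "\<not> special v" if n: "n \<ge> N" and v: "v \<in> piece (Jn n) (yn n)" for n v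
  proof
    assume "special v"
    then obtain s where "s \<in> Sp" "peq (Vx v) (Vx s)" using Sp(3) by blast
    then show False using piece_peq[OF v] N[OF n] by blast
  qed
  \<comment> \<open>Once the branches avoid all special vertices, equivalence is equality, so
    consecutive edges really share a vertex.\<close>
  have un: "u n = yn n" if "n \<ge> N" for n
    using nonspecial_class[OF inv(2) ns[OF that piece_self[OF inv(2)]] gu(4)] by simp
  define r where "r k = yn (N + k)" for k
  have redge: "{src (g (N + k)), tgt (g (N + k))} = {r k, r (Suc k)}" for k
    using gu(3)[of "N + k"] un[of "N + k"] by (simp add: r_def)
  have gE: "g n \<in> J" for n using gu(1)[of n] inv(1)[of n] by auto
  have yneq: "yn n \<noteq> yn m" if "n < m" for n m
  proof -
    have "yn m \<in> piece (Jn (Suc n)) (yn (Suc n))"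
      using Pdec[of "Suc n" m] piece_self[OF inv(2)[of m], of "Jn m"] that by auto
    then show ?thesis using gu(5)[of n] by auto
  qed
  have ray: "ray r"
  proof (rule is_rayI)
    fix i j assume "r i = r j"
    then show "i = j" using yneq[of "N + i" "N + j"] yneq[of "N + j" "N + i"]
      by (cases i j rule: linorder_cases) (auto simp: r_def)
  next
    fix n
    show "r n \<in> V" using inv(2) by (simp add: r_def)
    show "edge_adj (r n) (r (Suc n))" unfolding adj_def using redge[of n] gE[of "N + n"] JE by blast
  qed
  have we: "\<omega> \<in> ends" using w Psi by blast
  obtain s where s: "ray s" "s \<in> \<omega>" by (rule end_cases[OF we])
  \<comment> \<open>A late branch avoids \<open>S\<close> and is connected, and being bad it meets
    the component of \<omega>; hence its root is in that component.\<close>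
  have "ray_equiv V E src tgt s r"
  proof (rule ray_equivI[OF s(1) ray])
    fix S n assume S: "finite S" "S \<subseteq> V" and n: "\<forall>m\<ge>n. s m \<notin> S \<and> r m \<notin> S"
    obtain M' where M': "\<And>k. k \<ge> M' \<Longrightarrow> piece (Jn k) (yn k) \<inter> S = {}" using vanish_finite[OF S(1)] by blast
    define M where "M = N + (n + M')"
    have av: "piece (Jn M) (yn M) \<inter> S = {}" by (rule M') (simp add: M_def)
    obtain v where v: "v \<in> piece (Jn M) (yn M)" "v \<in> Cmp S \<omega>" using inv(4)[of M] S unfolding bad_def by blast
    have "Jn M \<subseteq> E" using inv(1)[of M] JE by blast
    then have "conn S (yn M) v" using inv(2) av ns[of M] v(1) by (intro piece_conn[of "Jn M"]) (auto simp: M_def)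
    then have "yn M \<in> Cmp S \<omega>" by (rule Cmp_conn[OF v(2) conn_avoid_sym])
    then have "conn S (s n) (yn M)" using CmpD[OF _ we S s(2), of "yn M" n] n by blast
    then have "conn S (s n) (r (n + M'))" by (simp add: r_def M_def)
    then show "\<exists>a\<ge>n. \<exists>b\<ge>n. conn S (s a) (r b)" by (intro exI[of _ n] conjI exI[of _ "n + M'"]) auto
  qed
  then have "r \<in> \<omega>" using end_equiv[OF we s(2)] ray by blast
  moreover have "r 0 \<in> piece J y"
    using piece_self[OF inv(2)[of N], of "Jn N"] inv(3)[of N] by (auto simp: r_def)
  moreover have "\<forall>n. \<exists>f\<in>J. {src f, tgt f} = {r n, r (Suc n)}" using redge gE by blast
  ultimately show False using nr by blast
qed

end

section \<open>Linked edges\<close>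

text \<open>The pairwise intersections form a finite set, and tails beyond it are disjoint.\<close>

lemma disjoint_rays_of_almost_disjoint:
  assumes I: "finite I" and r: "\<forall>i\<in>I. is_ray V E src tgt (r i)"
    and fin: "\<forall>i\<in>I. \<forall>j\<in>I. i \<noteq> j \<longrightarrow> finite (range (r i) \<inter> range (r j))"
  shows "\<exists>R. disjoint_rays V E src tgt (card I) R"
proof -
  define B where "B = (\<Union>i\<in>I. \<Union>j\<in>I - {i}. range (r i) \<inter> range (r j))"
  have B: "finite B" unfolding B_def using I fin by (intro finite_UN_I finite_Diff) auto
  have "\<exists>k. i \<in> I \<longrightarrow> (\<forall>m\<ge>k. r i m \<notin> B)" for i using is_ray_avoids_finite[OF _ B] r by blast
  then have "\<forall>i. \<exists>k. i \<in> I \<longrightarrow> (\<forall>m\<ge>k. r i m \<notin> B)" ..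
  from choice[OF this] obtain k where k: "\<And>i m. i \<in> I \<Longrightarrow> m \<ge> k i \<Longrightarrow> r i m \<notin> B" by blast
  obtain h where h: "bij_betw h {0..<card I} I" using ex_bij_betw_nat_finite[OF I] by blast
  have hI: "h i \<in> I" if "i < card I" for i using h that by (auto simp: bij_betw_def)
  have "disjoint_rays V E src tgt (card I) (\<lambda>i m. r (h i) (k (h i) + m))"
    unfolding disjoint_rays_def
  proof (intro conjI allI impI)
    fix i assume "i < card I"
    then show "is_ray V E src tgt (\<lambda>m. r (h i) (k (h i) + m))" by (rule is_ray_tail[OF bspec[OF r hI]])
  next
    fix i j l m assume ij: "i < card I" "j < card I" and eq: "r (h i) (k (h i) + l) = r (h j) (k (h j) + m)"
    show "i = j"
    proof (rule ccontr)
      assume "i \<noteq> j"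
      then have "h i \<noteq> h j" using h ij by (auto simp: bij_betw_def inj_on_def)
      then have "h j \<in> I - {h i}" using hI ij by auto
      moreover have "r (h i) (k (h i) + l) \<in> range (r (h i)) \<inter> range (r (h j))" using eq by (metis IntI rangeI)
      ultimately have "r (h i) (k (h i) + l) \<in> B" unfolding B_def using hI[OF ij(1)] by blast
      then show False using k[OF hI[OF ij(1)], of "k (h i) + l"] by simp
    qed
  qed
  then show ?thesis by blast
qed

context psi_graph
begin

section \<open>Consequences of the bound on disjoint rays\<close>

lemma common_end:
  assumes "\<omega> \<in> ends" "\<omega>' \<in> ends" "r \<in> \<omega>" "s \<in> \<omega>'" "infinite (range r \<inter> range s)"
  shows "\<omega> = \<omega>'"
proof -
  have rs: "ray r" "ray s" using assms end_ray by blast+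
  have "s \<in> \<omega>" using end_equiv[OF assms(1,3)] infinite_meet_ray_equiv[OF rs assms(5)] rs by blast
  then show ?thesis using end_eqI assms by blast
qed

text \<open>Rays of distinct ends meet only finitely often, so \<open>K + 1\<close> ends would give
  \<open>K + 1\<close> disjoint rays.\<close>

lemma finite_Psi:
  assumes K: "\<forall>n R. disjoint_rays V E src tgt n R \<longrightarrow> n \<le> K"
  shows "finite \<Psi>"
proof (rule ccontr)
  assume "infinite \<Psi>"
  then obtain T where T: "finite T" "card T = Suc K" "T \<subseteq> \<Psi>" using infinite_arbitrarily_large by blast
  have "\<forall>\<omega>. \<exists>r. \<omega> \<in> T \<longrightarrow> r \<in> \<omega> \<and> ray r"
  proof
    fix \<omega> show "\<exists>r. \<omega> \<in> T \<longrightarrow> r \<in> \<omega> \<and> ray r"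
    proof (cases "\<omega> \<in> T")
      case True
      then have "\<omega> \<in> ends" using T Psi by blast
      then obtain r where "ray r" "r \<in> \<omega>" by (rule end_cases)
      then show ?thesis by blast
    qed simp
  qed
  from choice[OF this] obtain r where r: "\<And>\<omega>. \<omega> \<in> T \<Longrightarrow> r \<omega> \<in> \<omega>" "\<And>\<omega>. \<omega> \<in> T \<Longrightarrow> ray (r \<omega>)" by blast
  have "finite (range (r \<omega>) \<inter> range (r \<omega>'))" if "\<omega> \<in> T" "\<omega>' \<in> T" "\<omega> \<noteq> \<omega>'" for \<omega> \<omega>'
  proof (rule ccontr)
    assume "infinite (range (r \<omega>) \<inter> range (r \<omega>'))"
    moreover have "\<omega> \<in> ends" "\<omega>' \<in> ends" using that T(3) Psi by blast+
    ultimately show False using common_end r(1) that by blast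
  qed
  then have "\<exists>R. disjoint_rays V E src tgt (card T) R"
    using r(2) by (intro disjoint_rays_of_almost_disjoint[OF T(1), where r = r]) blast+
  then have "card T \<le> K" using K by blast
  then show False using T(2) by simp
qed

text \<open>A ray of the end \<open>\<omega>\<close> inside \<open>J\<close> attaches its component of \<open>J\<close> to the point \<open>\<omega>\<close>.\<close>

definition Links :: "'e set \<Rightarrow> (('v, 'e) gpoint \<times> ('v, 'e) gpoint) set" where
  "Links J = {(Vx (r 0), En \<omega>) | r \<omega>. \<omega> \<in> \<Psi> \<and> r \<in> \<omega> \<and> (\<forall>n. \<exists>f\<in>J. {src f, tgt f} = {r n, r (Suc n)})}"

lemma eqc_Rel_ray:
  assumes "\<forall>n. \<exists>f\<in>J. {src f, tgt f} = {r n, r (Suc n)}"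
  shows "(Vx (r 0), Vx (r n)) \<in> eqc (Rel J)"
proof (induction n)
  case (Suc n)
  obtain f where "f \<in> J" "{src f, tgt f} = {r n, r (Suc n)}" using assms by blast
  from eqc_trans[OF Suc eqc_Rel_edge[OF this]] show ?case .
qed simp

lemma edge_pair_inj: "inj_on edge_pair E"
  by (rule inj_onI) (auto simp: edge_pair_def intro: edge_unique)

text \<open>A comparison of ranks over \<open>Rel (J - X)\<close>: the edges of \<open>X\<close> are
  independent because \<open>J\<close> is a forest, and they are spanned by a set of links, each of
  which comes from a ray. A smallest such set has at most \<open>K\<close> elements.\<close>

lemma linked_edges_bound:
  assumes K: "\<forall>n R. disjoint_rays V E src tgt n R \<longrightarrow> n \<le> K"
    and J: "forest J" and X: "finite X" "X \<subseteq> J"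
    and linked: "edge_pair ` X \<subseteq> eqc (Rel (J - X) \<union> Links (J - X))"
  shows "card X \<le> K"
proof -
  let ?Q = "Rel (J - X)" and ?P = "edge_pair ` X"
  define \<phi> where "\<phi> L \<longleftrightarrow> finite L \<and> L \<subseteq> Links (J - X) \<and> ?P \<subseteq> eqc (?Q \<union> L)" for L
  have "\<exists>L. \<phi> L"
  proof -
    have "\<forall>p. \<exists>L. p \<in> ?P \<longrightarrow> finite L \<and> L \<subseteq> Links (J - X) \<and> p \<in> eqc (?Q \<union> L)"
    proof
      fix p :: "('v, 'e) gpoint \<times> ('v, 'e) gpoint"
      show "\<exists>L. p \<in> ?P \<longrightarrow> finite L \<and> L \<subseteq> Links (J - X) \<and> p \<in> eqc (?Q \<union> L)"
        using eqc_finite_support[of "fst p" "snd p" ?Q "Links (J - X)"] linked by (cases "p \<in> ?P") auto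
    qed
    from choice[OF this] obtain L where L: "\<And>p. p \<in> ?P \<Longrightarrow> finite (L p)"
      "\<And>p. p \<in> ?P \<Longrightarrow> L p \<subseteq> Links (J - X)" "\<And>p. p \<in> ?P \<Longrightarrow> p \<in> eqc (?Q \<union> L p)" by blast
    have "p \<in> eqc (?Q \<union> (\<Union>p\<in>?P. L p))" if p: "p \<in> ?P" for p
    proof -
      have "?Q \<union> L p \<subseteq> ?Q \<union> (\<Union>p\<in>?P. L p)" using p by blast
      from eqc_mono[OF this] show ?thesis using L(3)[OF p] by blast
    qed
    then have "\<phi> (\<Union>p\<in>?P. L p)" unfolding \<phi>_def using L(1,2) X(1) by (intro conjI) (auto; fail | blast)+
    then show ?thesis by blast
  qed
  then obtain L where L: "\<phi> L" "\<And>L'. \<phi> L' \<Longrightarrow> card L \<le> card L'"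
    using ex_has_least_nat[of \<phi> _ card] by blast
  have "\<exists>r \<omega>. l \<in> L \<longrightarrow> l = (Vx (r 0), En \<omega>) \<and> \<omega> \<in> \<Psi> \<and> r \<in> \<omega> \<and>
      (\<forall>n. \<exists>f\<in>J - X. {src f, tgt f} = {r n, r (Suc n)})" for l
  proof (cases "l \<in> L")
    case True
    then have "l \<in> Links (J - X)" using L(1) unfolding \<phi>_def by blast
    then show ?thesis unfolding Links_def mem_Collect_eq by blast
  qed blast
  then have "\<forall>l. \<exists>r \<omega>. l \<in> L \<longrightarrow> l = (Vx (r 0), En \<omega>) \<and> \<omega> \<in> \<Psi> \<and> r \<in> \<omega> \<and>
      (\<forall>n. \<exists>f\<in>J - X. {src f, tgt f} = {r n, r (Suc n)})" by (rule allI)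
  from choice[OF this] obtain r where "\<forall>l. \<exists>\<omega>. l \<in> L \<longrightarrow> l = (Vx (r l 0), En \<omega>) \<and> \<omega> \<in> \<Psi> \<and> r l \<in> \<omega> \<and>
      (\<forall>n. \<exists>f\<in>J - X. {src f, tgt f} = {r l n, r l (Suc n)})" by blast
  from choice[OF this] obtain \<omega> where rw: "\<And>l. l \<in> L \<Longrightarrow> l = (Vx (r l 0), En (\<omega> l))" "\<And>l. l \<in> L \<Longrightarrow> \<omega> l \<in> \<Psi>"
    "\<And>l. l \<in> L \<Longrightarrow> r l \<in> \<omega> l" "\<And>l. l \<in> L \<Longrightarrow> \<forall>n. \<exists>f\<in>J - X. {src f, tgt f} = {r l n, r l (Suc n)}" by blast
  have we: "\<omega> l \<in> ends" if "l \<in> L" for l using rw(2)[OF that] Psi by blast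
  have rr: "ray (r l)" if "l \<in> L" for l using end_ray[OF we[OF that] rw(3)[OF that]] .
  \<comment> \<open>Two rays with infinitely many common vertices belong to the same end, and one
    common vertex connects their starting vertices within \<open>J - X\<close>. So one of the two
    links is redundant, against minimality.\<close>
  have "finite (range (r l) \<inter> range (r l'))" if l: "l \<in> L" "l' \<in> L" "l \<noteq> l'" for l l'
  proof (rule ccontr)
    assume inf: "infinite (range (r l) \<inter> range (r l'))"
    have w: "\<omega> l = \<omega> l'" by (rule common_end[OF we[OF l(1)] we[OF l(2)] rw(3)[OF l(1)] rw(3)[OF l(2)] inf])
    have "range (r l) \<inter> range (r l') \<noteq> {}" using inf by (metis finite.emptyI)
    then obtain a b where ab: "r l a = r l' b" by blast
    have 1: "(Vx (r l' 0), Vx (r l 0)) \<in> eqc ?Q"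
      using eqc_trans[OF eqc_Rel_ray[OF rw(4)[OF l(2)], of b]] eqc_sym[OF eqc_Rel_ray[OF rw(4)[OF l(1)], of a]] ab
      by simp
    let ?L = "L - {l'}"
    have "(Vx (r l' 0), Vx (r l 0)) \<in> eqc (?Q \<union> ?L)" using eqc_mono[of ?Q "?Q \<union> ?L"] 1 by blast
    moreover have "l \<in> eqc (?Q \<union> ?L)" using l subset_eqc[of "?Q \<union> ?L"] by blast
    then have "(Vx (r l 0), En (\<omega> l')) \<in> eqc (?Q \<union> ?L)" using rw(1)[OF l(1)] w by simp
    ultimately have "(Vx (r l' 0), En (\<omega> l')) \<in> eqc (?Q \<union> ?L)" by (rule eqc_trans)
    then have l': "l' \<in> eqc (?Q \<union> ?L)" using rw(1)[OF l(2)] by simp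
    have "?Q \<union> L \<subseteq> eqc (?Q \<union> ?L)" using subset_eqc[of "?Q \<union> ?L"] l' by blast
    from eqc_least[OF this] have "\<phi> ?L" using L(1) unfolding \<phi>_def by blast
    then have "card L \<le> card ?L" by (rule L(2))
    moreover have "card ?L < card L" using l(2) L(1) unfolding \<phi>_def by (intro card_Diff1_less) auto
    ultimately show False by simp
  qed
  moreover have finL: "finite L" using L(1) unfolding \<phi>_def by blast
  ultimately have "\<exists>R. disjoint_rays V E src tgt (card L) R"
    using rr by (intro disjoint_rays_of_almost_disjoint[where r = r]) blast+
  then have "card L \<le> K" using K by blast
  moreover have "card ?P \<le> card L"
  proof (rule eqc_rank_bound[OF _ finL])
    show "finite ?P" using X(1) by simp
    show "?P \<subseteq> eqc (?Q \<union> L)" using L(1) unfolding \<phi>_def by blast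
    show "\<forall>p\<in>?P. p \<notin> eqc (?Q \<union> (?P - {p}))"
    proof
      fix p assume "p \<in> ?P"
      then obtain e where e: "e \<in> X" "p = edge_pair e" by blast
      have "?Q \<union> (?P - {p}) \<subseteq> Rel (J - {e})" unfolding Rel_def using X(2) e by blast
      then have "eqc (?Q \<union> (?P - {p})) \<subseteq> eqc (Rel (J - {e}))" by (rule eqc_mono)
      moreover have "p \<notin> eqc (Rel (J - {e}))" using J e X(2) unfolding forest_def by blast
      ultimately show "p \<notin> eqc (?Q \<union> (?P - {p}))" by blast
    qed
  qed
  moreover have "X \<subseteq> E" using X(2) J by (auto simp: forest_def)
  then have "card ?P = card X" using inj_on_subset[OF edge_pair_inj] by (intro card_image) blast
  ultimately show ?thesis by simp
qed

text \<open>A ray uses \<open>e\<close> at most finitely often, so a tail of it still gives a link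
  without \<open>e\<close>; the initial segment is replaced by connections, in which
  \<open>e\<close> is redundant by assumption.\<close>

lemma Rel_Links_remove:
  assumes e: "edge_pair e \<in> eqc (Rel (J - {e}) \<union> Links (J - {e}))"
  shows "Rel J \<union> Links J \<subseteq> eqc (Rel (J - {e}) \<union> Links (J - {e}))"
proof -
  let ?R = "Rel (J - {e}) \<union> Links (J - {e})"
  have sub: "?R \<subseteq> eqc ?R" by (rule subset_eqc)
  have Rel: "Rel J \<subseteq> eqc ?R"
  proof
    fix p assume "p \<in> Rel J"
    then have "p = edge_pair e \<or> p \<in> Rel (J - {e})" unfolding Rel_def by blast
    then show "p \<in> eqc ?R" using e sub by blast
  qed
  have "p \<in> eqc ?R" if p: "p \<in> Links J" for p
  proof -
    obtain r \<omega> where r: "p = (Vx (r 0), En \<omega>)" "\<omega> \<in> \<Psi>" "r \<in> \<omega>"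
      "\<forall>n. \<exists>f\<in>J. {src f, tgt f} = {r n, r (Suc n)}" using p unfolding Links_def by blast
    have we: "\<omega> \<in> ends" using r(2) Psi by blast
    obtain n where n: "\<forall>m\<ge>n. r m \<notin> {src e}" using is_ray_avoids_finite[OF end_ray[OF we r(3)], of "{src e}"] by blast
    have "\<exists>f\<in>J - {e}. {src f, tgt f} = {r (n + m), r (Suc (n + m))}" for m
    proof -
      obtain f where f: "f \<in> J" "{src f, tgt f} = {r (n + m), r (Suc (n + m))}" using r(4) by blast
      have "r (n + m) \<noteq> src e" "r (Suc (n + m)) \<noteq> src e" using n by auto
      then have "f \<noteq> e" using f(2) by (auto simp: doubleton_eq_iff)
      then show ?thesis using f by blast
    qed
    then have "(Vx (r n), En \<omega>) \<in> Links (J - {e})"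
      unfolding Links_def using r(2) end_tail[OF we r(3), of n]
      by (intro CollectI exI[of _ "\<lambda>m. r (n + m)"] exI[of _ \<omega>]) simp
    then have 1: "(Vx (r n), En \<omega>) \<in> eqc ?R" using sub by blast
    have "(Vx (r 0), Vx (r n)) \<in> eqc ?R" using eqc_Rel_ray[OF r(4)] eqc_least[OF Rel] by blast
    from eqc_trans[OF this 1] show ?thesis using r(1) by simp
  qed
  then show ?thesis using Rel by blast
qed

section \<open>Open partitions obtained from linked classes\<close>

lemma conn_eqc:
  assumes span: "\<forall>f\<in>E. edge_pair f \<in> eqc (Rel J)" and c: "conn S u w"
  shows "(Vx u, Vx w) \<in> eqc (Rel J)"
proof -
  have "(u, w) \<in> {(x, y). x \<in> V - S \<and> y \<in> V - S \<and> edge_adj x y}\<^sup>*"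
    using c by (simp add: conn_avoid_def)
  then show ?thesis
  proof (induction rule: rtrancl_induct)
    case (step a b)
    then obtain f where f: "f \<in> E" "{src f, tgt f} = {a, b}" by (auto simp: adj_def)
    have "(Vx a, Vx b) \<in> eqc (Rel J)"
      using bspec[OF span f(1)] f(2) eqc_sym by (auto simp: edge_pair_def doubleton_eq_iff)
    from eqc_trans[OF step.IH this] show ?case .
  qed simp
qed

text \<open>The condition to be met at each end \<omega> is that vertices near \<omega> are linked
  to \<open>a\<close> exactly when \<omega> is. Finiteness of \<open>Y\<close> reduces this to
  finitely many pieces, each of which is linked to \<omega> or separated from it.\<close>

lemma split_component:
  assumes fin: "finite \<Psi>" and J: "forest J" and span: "\<forall>f\<in>E. edge_pair f \<in> eqc (Rel J)"
    and Y: "finite Y" "Y \<subseteq> J"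
  defines "R \<equiv> Rel (J - Y) \<union> Links (J - Y)"
  shows "split {v \<in> V. (a, Vx v) \<in> eqc R} {\<omega> \<in> \<Psi>. (a, En \<omega>) \<in> eqc R}"
proof -
  define same where "same p \<longleftrightarrow> (a, p) \<in> eqc R" for p
  have same_eq: "same p \<longleftrightarrow> same q" if "(p, q) \<in> eqc R" for p q
    unfolding same_def by (rule eqc_cong_right[OF that])
  have RelR: "(p, q) \<in> eqc (Rel (J - Y)) \<Longrightarrow> (p, q) \<in> eqc R" for p q
    using eqc_mono[of "Rel (J - Y)" R] unfolding R_def by blast
  have JE: "J \<subseteq> E" using J by (simp add: forest_def)
  have key: "\<exists>S. finite S \<and> S \<subseteq> V \<and> (\<forall>v\<in>nbhd S \<omega>. same (Vx v) = same (En \<omega>))" if w: "\<omega> \<in> \<Psi>" for \<omega>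
  proof -
    have we: "\<omega> \<in> ends" using w Psi by blast
    obtain s where s: "ray s" "s \<in> \<omega>" by (rule end_cases[OF we])
    \<comment> \<open>The endvertices of \<open>Y\<close> and a vertex of a ray of \<omega>. As
      \<open>J\<close> spans, the pieces of these finitely many vertices cover the component of the
      whole graph that contains \<omega>.\<close>
    define Z where "Z = insert (s 0) (src ` Y \<union> tgt ` Y)"
    have Z: "finite Z" "Z \<subseteq> V" using Y JE edge_in is_ray_in[OF s(1)] by (auto simp: Z_def)
    have cover: "\<exists>z\<in>Z. v \<in> piece (J - Y) z" if v: "v \<in> Cmp {} \<omega>" for v
    proof -
      have "conn {} (s 0) v" using CmpD[OF v we _ _ s(2), of 0] by simp
      then have c: "(Vx (s 0), Vx v) \<in> eqc (Rel J)" by (rule conn_eqc[OF span])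
      let ?T = "{p. \<exists>z\<in>Z. (Vx z, p) \<in> eqc (Rel (J - Y))}"
      have "Vx v \<in> ?T"
      proof (rule eqc_Rel_closed[OF c])
        show "Vx (s 0) \<in> ?T" unfolding Z_def by (intro CollectI bexI[of _ "s 0"]) simp_all
      next
        fix f u w assume f: "f \<in> J" "{src f, tgt f} = {u, w}" "Vx u \<in> ?T"
        show "Vx w \<in> ?T"
        proof (cases "f \<in> Y")
          case True
          then have "w \<in> Z" using f(2) unfolding Z_def by (auto simp: doubleton_eq_iff)
          then show ?thesis by (intro CollectI bexI[of _ w]) simp_all
        next
          case False
          obtain z where z: "z \<in> Z" "(Vx z, Vx u) \<in> eqc (Rel (J - Y))" using f(3) by blast
          have "f \<in> J - Y" using f(1) False by blast
          from eqc_trans[OF z(2) eqc_Rel_edge[OF this f(2)]] show ?thesis using z(1) by blast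
        qed
      next
        fix p q assume pq: "peq p q" "p \<in> ?T"
        obtain z where z: "z \<in> Z" "(Vx z, p) \<in> eqc (Rel (J - Y))" using pq(2) by blast
        from eqc_trans[OF z(2) eqc_Rel_peq[OF pq(1)]] show "q \<in> ?T" using z(1) by blast
      qed
      then obtain z where "z \<in> Z" "(Vx z, Vx v) \<in> eqc (Rel (J - Y))" by blast
      then show ?thesis using Cmp_in[OF v] by (auto simp: piece_def)
    qed
    \<comment> \<open>A piece whose linkage to \<open>a\<close> differs from that of \<omega>
      contains neither a vertex equivalent to \<omega> nor the start of a ray of \<omega> in
      \<open>J - Y\<close>, so \<open>separate_piece_end\<close> applies.\<close>
    have sep: "\<exists>S. z \<in> Z \<and> same (Vx z) \<noteq> same (En \<omega>) \<longrightarrow> finite S \<and> S \<subseteq> V \<and> piece (J - Y) z \<inter> Cmp S \<omega> = {}" for z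
    proof (cases "z \<in> Z \<and> same (Vx z) \<noteq> same (En \<omega>)")
      case True
      have pz: "same (Vx v) = same (Vx z)" if "v \<in> piece (J - Y) z" for v
        using same_eq[OF RelR] that by (auto simp: piece_def)
      have "\<exists>S. finite S \<and> S \<subseteq> V \<and> piece (J - Y) z \<inter> Cmp S \<omega> = {}"
      proof (rule separate_piece_end[OF fin forest_subset[OF J] w])
        show "J - Y \<subseteq> J" by blast
        show "z \<in> V" using True Z(2) by blast
      next
        fix v assume v: "v \<in> piece (J - Y) z"
        show "\<not> peq (Vx v) (En \<omega>)"
        proof
          assume "peq (Vx v) (En \<omega>)"
          then have "same (Vx v) = same (En \<omega>)" by (intro same_eq RelR eqc_Rel_peq)
          then show False using pz[OF v] True by simp
        qed
      next
        fix r assume r: "r \<in> \<omega>" "r 0 \<in> piece (J - Y) z"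
        show "\<not> (\<forall>n. \<exists>f\<in>J - Y. {src f, tgt f} = {r n, r (Suc n)})"
        proof
          assume "\<forall>n. \<exists>f\<in>J - Y. {src f, tgt f} = {r n, r (Suc n)}"
          then have "(Vx (r 0), En \<omega>) \<in> Links (J - Y)" unfolding Links_def using w r(1) by blast
          then have "(Vx (r 0), En \<omega>) \<in> eqc R" unfolding R_def by (intro eqc_base) blast
          then have "same (Vx (r 0)) = same (En \<omega>)" by (rule same_eq)
          then show False using pz[OF r(2)] True by simp
        qed
      qed
      then show ?thesis by blast
    qed blast
    have "\<forall>z. \<exists>S. z \<in> Z \<and> same (Vx z) \<noteq> same (En \<omega>) \<longrightarrow> finite S \<and> S \<subseteq> V \<and> piece (J - Y) z \<inter> Cmp S \<omega> = {}"
      using sep by (rule allI)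
    from choice[OF this] obtain Sz where Sz: "\<And>z. z \<in> Z \<Longrightarrow> same (Vx z) \<noteq> same (En \<omega>) \<Longrightarrow>
        finite (Sz z) \<and> Sz z \<subseteq> V \<and> piece (J - Y) z \<inter> Cmp (Sz z) \<omega> = {}" by blast
    define S1 where "S1 = (\<Union>z\<in>{z \<in> Z. same (Vx z) \<noteq> same (En \<omega>)}. Sz z)"
    have S1: "finite S1" "S1 \<subseteq> V" unfolding S1_def using Z(1) Sz by auto
    have C1: "same (Vx v) = same (En \<omega>)" if v: "v \<in> Cmp S1 \<omega>" for v
    proof (rule ccontr)
      assume ne: "same (Vx v) \<noteq> same (En \<omega>)"
      have "v \<in> Cmp {} \<omega>" using v Cmp_antimono[of "{}" S1 \<omega>] by blast
      then obtain z where z: "z \<in> Z" "v \<in> piece (J - Y) z" using cover by blast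
      have "same (Vx z) = same (Vx v)" using same_eq[OF RelR] z(2) by (auto simp: piece_def)
      then have zn: "same (Vx z) \<noteq> same (En \<omega>)" using ne by simp
      have "Sz z \<subseteq> S1" unfolding S1_def using z(1) zn by blast
      then have "v \<in> Cmp (Sz z) \<omega>" using v Cmp_antimono by blast
      then show False using Sz[OF z(1) zn] z(2) by blast
    qed
    \<comment> \<open>\<open>C1\<close> settles only the component itself, while \<open>nbhd\<close>
      may also contain vertices of \<open>S1\<close>. The finitely many of these with the wrong
      linkage are separated from \<omega> one at a time.\<close>
    have sep2: "\<exists>S. v \<in> S1 \<and> same (Vx v) \<noteq> same (En \<omega>) \<longrightarrow> finite S \<and> S \<subseteq> V \<and> v \<notin> nbhd S \<omega>" for v
    proof (cases "v \<in> S1 \<and> same (Vx v) \<noteq> same (En \<omega>)")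
      case True
      then have vV: "v \<in> V" using S1(2) by blast
      have "\<not> peq (Vx v) (En \<omega>)" using True same_eq[OF RelR[OF eqc_Rel_peq]] by blast
      from separate_class_end[OF w vV this] obtain S where
        S: "finite S" "S \<subseteq> V" "\<forall>u. peq (Vx v) (Vx u) \<longrightarrow> u \<notin> nbhd S \<omega>" by blast
      have "v \<notin> nbhd S \<omega>" using S(3) peq_refl vV by (simp add: mem_VPsi)
      then show ?thesis using S by blast
    qed blast
    have "\<forall>v. \<exists>S. v \<in> S1 \<and> same (Vx v) \<noteq> same (En \<omega>) \<longrightarrow> finite S \<and> S \<subseteq> V \<and> v \<notin> nbhd S \<omega>"
      using sep2 by (rule allI)
    from choice[OF this] obtain Sv where Sv: "\<And>v. v \<in> S1 \<Longrightarrow> same (Vx v) \<noteq> same (En \<omega>) \<Longrightarrow>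
        finite (Sv v) \<and> Sv v \<subseteq> V \<and> v \<notin> nbhd (Sv v) \<omega>" by blast
    define S2 where "S2 = S1 \<union> (\<Union>v\<in>{v \<in> S1. same (Vx v) \<noteq> same (En \<omega>)}. Sv v)"
    have S2: "finite S2" "S2 \<subseteq> V" unfolding S2_def using S1 Sv by auto
    have C2: "v \<in> Cmp S1 \<omega>" if "v \<in> Cmp S2 \<omega>" for v
      using that Cmp_antimono[of S1 S2 \<omega>] unfolding S2_def by blast
    have "same (Vx v) = same (En \<omega>)" if v: "v \<in> nbhd S2 \<omega>" for v
    proof (cases "v \<in> S1")
      case True
      show ?thesis
      proof (rule ccontr)
        assume ne: "same (Vx v) \<noteq> same (En \<omega>)"
        then have "Sv v \<subseteq> S2" unfolding S2_def using True by blast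
        then have "v \<in> nbhd (Sv v) \<omega>" using nbhd_antimono v by blast
        then show False using Sv[OF True ne] by blast
      qed
    next
      case False
      have "v \<in> Cmp S1 \<omega>"
      proof (cases "v \<in> Cmp S2 \<omega>")
        case True then show ?thesis by (rule C2)
      next
        case notC: False
        then obtain u where u: "u \<in> Cmp S2 \<omega>" "edge_adj u v" using v unfolding nbhd_def by blast
        have "u \<in> V - S1" using Cmp_in[OF C2[OF u(1)]] .
        moreover have "v \<in> V - S1" using False edge_adj_in(2)[OF u(2)] by blast
        ultimately have "conn S1 u v" using u(2) by (rule conn_avoid_edge)
        then show ?thesis by (rule Cmp_conn[OF C2[OF u(1)]])
      qed
      then show ?thesis by (rule C1)
    qed
    then show ?thesis using S2 by blast
  qed
  show ?thesis
    unfolding split_def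
  proof (intro conjI ballI)
    fix \<omega> assume w: "\<omega> \<in> \<Psi>"
    obtain S where S: "finite S" "S \<subseteq> V" "\<forall>v\<in>nbhd S \<omega>. same (Vx v) = same (En \<omega>)" using key[OF w] by blast
    have "if \<omega> \<in> {\<omega> \<in> \<Psi>. (a, En \<omega>) \<in> eqc R} then nbhd S \<omega> \<subseteq> {v \<in> V. (a, Vx v) \<in> eqc R}
      else nbhd S \<omega> \<inter> {v \<in> V. (a, Vx v) \<in> eqc R} = {}"
      using S(3) nbhd_in[of S \<omega>] w unfolding same_def by auto
    with S show "\<exists>S. finite S \<and> S \<subseteq> V \<and> (if \<omega> \<in> {\<omega> \<in> \<Psi>. (a, En \<omega>) \<in> eqc R}
      then nbhd S \<omega> \<subseteq> {v \<in> V. (a, Vx v) \<in> eqc R} else nbhd S \<omega> \<inter> {v \<in> V. (a, Vx v) \<in> eqc R} = {})"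
      by blast
  qed auto
qed

end

section \<open>Independent sets\<close>

lemma matroid_indep_in: "is_matroid E ind \<Longrightarrow> ind I \<Longrightarrow> I \<subseteq> E"
  by (simp add: is_matroid_def)

lemma matroid_indep_empty: "is_matroid E ind \<Longrightarrow> ind {}"
  by (simp add: is_matroid_def)

lemma matroid_indep_subset:
  assumes "is_matroid E ind" "ind I" "J \<subseteq> I" shows "ind J"
proof -
  have "\<forall>I J. ind I \<and> J \<subseteq> I \<longrightarrow> ind J" using assms(1) unfolding is_matroid_def by (elim conjE)
  then show ?thesis using assms(2,3) by blast
qed

lemma matroid_exchange:
  assumes "is_matroid E ind" "ind A" "\<not> maximal_in ind E A" "maximal_in ind E B"
  shows "\<exists>b\<in>B - A. ind (insert b A)"
proof -
  have "\<forall>A B. ind A \<and> \<not> maximal_in ind E A \<and> maximal_in ind E B \<longrightarrow> (\<exists>b\<in>B - A. ind (insert b A))"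
    using assms(1) unfolding is_matroid_def by (elim conjE)
  from this[rule_format, of A B] show ?thesis using assms(2-4) by simp
qed

lemma matroid_extend:
  assumes "is_matroid E ind" "ind A" "A \<subseteq> X" "X \<subseteq> E"
  shows "\<exists>S. A \<subseteq> S \<and> maximal_in ind X S"
proof -
  have "\<forall>A X. ind A \<and> A \<subseteq> X \<and> X \<subseteq> E \<longrightarrow> (\<exists>S. A \<subseteq> S \<and> maximal_in ind X S)"
    using assms(1) unfolding is_matroid_def by (elim conjE)
  from this[rule_format, of A X] show ?thesis using assms(2-4) by simp
qed

lemma maximal_in_eq: "maximal_in P X S \<Longrightarrow> P T \<Longrightarrow> S \<subseteq> T \<Longrightarrow> T \<subseteq> X \<Longrightarrow> T = S"
  unfolding maximal_in_def by simp

text \<open>Replacing some \<open>x\<close> of \<open>B1 - B2\<close> by a suitable \<open>b\<close>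
  of \<open>B2 - B1\<close> keeps a base and shrinks both differences by one element.\<close>

lemma matroid_base_exchange:
  assumes M: "is_matroid E ind" and B: "maximal_in ind E B1" "maximal_in ind E B2" and fin: "finite (B1 - B2)"
  shows "finite (B2 - B1) \<and> card (B2 - B1) \<le> card (B1 - B2)"
  using B fin
proof (induction "card (B1 - B2)" arbitrary: B1)
  case 0
  then have "B1 \<subseteq> B2" by simp
  moreover have "ind B2" "B2 \<subseteq> E" using 0(3) by (simp_all add: maximal_in_def)
  ultimately have "B2 = B1" using maximal_in_eq[OF 0(2)] by blast
  then show ?case by simp
next
  case (Suc n)
  note I1 = matroid_indep_in[OF M] and I2 = matroid_indep_subset[OF M] and I3 = matroid_exchange[OF M]
  have "B1 - B2 \<noteq> {}" using Suc.hyps(2) by (metis card.empty nat.distinct(1))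
  then obtain x where x: "x \<in> B1" "x \<notin> B2" by blast
  let ?A = "B1 - {x}"
  have indB1: "ind B1" using Suc.prems(1) by (simp add: maximal_in_def)
  have indA: "ind ?A" by (rule I2[OF indB1]) blast
  have "\<not> maximal_in ind E ?A"
  proof
    assume "maximal_in ind E ?A"
    then have "B1 = ?A" by (rule maximal_in_eq) (use indB1 I1[OF indB1] in auto)
    then show False using x by blast
  qed
  from I3[OF indA this Suc.prems(2)] obtain b where b: "b \<in> B2" "b \<notin> ?A" "ind (insert b ?A)" by blast
  have bx: "b \<noteq> x" "b \<notin> B1" using b x by auto
  let ?B = "insert b ?A"
  have maxB: "maximal_in ind E ?B"
  proof (rule ccontr)
    assume "\<not> maximal_in ind E ?B"
    \<comment> \<open>The only candidate for \<open>c\<close> is \<open>x\<close>, so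
      \<open>b\<close> could have been added to the base \<open>B1\<close>.\<close>
    from I3[OF b(3) this Suc.prems(1)] obtain c where "c \<in> B1 - ?B" "ind (insert c ?B)" by blast
    then have "ind (insert x ?B)" by auto
    moreover have "insert x ?B = insert b B1" using x by blast
    ultimately have i: "ind (insert b B1)" by simp
    then have "insert b B1 = B1" using I1[OF i] by (intro maximal_in_eq[OF Suc.prems(1)]) auto
    then show False using bx by blast
  qed
  have d: "?B - B2 = (B1 - B2) - {x}" "B2 - ?B = (B2 - B1) - {b}" using b x bx by auto
  have "card (?B - B2) = n" unfolding d using Suc.hyps(2) x Suc.prems(3) by simp
  then have IH: "finite (B2 - ?B)" "card (B2 - ?B) \<le> n"
    using Suc.hyps(1)[of ?B] maxB Suc.prems(2,3) d(1) by auto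
  have "B2 - B1 = insert b (B2 - ?B)" using d(2) b bx by blast
  then have "finite (B2 - B1)" "card (B2 - B1) \<le> Suc (card (B2 - ?B))"
    using IH(1) by (simp_all add: card_insert_if)
  then show ?case using IH(2) Suc.hyps(2) by simp
qed

text \<open>A maximal independent subset \<open>B'\<close> of \<open>F\<close> above
  \<open>F - X\<close> is a base of the whole matroid, because \<open>F\<close> contains the base
  \<open>B\<close>. It misses at most \<open>card X\<close> elements of \<open>F\<close>, and base
  exchange transfers this to \<open>B\<close>.\<close>

lemma matroid_corank_bound:
  assumes M: "is_matroid E ind" and FE: "F \<subseteq> E" and B: "maximal_in ind E B" "B \<subseteq> F"
    and X: "finite X" "ind (F - X)"
  shows "finite (F - B) \<and> card (F - B) \<le> card X"
proof -
  note I3 = matroid_exchange[OF M] and I4 = matroid_extend[OF M]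
  obtain B' where B': "F - X \<subseteq> B'" "maximal_in ind F B'" using I4[OF X(2) Diff_subset FE] by blast
  have B'F: "ind B'" "B' \<subseteq> F" using B'(2) by (auto simp: maximal_in_def)
  have maxB': "maximal_in ind E B'"
  proof (rule ccontr)
    assume "\<not> maximal_in ind E B'"
    from I3[OF B'F(1) this B(1)] obtain b where b: "b \<in> B - B'" "ind (insert b B')" by blast
    then have "insert b B' \<subseteq> F" using B(2) B'F(2) by blast
    then have "insert b B' = B'" using b(2) by (intro maximal_in_eq[OF B'(2)]) auto
    then show False using b(1) by blast
  qed
  have sub: "F - B' \<subseteq> X" using B'(1) by blast
  then have fin: "finite (F - B')" using X(1) finite_subset by blast
  have "B - B' \<subseteq> F - B'" using B(2) by blast
  then have finB: "finite (B - B')" using fin finite_subset by blast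
  from matroid_base_exchange[OF M B(1) maxB' this]
  have ex: "finite (B' - B)" "card (B' - B) \<le> card (B - B')" by auto
  have FB: "F - B = (F - (B \<union> B')) \<union> (B' - B)" "F - B' = (F - (B \<union> B')) \<union> (B - B')"
    using B(2) B'F(2) by auto
  have finR: "finite (F - (B \<union> B'))" using fin by (rule rev_finite_subset) blast
  have "card (F - B) = card (F - (B \<union> B')) + card (B' - B)"
    unfolding FB(1) using finR ex(1) by (intro card_Un_disjoint) auto
  also have "\<dots> \<le> card (F - (B \<union> B')) + card (B - B')" using ex(2) by simp
  also have "\<dots> = card (F - B')"
    unfolding FB(2) using finR finB by (intro card_Un_disjoint[symmetric]) auto
  also have "\<dots> \<le> card X" using sub X(1) by (rule card_mono[rotated])
  finally show ?thesis unfolding FB(1) using finR ex(1) by simp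
qed

section \<open>Spanning forests and independence in the system of circles\<close>

context psi_graph
begin

text \<open>Restates acyclicity as independence over the identifications, the form needed by
  \<open>eqc_maximal_spans\<close>. As parallel edges are absent, deleting an edge amounts to
  deleting its pair.\<close>

lemma forest_iff:
  assumes "J \<subseteq> E"
  shows "forest J \<longleftrightarrow> (\<forall>q\<in>edge_pair ` J. q \<notin> eqc ({(x, y). peq x y} \<union> (edge_pair ` J - {q})))"
proof -
  have "Rel (J - {e}) = {(x, y). peq x y} \<union> (edge_pair ` J - {edge_pair e})" if e: "e \<in> J" for e
  proof -
    have "edge_pair ` (J - {e}) = edge_pair ` J - edge_pair ` {e}"
      using e assms by (intro inj_on_image_set_diff[OF edge_pair_inj]) auto
    then show ?thesis by (simp add: Rel_def Un_commute)
  qed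
  then show ?thesis using assms unfolding forest_def by auto
qed

text \<open>A cycle in the union of a chain uses finitely many edges and hence lies in one member,
  so Zorn's lemma gives a maximal forest, and such a forest spans.\<close>

lemma forest_extend_spanning:
  assumes F: "forest F"
  obtains J where "forest J" "F \<subseteq> J" "\<forall>f\<in>E. edge_pair f \<in> eqc (Rel J)"
proof -
  let ?A = "{J. forest J \<and> F \<subseteq> J}"
  have "\<exists>M\<in>?A. \<forall>X\<in>?A. M \<subseteq> X \<longrightarrow> X = M"
  proof (rule subset_Zorn_nonempty)
    show "?A \<noteq> {}" using F by blast
    fix \<C> assume C: "\<C> \<noteq> {}" "subset.chain ?A \<C>"
    have CA: "\<C> \<subseteq> ?A" using C(2) by (simp add: subset.chain_def)
    have "forest (\<Union>\<C>)"
      unfolding forest_def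
    proof (intro conjI ballI notI)
      show "\<Union>\<C> \<subseteq> E" using CA by (auto simp: forest_def)
      fix e assume e: "e \<in> \<Union>\<C>" "edge_pair e \<in> eqc (Rel (\<Union>\<C> - {e}))"
      then have "(Vx (src e), Vx (tgt e)) \<in> eqc ({(x, y). peq x y} \<union> edge_pair ` (\<Union>\<C> - {e}))"
        by (simp add: edge_pair_def[of e] Rel_def Un_commute)
      then obtain L where L: "finite L" "L \<subseteq> edge_pair ` (\<Union>\<C> - {e})"
        "(Vx (src e), Vx (tgt e)) \<in> eqc ({(x, y). peq x y} \<union> L)" using eqc_finite_support by metis
      then obtain Z where Z: "Z \<subseteq> \<Union>\<C> - {e}" "finite Z" "L = edge_pair ` Z" using finite_subset_image by metis
      have "finite (insert e Z)" "insert e Z \<subseteq> \<Union>\<C>" using Z e(1) by auto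
      from finite_subset_Union_chain[OF this C] obtain J where J: "J \<in> \<C>" "insert e Z \<subseteq> J" by blast
      have "edge_pair e \<in> eqc (Rel Z)" using L(3) Z(3) by (simp add: edge_pair_def[of e] Rel_def Un_commute)
      moreover have "Z \<subseteq> J - {e}" using J(2) Z(1) by blast
      ultimately have "edge_pair e \<in> eqc (Rel (J - {e}))" using eqc_mono[OF Rel_mono] by blast
      moreover have "forest J" using CA J(1) by blast
      ultimately show False using J(2) unfolding forest_def by blast
    qed
    moreover have "F \<subseteq> \<Union>\<C>" using CA C(1) by blast
    ultimately show "\<Union>\<C> \<in> ?A" by simp
  qed
  then obtain J where J': "J \<in> ?A" "\<forall>X\<in>?A. J \<subseteq> X \<longrightarrow> X = J" by (elim bexE)
  then have J: "forest J" "F \<subseteq> J" by simp_all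
  have max: "X = J" if "forest X" "F \<subseteq> X" "J \<subseteq> X" for X using J'(2) that by simp
  have JE: "J \<subseteq> E" using J(1) by (simp add: forest_def)
  have "edge_pair f \<in> eqc (Rel J)" if f: "f \<in> E" for f
  proof (rule ccontr)
    assume n: "edge_pair f \<notin> eqc (Rel J)"
    then have "edge_pair f \<notin> eqc ({(x, y). peq x y} \<union> edge_pair ` J)" by (simp add: Rel_def Un_commute)
    with J(1)[unfolded forest_iff[OF JE]]
    have "\<forall>q\<in>insert (edge_pair f) (edge_pair ` J).
        q \<notin> eqc ({(x, y). peq x y} \<union> (insert (edge_pair f) (edge_pair ` J) - {q}))"
      by (rule eqc_maximal_spans)
    moreover have "insert f J \<subseteq> E" using f JE by blast
    ultimately have "forest (insert f J)" using forest_iff[of "insert f J"] by simp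
    then have "insert f J = J" using J(2) by (intro max) auto
    then have "edge_pair f \<in> Rel J" unfolding Rel_def by blast
    then show False using n subset_eqc by blast
  qed
  then show ?thesis using that[OF J(1,2)] by blast
qed

lemma fin_indep_forest:
  assumes "F \<subseteq> E" "fin_indep (psi_indep V E src tgt \<Psi>) F"
  shows "forest F"
  unfolding forest_def
proof (intro conjI ballI notI)
  fix e assume e: "e \<in> F" "edge_pair e \<in> eqc (Rel (F - {e}))"
  have "e \<in> E" "F - {e} \<subseteq> E" using e(1) assms(1) by auto
  from finite_circle_exists[OF this _ e(2)] obtain C K where
    C: "topological_circle quot C" "finite K" "K \<subseteq> insert e (F - {e})" "circle_edges V E src tgt \<Psi> C \<subseteq> K"
    by blast
  have "K \<subseteq> F" using C(3) e(1) by blast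
  then have "psi_indep V E src tgt \<Psi> K" using assms(2) C(2) by (simp add: fin_indep_def)
  then show False using C(1,4) unfolding psi_indep_def by blast
qed (use assms in blast)

text \<open>By \<open>e0\<close> every circle contains an edge \<open>e\<close>. The points linked
  to \<open>src e\<close> without \<open>e\<close> form a split; \<open>br\<close> puts
  \<open>tgt e\<close> on its other side, while every other edge of \<open>J - X\<close> joins
  linked points. So \<open>e\<close> would be the only edge of the circle to cross the
  split.\<close>

lemma acyclic_indep:
  assumes fin: "finite \<Psi>" and J: "forest J" and span: "\<forall>f\<in>E. edge_pair f \<in> eqc (Rel J)"
    and X: "finite X" "X \<subseteq> J"
    and br: "\<forall>e\<in>J - X. edge_pair e \<notin> eqc (Rel (J - X - {e}) \<union> Links (J - X - {e}))"
    and e0: "psi_indep V E src tgt \<Psi> {}"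
  shows "psi_indep V E src tgt \<Psi> (J - X)"
  unfolding psi_indep_def
proof (intro conjI notI)
  show "J - X \<subseteq> E" using J by (auto simp: forest_def)
  assume "\<exists>C. topological_circle quot C \<and> circle_edges V E src tgt \<Psi> C \<subseteq> J - X"
  then obtain C where C: "topological_circle quot C" "circle_edges V E src tgt \<Psi> C \<subseteq> J - X" by blast
  have "circle_edges V E src tgt \<Psi> C \<noteq> {}" using e0 C(1) unfolding psi_indep_def by blast
  then obtain e where e: "e \<in> circle_edges V E src tgt \<Psi> C" by blast
  let ?R = "Rel (J - X - {e}) \<union> Links (J - X - {e})"
  let ?A = "{v \<in> V. (Vx (src e), Vx v) \<in> eqc ?R}"
  have eJ: "e \<in> J - X" using e C(2) by blast
  then have eE: "e \<in> E" using J by (auto simp: forest_def)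
  have "finite (insert e X)" "insert e X \<subseteq> J" using X eJ by auto
  from split_component[OF fin J span this, of "Vx (src e)"]
  have "split {v \<in> V. (Vx (src e), Vx v) \<in> eqc (Rel (J - insert e X) \<union> Links (J - insert e X))}
    {\<omega> \<in> \<Psi>. (Vx (src e), En \<omega>) \<in> eqc (Rel (J - insert e X) \<union> Links (J - insert e X))}" .
  moreover have "J - insert e X = J - X - {e}" by blast
  ultimately have sp: "split ?A {\<omega> \<in> \<Psi>. (Vx (src e), En \<omega>) \<in> eqc ?R}" by simp
  have "src e \<in> ?A" using edge_in[OF eE] by simp
  moreover have "tgt e \<notin> ?A" using bspec[OF br eJ] by (simp add: edge_pair_def)
  ultimately have cr: "(src e \<in> ?A) \<noteq> (tgt e \<in> ?A)" by blast
  from circle_crosses_split_twice[OF C(1) sp e cr] obtain f where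
    f: "f \<in> circle_edges V E src tgt \<Psi> C" "f \<noteq> e" "(src f \<in> ?A) \<noteq> (tgt f \<in> ?A)" by blast
  have fJ: "f \<in> J - X - {e}" using f C(2) by blast
  then have fE: "f \<in> E" using J by (auto simp: forest_def)
  have "edge_pair f \<in> ?R" using fJ unfolding Rel_def by blast
  then have "(Vx (src f), Vx (tgt f)) \<in> eqc ?R" unfolding edge_pair_def by (rule eqc_base)
  from eqc_cong_right[OF this, of "Vx (src e)"] f(3) edge_in[OF fE] show False by simp
qed

lemma delete_few_indep:
  assumes K: "\<forall>n R. disjoint_rays V E src tgt n R \<longrightarrow> n \<le> K"
    and F: "F \<subseteq> E" "fin_indep (psi_indep V E src tgt \<Psi>) F"
    and M: "is_matroid E (psi_indep V E src tgt \<Psi>)"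
  shows "\<exists>X. finite X \<and> card X \<le> K \<and> psi_indep V E src tgt \<Psi> (F - X)"
proof -
  obtain J where J: "forest J" "F \<subseteq> J" "\<forall>f\<in>E. edge_pair f \<in> eqc (Rel J)"
    using forest_extend_spanning[OF fin_indep_forest[OF F]] by blast
  define \<phi> where "\<phi> X \<longleftrightarrow> finite X \<and> X \<subseteq> J \<and> edge_pair ` X \<subseteq> eqc (Rel (J - X) \<union> Links (J - X))" for X
  have bound: "card X \<le> K" if "\<phi> X" for X
    using linked_edges_bound[OF K J(1), of X] that unfolding \<phi>_def by blast
  have "\<phi> {}" by (simp add: \<phi>_def)
  \<comment> \<open>The strict bound required by \<open>ex_has_greatest_nat\<close>.\<close>
  moreover have "\<forall>X. \<phi> X \<longrightarrow> card X < Suc K" using bound by (simp add: less_Suc_eq_le)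
  ultimately obtain X where X: "\<phi> X" "\<forall>Y. \<phi> Y \<longrightarrow> card Y \<le> card X"
    using Lattices_Big.ex_has_greatest_nat[of \<phi> "{}" card "Suc K"] by blast
  have X': "finite X" "X \<subseteq> J" "edge_pair ` X \<subseteq> eqc (Rel (J - X) \<union> Links (J - X))" using X(1) by (auto simp: \<phi>_def)
  have br: "\<forall>e\<in>J - X. edge_pair e \<notin> eqc (Rel (J - X - {e}) \<union> Links (J - X - {e}))"
  proof (intro ballI notI)
    fix e assume e: "e \<in> J - X" and l: "edge_pair e \<in> eqc (Rel (J - X - {e}) \<union> Links (J - X - {e}))"
    have eq: "J - insert e X = J - X - {e}" by blast
    \<comment> \<open>Deleting a redundant edge \<open>e\<close> loses no connection, so the edges
      of \<open>X\<close> stay linked and adding \<open>e\<close> to \<open>X\<close> would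
      contradict its maximal size.\<close>
    have "edge_pair ` X \<subseteq> eqc (Rel (J - X - {e}) \<union> Links (J - X - {e}))"
      using X'(3) eqc_least[OF Rel_Links_remove[OF l]] by blast
    then have "\<phi> (insert e X)" unfolding \<phi>_def eq using X' e l by simp
    then have "card (insert e X) \<le> card X" using X(2) by blast
    then show False using X'(1) e by simp
  qed
  have e0: "psi_indep V E src tgt \<Psi> {}" by (rule matroid_indep_empty[OF M])
  have JX: "psi_indep V E src tgt \<Psi> (J - X)"
    by (rule acyclic_indep[OF finite_Psi[OF K] J(1,3) X'(1,2) br e0])
  have "F - X \<subseteq> J - X" using J(2) by blast
  with JX have "psi_indep V E src tgt \<Psi> (F - X)" by (rule matroid_indep_subset[OF M])
  then show ?thesis using X'(1) bound[OF X(1)] by blast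
qed

end

theorem theorem5p1p1:
  fixes V :: "'v set" and E :: "'e set" and src tgt :: "'e \<Rightarrow> 'v"
    and \<Psi> :: "(nat \<Rightarrow> 'v) set set"
  assumes "simple_graph V E src tgt"
    and "\<not> inf_disjoint_rays V E src tgt"
    and "\<Psi> \<subseteq> graph_ends V E src tgt"
    and "is_matroid E (psi_indep V E src tgt \<Psi>)"
  shows "\<exists>k::nat. nearly_finitary k E (psi_indep V E src tgt \<Psi>)"
proof -
  interpret psi_graph V E src tgt \<Psi> using assms(1,3) by unfold_locales
  obtain K where K: "\<forall>n R. disjoint_rays V E src tgt n R \<longrightarrow> n \<le> K"
    using bounded_disjoint_rays[OF assms(2)] by blast
  have "finite (F - B) \<and> card (F - B) \<le> K"
    if F: "is_base E (\<lambda>I. I \<subseteq> E \<and> fin_indep (psi_indep V E src tgt \<Psi>) I) F"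
      and B: "is_base E (psi_indep V E src tgt \<Psi>) B" "B \<subseteq> F" for F B
  proof -
    have F': "F \<subseteq> E" "fin_indep (psi_indep V E src tgt \<Psi>) F"
      using F unfolding is_base_def maximal_in_def by blast+
    obtain X where X: "finite X" "card X \<le> K" "psi_indep V E src tgt \<Psi> (F - X)"
      using delete_few_indep[OF K F' assms(4)] by blast
    show ?thesis
      using matroid_corank_bound[OF assms(4) F'(1) B(1)[unfolded is_base_def] B(2) X(1,3)] X(2) by linarith
  qed
  then show ?thesis unfolding nearly_finitary_def by blast
qed

end
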